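(* Let $(A,B)$ be a table algebra, let $C$ be a closed subset of $B$, let $e=|C^+|^{-1}C^+$ and $\mathcal{H}=eAe$, the algebra of the quotient table algebra $(A/C,B/C)$. Let $\chi\in\mathrm{Irr}(A)$. If $\chi|_{\mathcal{H}}\neq 0$, then the standard feasible multiplicity of $\chi|_{\mathcal{H}}$ (with respect to $(A/C,B/C)$) is equal to the standard feasible multiplicity of $\chi$ (with respect to $(A,B)$).
   Context: A C-algebra (not necessarily commutative) is a pair $(A,B)$, where $A$ is a finite dimensional associative algebra over $\mathbb{C}$ with identity $1_A$ and $B$ is a linear basis of $A$, such that: (I) $1_A\in B$ and the structure constants $\lambda_{abc}$ defined by $ab=\sum_{c\in B}\lambda_{abc}c$ ($a,b\in B$) are real; (II) there is a semilinear involutory anti-automorphism $*$ of $A$ with $B^*=B$; (III) for $a,b\in B$, $\lambda_{ab1_A}=\delta_{ab^*}|a|$ with $|a|>0$; (IV) the map $b\mapsto |b|$, $b\in B$, is (extends linearly to) a one-dimensional $*$-linear representation of $A$, called the degree map. $A$ is then semisimple. A table algebra is a C-algebra whose structure constants are all nonnegative. $\mathrm{Irr}(A)$ is the set of irreducible characters of $A$. For $S\subseteq B$ put $S^+=\sum_{s\in S}s$ and $|S^+|=\sum_{s\in S}|s|$. The standard feasible trace of a C-algebra $(A,B)$ is the linear function $\zeta:A\to\mathbb{C}$ with $\zeta(b)=\delta_{1_A b}|B^+|$ for $b\in B$. It can be written uniquely as $\zeta=\sum_{\chi\in\mathrm{Irr}(A)}\zeta_\chi\chi$ with nonzero $\zeta_\chi\in\mathbb{C}$;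 $\zeta_\chi$ is called the standard feasible multiplicity of $\chi$. For subsets $S,T\subseteq B$, $ST$ denotes the set of basis elements occurring with nonzero coefficient in some product $st$, $s\in S$, $t\in T$. A nonempty $C\subseteq B$ is a closed subset if $C^*C\subseteq C$. The sets $CbC$ ($b\in B$) partition $B$ ($C$-double cosets). Put $b/C=|C^+|^{-1}(CbC)^+$ and $B/C=\{b/C: b\in B\}$. The linear span $A/C$ of $B/C$, with distinguished basis $B/C$, is a table algebra, called the quotient table algebra of $(A,B)$ modulo $C$. The element $e=|C^+|^{-1}C^+$ is an idempotent, $A/C=eAe=\mathcal{H}$, and $e$ is its identity. If $\chi\in\mathrm{Irr}(A)$ and $\chi|_{\mathcal{H}}\ne0$ then $\chi|_{\mathcal{H}}$ is an irreducible character of $\mathcal{H}$. *)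

theory Defs
  imports Jordan_Normal_Form.VS_Connect "HOL-Library.FuncSet"
begin

text \<open>
  An algebra is given by a carrier inside an ambient (not necessarily unital) associative complex
  algebra on the type \<open>'a\<close>, together with its own identity element. This is because \<open>e A e\<close>
  and \<open>A\<close> have different identities. Taking the carrier to be everything recovers an algebra on a
  whole type.
\<close>

locale complex_algebra = vector_space scale
  for scale :: "complex \<Rightarrow> 'a::ring \<Rightarrow> 'a"  (infixr \<open>*\<^sub>C\<close> 75) +
  assumes scale_mult_left: "(c *\<^sub>C x) * y = c *\<^sub>C (x * y)"
    and scale_mult_right: "x * (c *\<^sub>C y) = c *\<^sub>C (x * y)"
begin

subsection \<open>Structure constants, degrees, products of subsets\<close>

definition structure_const :: "'a set \<Rightarrow> 'a \<Rightarrow> 'a \<Rightarrow> 'a \<Rightarrow> complex" where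
  "structure_const B a b c = representation B (a * b) c"

text \<open>
  Axiom (III) of C-algebras forces \<open>|b|\<close> to be the coefficient of the identity in \<open>b b*\<close>, which
  is used here to define \<open>|b|\<close>. Throughout, \<open>u\<close> is the
  identity of the algebra under consideration and \<open>st\<close> its involution.
\<close>

definition basis_degree :: "'a \<Rightarrow> ('a \<Rightarrow> 'a) \<Rightarrow> 'a set \<Rightarrow> 'a \<Rightarrow> real" where
  "basis_degree u st B b = Re (structure_const B b (st b) u)"

definition set_degree :: "'a \<Rightarrow> ('a \<Rightarrow> 'a) \<Rightarrow> 'a set \<Rightarrow> 'a set \<Rightarrow> real" where
  "set_degree u st B S = (\<Sum>s\<in>S. basis_degree u st B s)"

definition degree_map :: "'a \<Rightarrow> ('a \<Rightarrow> 'a) \<Rightarrow> 'a set \<Rightarrow> 'a \<Rightarrow> complex" where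
  "degree_map u st B x = (\<Sum>b\<in>B. representation B x b * complex_of_real (basis_degree u st B b))"

definition set_prod :: "'a set \<Rightarrow> 'a set \<Rightarrow> 'a set \<Rightarrow> 'a set" where
  "set_prod B S T = {c \<in> B. \<exists>s\<in>S. \<exists>t\<in>T. structure_const B s t c \<noteq> 0}"

definition closed_subset :: "('a \<Rightarrow> 'a) \<Rightarrow> 'a set \<Rightarrow> 'a set \<Rightarrow> bool" where
  "closed_subset st B C \<longleftrightarrow> C \<subseteq> B \<and> C \<noteq> {} \<and> set_prod B (st ` C) C \<subseteq> C"

definition double_coset :: "'a set \<Rightarrow> 'a set \<Rightarrow> 'a \<Rightarrow> 'a set" where
  "double_coset B C b = set_prod B (set_prod B C {b}) C"

definition quotient_elem :: "'a \<Rightarrow> ('a \<Rightarrow> 'a) \<Rightarrow> 'a set \<Rightarrow> 'a set \<Rightarrow> 'a \<Rightarrow> 'a" where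
  "quotient_elem u st B C b =
     complex_of_real (inverse (set_degree u st B C)) *\<^sub>C (\<Sum>x\<in>double_coset B C b. x)"

definition quotient_basis :: "'a \<Rightarrow> ('a \<Rightarrow> 'a) \<Rightarrow> 'a set \<Rightarrow> 'a set \<Rightarrow> 'a set" where
  "quotient_basis u st B C = quotient_elem u st B C ` B"

subsection \<open>Irreducible characters\<close>

definition is_representation :: "'a set \<Rightarrow> 'a \<Rightarrow> nat \<Rightarrow> ('a \<Rightarrow> complex mat) \<Rightarrow> bool" where
  "is_representation A u n \<rho> \<longleftrightarrow>
     (\<forall>x\<in>A. \<rho> x \<in> carrier_mat n n) \<and>
     (\<forall>x\<in>A. \<forall>y\<in>A. \<rho> (x + y) = \<rho> x + \<rho> y) \<and>
     (\<forall>c. \<forall>x\<in>A. \<rho> (c *\<^sub>C x) = c \<cdot>\<^sub>m \<rho> x) \<and>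
     (\<forall>x\<in>A. \<forall>y\<in>A. \<rho> (x * y) = \<rho> x * \<rho> y) \<and>
     \<rho> u = 1\<^sub>m n"

definition is_irreducible_rep :: "'a set \<Rightarrow> 'a \<Rightarrow> nat \<Rightarrow> ('a \<Rightarrow> complex mat) \<Rightarrow> bool" where
  "is_irreducible_rep A u n \<rho> \<longleftrightarrow>
     is_representation A u n \<rho> \<and> 0 < n \<and>
     (\<forall>W. VectorSpace.subspace class_ring W (module_vec TYPE(complex) n) \<longrightarrow>
        (\<forall>x\<in>A. \<forall>w\<in>W. \<rho> x *\<^sub>v w \<in> W) \<longrightarrow> W = {0\<^sub>v n} \<or> W = carrier_vec n)"

definition mat_trace :: "complex mat \<Rightarrow> complex" where
  "mat_trace M = (\<Sum>i<dim_row M. M $$ (i, i))"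

text \<open>
  Characters are restricted to the carrier (and undefined outside it), so that equality of
  characters is equality of functions on the carrier.
\<close>

definition Irr :: "'a set \<Rightarrow> 'a \<Rightarrow> ('a \<Rightarrow> complex) set" where
  "Irr A u = {\<chi>. \<exists>n \<rho>. is_irreducible_rep A u n \<rho> \<and> \<chi> = restrict (\<lambda>x. mat_trace (\<rho> x)) A}"

subsection \<open>Standard feasible trace and multiplicities\<close>

definition std_feasible_trace :: "'a \<Rightarrow> ('a \<Rightarrow> 'a) \<Rightarrow> 'a set \<Rightarrow> 'a \<Rightarrow> complex" where
  "std_feasible_trace u st B x = representation B x u * complex_of_real (set_degree u st B B)"

text \<open>
  The coefficient family is a function on \<open>Irr A u\<close>; membership in \<open>extensional\<close> only fixes its
  values elsewhere, so that the family is unique as a total function.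
\<close>

definition std_feasible_mult ::
  "'a set \<Rightarrow> 'a \<Rightarrow> ('a \<Rightarrow> 'a) \<Rightarrow> 'a set \<Rightarrow> ('a \<Rightarrow> complex) \<Rightarrow> complex" where
  "std_feasible_mult A u st B =
     (THE m. m \<in> extensional (Irr A u) \<and>
        (\<forall>x\<in>A. std_feasible_trace u st B x = (\<Sum>\<chi>\<in>Irr A u. m \<chi> * \<chi> x)))"

end

subsection \<open>C-algebras and table algebras\<close>

locale C_algebra = complex_algebra scale
  for scale :: "complex \<Rightarrow> 'a::ring \<Rightarrow> 'a"  (infixr \<open>*\<^sub>C\<close> 75) +
  fixes A :: "'a set" and u :: 'a and st :: "'a \<Rightarrow> 'a" and B :: "'a set"
  assumes finite_basis: "finite B"
    and independent_basis: "independent B"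
    and span_basis: "span B = A"
    and mult_closed: "\<lbrakk>x \<in> A; y \<in> A\<rbrakk> \<Longrightarrow> x * y \<in> A"
    and one_left: "x \<in> A \<Longrightarrow> u * x = x"
    and one_right: "x \<in> A \<Longrightarrow> x * u = x"
    and one_in_basis: "u \<in> B"
    and structure_const_real:
      "\<lbrakk>a \<in> B; b \<in> B; c \<in> B\<rbrakk> \<Longrightarrow> structure_const B a b c \<in> \<real>"
    and star_add: "\<lbrakk>x \<in> A; y \<in> A\<rbrakk> \<Longrightarrow> st (x + y) = st x + st y"
    and star_scale: "x \<in> A \<Longrightarrow> st (k *\<^sub>C x) = cnj k *\<^sub>C st x"
    and star_mult: "\<lbrakk>x \<in> A; y \<in> A\<rbrakk> \<Longrightarrow> st (x * y) = st y * st x"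
    and star_star: "x \<in> A \<Longrightarrow> st (st x) = x"
    and star_basis: "st ` B = B"
    and structure_const_one: "\<lbrakk>a \<in> B; b \<in> B\<rbrakk> \<Longrightarrow>
      structure_const B a b u = (if a = st b then complex_of_real (basis_degree u st B a) else 0)"
    and degree_pos: "a \<in> B \<Longrightarrow> 0 < basis_degree u st B a"
    and degree_one: "degree_map u st B u = 1"
    and degree_mult: "\<lbrakk>x \<in> A; y \<in> A\<rbrakk> \<Longrightarrow>
      degree_map u st B (x * y) = degree_map u st B x * degree_map u st B y"
    and degree_star: "x \<in> A \<Longrightarrow> degree_map u st B (st x) = cnj (degree_map u st B x)"

locale table_algebra = C_algebra +
  assumes structure_const_nonneg:
    "\<lbrakk>a \<in> B; b \<in> B; c \<in> B\<rbrakk> \<Longrightarrow> 0 \<le> Re (structure_const B a b c)"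

end

theory Submission
  imports Defs Jordan_Normal_Form.Spectral_Radius
begin

text \<open>
  Both \<open>A\<close> and the corner \<open>e A e\<close> carry the trace \<open>\<tau>\<close> reading off the coefficient of the identity of \<open>A\<close>,
  which makes \<open>(x, y) \<mapsto> \<tau> (x y*)\<close> a definite form with orthogonal bases \<open>B\<close> and \<open>B/C\<close>. The Casimir element
  \<open>\<Sum> b \<otimes> b* / \<tau> (b b*)\<close> of such an algebra yields Schur orthogonality, so the irreducible characters are
  finitely many and linearly independent, and every trace functional is a combination of them: a central
  element orthogonal to all of them dies in every irreducible representation, hence is zero by definiteness.

  The standard feasible trace of \<open>B/C\<close> turns out to be the restriction of that of \<open>B\<close>. Restricting
  \<open>\<zeta> = \<Sum> \<zeta>\<^sub>\<chi> \<chi>\<close> to \<open>e A e\<close>, where the nonzero restrictions are irreducible and pairwise distinct, gives the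
  decomposition of the trace of \<open>B/C\<close>, and the multiplicities agree by uniqueness.
\<close>

subsection \<open>Subspaces of coordinate space\<close>

text \<open>A multiplicity is defined by a \<open>THE\<close> over families on all of
  \<open>Irr\<close>, so existence and uniqueness are owed for \<open>A\<close> and for the corner
  alike. Hence the general theory lives in one locale, \<open>tracial_star_algebra\<close>, which
  sees the basis only through its span and inner products. For the corner, \<open>\<tau>\<close>
  remains the coordinate at \<open>u\<close> although the identity is \<open>e\<close>, so
  \<open>\<tau> e = 1 / |C^+|\<close>. This constant explains why the two standard traces agree:
  passing from \<open>\<tau> x\<close> to the coefficient of \<open>e\<close> in \<open>B/C\<close>
  multiplies by \<open>|C^+|\<close>, whereas the total degree of \<open>B/C\<close> is
  \<open>|B^+| / |C^+|\<close>. Nonnegativity of the structure constants enters through double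
  cosets: it excludes cancellation, so that \<open>C b C\<close> is exactly the support of
  \<open>e b e\<close>, and \<open>x -> e x e\<close> becomes an averaging operator. Irreducibility
  speaks of invariant subspaces of \<open>carrier_vec\<close>, so subspaces are handled by a pair of
  matrices, an embedding \<open>S\<close> and a retraction \<open>R\<close> with
  \<open>R * S = 1\<close>.\<close>

lemma left_inverse_dim_le:
  fixes R S :: "'a::field mat"
  assumes R: "R \<in> carrier_mat k n" and S: "S \<in> carrier_mat n k" and RS: "R * S = 1\<^sub>m k"
  shows "k \<le> n"
proof (rule ccontr)
  assume "\<not> k \<le> n"
  then have nk: "n < k" by simp
  \<comment> \<open>Padding both matrices with zeros to size \<open>k\<close> keeps the product
    \<open>1\<close>, and square one-sided inverses are two-sided. But row \<open>n\<close> of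
    \<open>S'\<close> is zero, so \<open>S' * R'\<close> cannot have \<open>1\<close> at
    \<open>(n,n)\<close>.\<close>
  define S' where "S' = mat k k (\<lambda>(i,j). if i < n then S $$ (i,j) else 0)"
  define R' where "R' = mat k k (\<lambda>(i,j). if j < n then R $$ (i,j) else 0)"
  have cS: "S' \<in> carrier_mat k k" and cR: "R' \<in> carrier_mat k k" by (auto simp: S'_def R'_def)
  have "R' * S' = 1\<^sub>m k"
  proof (rule eq_matI)
    fix i j assume "i < dim_row (1\<^sub>m k :: 'a mat)" "j < dim_col (1\<^sub>m k :: 'a mat)"
    then have ij: "i < k" "j < k" by auto
    have "(R' * S') $$ (i,j) = (\<Sum>p\<in>{0..<k}. R' $$ (i,p) * S' $$ (p,j))"
      using ij cS cR by (simp add: scalar_prod_def)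
    also have "\<dots> = (\<Sum>p\<in>{0..<n}. R $$ (i,p) * S $$ (p,j))"
      using ij nk by (intro sum.mono_neutral_cong_right) (auto simp: S'_def R'_def)
    also have "\<dots> = (R * S) $$ (i,j)" using ij R S by (simp add: scalar_prod_def)
    finally show "(R' * S') $$ (i,j) = (1\<^sub>m k :: 'a mat) $$ (i,j)" using RS by simp
  qed (use cS cR in auto)
  then have "S' * R' = 1\<^sub>m k" using mat_mult_left_right_inverse[OF cR cS] by simp
  then have "(S' * R') $$ (n,n) = 1" using nk by simp
  moreover have "(S' * R') $$ (n,n) = 0"
    using nk cS cR by (auto simp: scalar_prod_def S'_def R'_def)
  ultimately show False by simp
qed

text \<open>Coordinates on a subspace: the columns of \<open>S\<close> form a basis of
  \<open>W\<close>, and \<open>S * R\<close> is a projection onto \<open>W\<close>. The family of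
  columns is grown while it has a left inverse, which bounds its length by \<open>n\<close>; a
  maximal one must span \<open>W\<close>.\<close>

lemma subspace_retraction:
  fixes W :: "'a::field vec set"
  assumes W: "W \<subseteq> carrier_vec n" and W0: "0\<^sub>v n \<in> W"
    and Wadd: "\<And>v w. v \<in> W \<Longrightarrow> w \<in> W \<Longrightarrow> v + w \<in> W"
    and Wsmult: "\<And>c v. v \<in> W \<Longrightarrow> c \<cdot>\<^sub>v v \<in> W"
  obtains k S R where "S \<in> carrier_mat n k" "R \<in> carrier_mat k n" "R * S = 1\<^sub>m k"
    "\<forall>v\<in>carrier_vec k. S *\<^sub>v v \<in> W" "\<forall>w\<in>W. S *\<^sub>v (R *\<^sub>v w) = w"
proof -
  define P where "P k \<longleftrightarrow> (\<exists>S R. S \<in> carrier_mat n k \<and> R \<in> carrier_mat k n \<and> R * S = 1\<^sub>m k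
      \<and> (\<forall>v\<in>carrier_vec k. S *\<^sub>v v \<in> W))" for k
  have P0: "P 0"
    unfolding P_def
  proof (intro exI conjI ballI)
    show "(0\<^sub>m n 0 :: 'a mat) \<in> carrier_mat n 0" "(0\<^sub>m 0 n :: 'a mat) \<in> carrier_mat 0 n" by auto
    show "0\<^sub>m 0 n * 0\<^sub>m n 0 = (1\<^sub>m 0 :: 'a mat)" by (rule eq_matI) auto
    fix v :: "'a vec" assume "v \<in> carrier_vec 0"
    then have "0\<^sub>m n 0 *\<^sub>v v = 0\<^sub>v n" by (intro eq_vecI) (auto simp: scalar_prod_def)
    with W0 show "0\<^sub>m n 0 *\<^sub>v v \<in> W" by simp
  qed
  have bound: "P k \<Longrightarrow> k \<le> n" for k
    unfolding P_def using left_inverse_dim_le by blast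
  define k where "k = (GREATEST k. P k)"
  have Pk: "P k" unfolding k_def using P0 bound by (rule GreatestI_nat)
  have not_Suc: "\<not> P (Suc k)"
    using Greatest_le_nat[of P "Suc k" n] bound by (auto simp: k_def)
  from Pk obtain S R where S: "S \<in> carrier_mat n k" and R: "R \<in> carrier_mat k n"
    and RS: "R * S = 1\<^sub>m k" and SW: "\<And>v. v \<in> carrier_vec k \<Longrightarrow> S *\<^sub>v v \<in> W"
    unfolding P_def by blast
  have "S *\<^sub>v (R *\<^sub>v w) = w" if w: "w \<in> W" for w
  proof (rule ccontr)
    assume neq: "S *\<^sub>v (R *\<^sub>v w) \<noteq> w"
    have wc: "w \<in> carrier_vec n" using w W by auto
    have Rwc: "R *\<^sub>v w \<in> carrier_vec k" using R by (intro carrier_vecI) auto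
    have SRw: "S *\<^sub>v (R *\<^sub>v w) \<in> carrier_vec n" using S by (intro carrier_vecI) auto
    \<comment> \<open>\<open>x\<close> is the part of \<open>w\<close> killed by \<open>R\<close>;
      it lies in \<open>W\<close> but outside the range of \<open>S\<close> and becomes the next
      column.\<close>
    define x where "x = w + (-1) \<cdot>\<^sub>v (S *\<^sub>v (R *\<^sub>v w))"
    have xW: "x \<in> W" unfolding x_def using w SW[OF Rwc] Wadd Wsmult by blast
    then have xc: "x \<in> carrier_vec n" using W by auto
    have "R *\<^sub>v (S *\<^sub>v (R *\<^sub>v w)) = (R * S) *\<^sub>v (R *\<^sub>v w)"
      using R S Rwc by (simp add: assoc_mult_mat_vec[of R k n S k])
    then have RSR: "R *\<^sub>v (S *\<^sub>v (R *\<^sub>v w)) = R *\<^sub>v w" using RS Rwc by simp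
    have Rx: "R *\<^sub>v x = 0\<^sub>v k"
      unfolding x_def using R wc SRw RSR Rwc
      by (simp add: mult_add_distrib_mat_vec[of R k n] mult_mat_vec[of R k n]) (intro eq_vecI, auto)
    have xi: "x $ i = w $ i - (S *\<^sub>v (R *\<^sub>v w)) $ i" if "i < n" for i
      using that wc S by (simp add: x_def del: index_mult_mat_vec)
    have "x \<noteq> 0\<^sub>v n"
    proof
      assume "x = 0\<^sub>v n"
      then have "w $ i = (S *\<^sub>v (R *\<^sub>v w)) $ i" if "i < n" for i
        using xi[OF that] that by (simp del: index_mult_mat_vec)
      then have "w = S *\<^sub>v (R *\<^sub>v w)"
        using wc SRw S by (intro eq_vecI) (auto simp del: index_mult_mat_vec)
      with neq show False by simp
    qed
    then obtain p where p: "p < n" "x $ p \<noteq> 0"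
      using xc by (metis carrier_vecD eq_vecI index_zero_vec(1) index_zero_vec(2))
    define S' where "S' = mat n (Suc k) (\<lambda>(i,j). if j < k then S $$ (i,j) else x $ i)"
    \<comment> \<open>The new row is the functional \<open>v -> (v - S R v) $ p / x $ p\<close>,
      which vanishes on the columns of \<open>S\<close> and takes the value \<open>1\<close> at
      \<open>x\<close>.\<close>
    define R' where "R' = mat (Suc k) n (\<lambda>(i,j). if i < k then R $$ (i,j)
        else ((if j = p then 1 else 0) - (S * R) $$ (p,j)) / x $ p)"
    have cS: "S' \<in> carrier_mat n (Suc k)" and cR: "R' \<in> carrier_mat (Suc k) n"
      by (auto simp: S'_def R'_def)
    have colS: "col S' j = (if j < k then col S j else x)" if "j < Suc k" for j
      using that S xc by (intro eq_vecI) (auto simp: S'_def)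
    have rowR: "row R' i = (if i < k then row R i
        else (1 / x $ p) \<cdot>\<^sub>v (unit_vec n p - row (S * R) p))" if "i < Suc k" for i
      using that S R p by (intro eq_vecI) (auto simp: R'_def unit_vec_def field_simps)
    have proj: "((1 / x $ p) \<cdot>\<^sub>v (unit_vec n p - row (S * R) p)) \<bullet> v
        = (v $ p - (S *\<^sub>v (R *\<^sub>v v)) $ p) / x $ p" if v: "v \<in> carrier_vec n" for v
    proof -
      have r: "row (S * R) p \<in> carrier_vec n" using R by (intro carrier_vecI) auto
      have "(unit_vec n p - row (S * R) p) \<bullet> v = v $ p - row (S * R) p \<bullet> v"
        using minus_scalar_prod_distrib[OF unit_vec_carrier r v] scalar_prod_left_unit[OF v p(1)]
        by simp
      moreover have "row (S * R) p \<bullet> v = ((S * R) *\<^sub>v v) $ p" using S p by simp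
      moreover have "(S * R) *\<^sub>v v = S *\<^sub>v (R *\<^sub>v v)" using S R v by (rule assoc_mult_mat_vec)
      ultimately show ?thesis
        using smult_scalar_prod_distrib[of "unit_vec n p - row (S * R) p" n v "1 / x $ p"] r v by simp
    qed
    have "R' * S' = 1\<^sub>m (Suc k)"
    proof (rule eq_matI)
      fix i j assume "i < dim_row (1\<^sub>m (Suc k) :: 'a mat)" "j < dim_col (1\<^sub>m (Suc k) :: 'a mat)"
      then have ij: "i < Suc k" "j < Suc k" by auto
      have e: "(R' * S') $$ (i,j) = row R' i \<bullet> col S' j" using ij cS cR by simp
      have Rcol: "R *\<^sub>v col S j = unit_vec k j" if "j < k"
        using RS that R S by (metis col_mult2 col_one)
      have Scol: "S *\<^sub>v unit_vec k j = col S j" if "j < k"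
        using S that by (intro eq_vecI) (auto simp: scalar_prod_right_unit)
      consider "i < k" "j < k" | "i < k" "j = k" | "i = k" "j < k" | "i = k" "j = k"
        using ij by linarith
      then show "(R' * S') $$ (i,j) = (1\<^sub>m (Suc k) :: 'a mat) $$ (i,j)"
      proof cases
        case 1
        then have "row R i \<bullet> col S j = (R * S) $$ (i,j)" using R S by simp
        then show ?thesis using 1 e colS[of j] rowR[of i] RS by simp
      next
        case 2
        then have "row R i \<bullet> x = (R *\<^sub>v x) $ i" using R by simp
        then show ?thesis using 2 e colS[of j] rowR[of i] Rx by simp
      next
        case 3
        have "col S j \<in> carrier_vec n" using S by auto
        then show ?thesis using 3 e colS[of j] rowR[of i] proj[of "col S j"] Rcol Scol by simp
      next
        case 4
        have "S *\<^sub>v (0\<^sub>v k) = 0\<^sub>v n" using S by (intro eq_vecI) auto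
        then show ?thesis using 4 e colS[of j] rowR[of i] proj[of x] Rx xc p by simp
      qed
    qed (use cS cR in auto)
    moreover have "S' *\<^sub>v v \<in> W" if v: "v \<in> carrier_vec (Suc k)" for v
    proof -
      define v' where "v' = vec k (\<lambda>i. v $ i)"
      have "S' *\<^sub>v v = S *\<^sub>v v' + (v $ k) \<cdot>\<^sub>v x"
        using v S xc by (intro eq_vecI) (auto simp: S'_def v'_def scalar_prod_def mult.commute)
      then show ?thesis using SW[of v'] xW Wadd Wsmult by (auto simp: v'_def)
    qed
    ultimately have "P (Suc k)" unfolding P_def using cS cR by blast
    with not_Suc show False ..
  qed
  with S R RS SW show ?thesis using that by blast
qed

lemma subspace_module_vec_iff:
  "VectorSpace.subspace class_ring W (module_vec TYPE('a::field) n) \<longleftrightarrow>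
    W \<subseteq> carrier_vec n \<and> 0\<^sub>v n \<in> W \<and> (\<forall>v\<in>W. \<forall>w\<in>W. v + w \<in> W) \<and> (\<forall>c. \<forall>v\<in>W. c \<cdot>\<^sub>v v \<in> W)"
proof -
  have "submodule class_ring W (module_vec TYPE('a) n) \<longleftrightarrow>
    W \<subseteq> carrier_vec n \<and> 0\<^sub>v n \<in> W \<and> (\<forall>v\<in>W. \<forall>w\<in>W. v + w \<in> W) \<and> (\<forall>c. \<forall>v\<in>W. c \<cdot>\<^sub>v v \<in> W)"
    using vec_module[of n] by (auto simp: submodule_def module_vec_def)
  then show ?thesis using vec_vs[of n] by (auto simp: VectorSpace.subspace_def)
qed

lemma mat_eq_if_mult_vec_eq:
  fixes X Y :: "'a::semiring_1 mat"
  assumes "X \<in> carrier_mat n m" "Y \<in> carrier_mat n m"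
    and eq: "\<And>v. v \<in> carrier_vec m \<Longrightarrow> X *\<^sub>v v = Y *\<^sub>v v"
  shows "X = Y"
proof (rule eq_matI)
  fix i j assume "i < dim_row Y" "j < dim_col Y"
  then have ij: "i < n" "j < m" using assms by auto
  have "(X *\<^sub>v unit_vec m j) $ i = (Y *\<^sub>v unit_vec m j) $ i" using eq[of "unit_vec m j"] by simp
  then show "X $$ (i,j) = Y $$ (i,j)" using assms(1,2) ij by simp
qed (use assms(1,2) in auto)

subsection \<open>Representations and intertwiners\<close>

context complex_algebra
begin

lemma mat_trace_mult_comm:
  assumes "X \<in> carrier_mat n m" "Y \<in> carrier_mat m n"
  shows "mat_trace (X * Y) = mat_trace (Y * X)"
proof -
  have "mat_trace (X * Y) = (\<Sum>i<n. \<Sum>j<m. X $$ (i,j) * Y $$ (j,i))"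
    using assms by (simp add: mat_trace_def scalar_prod_def lessThan_atLeast0)
  also have "\<dots> = (\<Sum>j<m. \<Sum>i<n. Y $$ (j,i) * X $$ (i,j))"
    by (subst sum.swap) (simp add: mult.commute)
  also have "\<dots> = mat_trace (Y * X)"
    using assms by (simp add: mat_trace_def scalar_prod_def lessThan_atLeast0)
  finally show ?thesis .
qed

lemma mat_trace_eq_if_intertwined:
  assumes X: "X \<in> carrier_mat n n" and Y: "Y \<in> carrier_mat m m" and T: "T \<in> carrier_mat n m"
    and R: "R \<in> carrier_mat m n" and TR: "T * R = 1\<^sub>m n" and RT: "R * T = 1\<^sub>m m"
    and eq: "X * T = T * Y"
  shows "mat_trace X = mat_trace Y"
proof -
  have "mat_trace Y = mat_trace ((R * T) * Y)" using RT Y by simp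
  also have "(R * T) * Y = R * (X * T)" using R T Y by (simp add: eq)
  also have "mat_trace \<dots> = mat_trace ((X * T) * R)"
    by (rule mat_trace_mult_comm) (use R T X in auto)
  also have "(X * T) * R = X" using X T R TR by (simp add: assoc_mult_mat[of X n n T m R n])
  finally show ?thesis by simp
qed

definition functional_on :: "'a set \<Rightarrow> ('a \<Rightarrow> complex) \<Rightarrow> bool" where
  "functional_on A f \<longleftrightarrow> (\<forall>x\<in>A. \<forall>y\<in>A. f (x + y) = f x + f y) \<and> (\<forall>c. \<forall>x\<in>A. f (c *\<^sub>C x) = c * f x)"

lemma functional_on_sum:
  assumes "functional_on A f" and "subspace A" and "finite I" and "\<And>i. i \<in> I \<Longrightarrow> g i \<in> A"
  shows "f (\<Sum>i\<in>I. c i *\<^sub>C g i) = (\<Sum>i\<in>I. c i * f (g i))"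
  using assms(3,4)
proof (induction I rule: finite_induct)
  case empty
  have "f (0 *\<^sub>C 0) = 0 * f 0" using assms(1,2) subspace_0 unfolding functional_on_def by blast
  then show ?case by simp
next
  case (insert i I)
  have "f (c i *\<^sub>C g i + (\<Sum>i\<in>I. c i *\<^sub>C g i)) = f (c i *\<^sub>C g i) + f (\<Sum>i\<in>I. c i *\<^sub>C g i)"
    using assms(1) subspace_scale[OF assms(2)] subspace_sum[OF assms(2), of I "\<lambda>i. c i *\<^sub>C g i"] insert.prems
    unfolding functional_on_def by blast
  then show ?case using insert assms(1) unfolding functional_on_def by simp
qed

lemma functional_on_diff_sum:
  assumes "functional_on A f" "\<And>i. i \<in> I \<Longrightarrow> functional_on A (g i)"
  shows "functional_on A (\<lambda>x. f x - (\<Sum>i\<in>I. c i * g i x))"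
  using assms
  by (simp add: functional_on_def sum.distrib sum_distrib_left algebra_simps)

lemma representation_functional:
  assumes rep: "is_representation A u n \<rho>" and "i < n" "j < n"
  shows "functional_on A (\<lambda>x. \<rho> x $$ (i,j))"
  unfolding functional_on_def
proof (intro conjI ballI allI)
  fix x y assume xy: "x \<in> A" "y \<in> A"
  then have "\<rho> (x + y) = \<rho> x + \<rho> y" "\<rho> x \<in> carrier_mat n n" "\<rho> y \<in> carrier_mat n n"
    using rep by (auto simp: is_representation_def)
  then show "\<rho> (x + y) $$ (i,j) = \<rho> x $$ (i,j) + \<rho> y $$ (i,j)" using assms by simp
next
  fix c x assume x: "x \<in> A"
  then have "\<rho> (c *\<^sub>C x) = c \<cdot>\<^sub>m \<rho> x" "\<rho> x \<in> carrier_mat n n"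
    using rep by (auto simp: is_representation_def)
  then show "\<rho> (c *\<^sub>C x) $$ (i,j) = c * \<rho> x $$ (i,j)" using assms by simp
qed

lemma representation_mult_entry:
  assumes rep: "is_representation A u n \<rho>" and "x \<in> A" "y \<in> A" "i < n" "j < n"
  shows "\<rho> (x * y) $$ (i,j) = (\<Sum>p<n. \<rho> x $$ (i,p) * \<rho> y $$ (p,j))"
proof -
  have "\<rho> (x * y) = \<rho> x * \<rho> y" "\<rho> x \<in> carrier_mat n n" "\<rho> y \<in> carrier_mat n n"
    using assms by (auto simp: is_representation_def)
  then show ?thesis using assms by (simp add: scalar_prod_def lessThan_atLeast0)
qed

lemma mat_trace_representation:
  assumes "is_representation A u n \<rho>" and "x \<in> A"
  shows "mat_trace (\<rho> x) = (\<Sum>i<n. \<rho> x $$ (i,i))"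
proof -
  have "\<rho> x \<in> carrier_mat n n" using assms by (auto simp: is_representation_def)
  then show ?thesis by (simp add: mat_trace_def)
qed

lemma irreducible_rep_subspace:
  assumes irr: "is_irreducible_rep A u n \<rho>"
    and "W \<subseteq> carrier_vec n" "0\<^sub>v n \<in> W" "\<And>v w. v \<in> W \<Longrightarrow> w \<in> W \<Longrightarrow> v + w \<in> W"
      "\<And>c v. v \<in> W \<Longrightarrow> c \<cdot>\<^sub>v v \<in> W" "\<And>x w. x \<in> A \<Longrightarrow> w \<in> W \<Longrightarrow> \<rho> x *\<^sub>v w \<in> W"
  shows "W = {0\<^sub>v n} \<or> W = carrier_vec n"
proof -
  have "VectorSpace.subspace class_ring W (module_vec TYPE(complex) n)"
    using assms(2-5) unfolding subspace_module_vec_iff by blast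
  then show ?thesis using irr assms(6) unfolding is_irreducible_rep_def by blast
qed

lemma smult_mult_mat_vec:
  assumes "M \<in> carrier_mat n m" "v \<in> carrier_vec m"
  shows "(c \<cdot>\<^sub>m M) *\<^sub>v v = (c::complex) \<cdot>\<^sub>v (M *\<^sub>v v)"
  using assms by (intro eq_vecI) auto

text \<open>Half of Schur's lemma: the kernel of \<open>T\<close> is
  \<open>\<sigma>\<close>-invariant and is not everything. Irreducibility is asked of the source
  alone, so that the target may be a representation not yet known to be irreducible, such as the
  adjoint of \<open>\<sigma>\<close>.\<close>

lemma intertwiner_injective:
  assumes irr: "is_irreducible_rep A u m \<sigma>" and T: "T \<in> carrier_mat n m" and T0: "T \<noteq> 0\<^sub>m n m"
    and \<rho>: "\<And>x. x \<in> A \<Longrightarrow> \<rho> x \<in> carrier_mat n n"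
    and comm: "\<And>x. x \<in> A \<Longrightarrow> \<rho> x * T = T * \<sigma> x"
    and v: "v \<in> carrier_vec m" "T *\<^sub>v v = 0\<^sub>v n"
  shows "v = 0\<^sub>v m"
proof -
  have \<sigma>: "\<sigma> x \<in> carrier_mat m m" if "x \<in> A" for x
    using irr that by (auto simp: is_irreducible_rep_def is_representation_def)
  define W where "W = {v \<in> carrier_vec m. T *\<^sub>v v = 0\<^sub>v n}"
  have "W = {0\<^sub>v m} \<or> W = carrier_vec m"
  proof (rule irreducible_rep_subspace[OF irr])
    show "W \<subseteq> carrier_vec m" by (auto simp: W_def)
    show "0\<^sub>v m \<in> W" using T by (auto simp: W_def intro!: eq_vecI)
    show "v + w \<in> W" if "v \<in> W" "w \<in> W" for v w
      using that T by (auto simp: W_def mult_add_distrib_mat_vec[of T n m])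
    show "c \<cdot>\<^sub>v v \<in> W" if "v \<in> W" for c v
      using that T by (auto simp: W_def mult_mat_vec[of T n m])
    show "\<sigma> x *\<^sub>v w \<in> W" if x: "x \<in> A" and "w \<in> W" for x w
    proof -
      have w: "w \<in> carrier_vec m" "T *\<^sub>v w = 0\<^sub>v n" using that by (auto simp: W_def)
      have "T *\<^sub>v (\<sigma> x *\<^sub>v w) = (T * \<sigma> x) *\<^sub>v w" using T \<sigma>[OF x] w by simp
      also have "\<dots> = \<rho> x *\<^sub>v (T *\<^sub>v w)" using T \<rho>[OF x] w by (simp flip: comm[OF x])
      also have "\<dots> = 0\<^sub>v n" using w \<rho>[OF x] by (auto intro!: eq_vecI)
      finally show ?thesis using \<sigma>[OF x] w(1) mult_mat_vec_carrier by (auto simp: W_def)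
    qed
  qed
  moreover have "W \<noteq> carrier_vec m"
  proof
    assume W: "W = carrier_vec m"
    have "T = 0\<^sub>m n m"
    proof (rule eq_matI)
      fix i j assume "i < dim_row (0\<^sub>m n m :: complex mat)" "j < dim_col (0\<^sub>m n m :: complex mat)"
      then have ij: "i < n" "j < m" by auto
      have "unit_vec m j \<in> W" using W by simp
      then have "(T *\<^sub>v unit_vec m j) $ i = 0\<^sub>v n $ i" by (simp add: W_def)
      then show "T $$ (i,j) = 0\<^sub>m n m $$ (i,j)" using ij T by (simp add: scalar_prod_right_unit)
    qed (use T in auto)
    with T0 show False ..
  qed
  ultimately show ?thesis using v by (auto simp: W_def)
qed

text \<open>The other half of Schur's lemma, through the range of \<open>T\<close>, which is
  \<open>\<rho>\<close>-invariant and nonzero.\<close>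

lemma intertwiner_surjective:
  assumes irr: "is_irreducible_rep A u n \<rho>" and T: "T \<in> carrier_mat n m" and T0: "T \<noteq> 0\<^sub>m n m"
    and \<sigma>: "\<And>x. x \<in> A \<Longrightarrow> \<sigma> x \<in> carrier_mat m m"
    and comm: "\<And>x. x \<in> A \<Longrightarrow> \<rho> x * T = T * \<sigma> x"
    and w: "w \<in> carrier_vec n"
  shows "\<exists>v\<in>carrier_vec m. T *\<^sub>v v = w"
proof -
  have \<rho>: "\<rho> x \<in> carrier_mat n n" if "x \<in> A" for x
    using irr that by (auto simp: is_irreducible_rep_def is_representation_def)
  define W where "W = (\<lambda>v. T *\<^sub>v v) ` carrier_vec m"
  have "W = {0\<^sub>v n} \<or> W = carrier_vec n"
  proof (rule irreducible_rep_subspace[OF irr])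
    show "W \<subseteq> carrier_vec n" using T by (auto simp: W_def)
    show "0\<^sub>v n \<in> W" unfolding W_def using T by (intro image_eqI[of _ _ "0\<^sub>v m"]) (auto intro!: eq_vecI)
    show "v + w \<in> W" if "v \<in> W" "w \<in> W" for v w
    proof -
      obtain v' w' where "v' \<in> carrier_vec m" "w' \<in> carrier_vec m" "v = T *\<^sub>v v'" "w = T *\<^sub>v w'"
        using \<open>v \<in> W\<close> \<open>w \<in> W\<close> by (auto simp: W_def)
      then show ?thesis unfolding W_def using T
        by (intro image_eqI[of _ _ "v' + w'"]) (auto simp: mult_add_distrib_mat_vec[of T n m])
    qed
    show "c \<cdot>\<^sub>v v \<in> W" if "v \<in> W" for c v
    proof -
      obtain v' where "v' \<in> carrier_vec m" "v = T *\<^sub>v v'" using \<open>v \<in> W\<close> by (auto simp: W_def)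
      then show ?thesis unfolding W_def using T
        by (intro image_eqI[of _ _ "c \<cdot>\<^sub>v v'"]) (auto simp: mult_mat_vec[of T n m])
    qed
    show "\<rho> x *\<^sub>v w \<in> W" if x: "x \<in> A" and "w \<in> W" for x w
    proof -
      obtain v where v: "v \<in> carrier_vec m" "w = T *\<^sub>v v" using \<open>w \<in> W\<close> by (auto simp: W_def)
      have "\<rho> x *\<^sub>v w = (\<rho> x * T) *\<^sub>v v" using T \<rho>[OF x] v by simp
      also have "\<dots> = T *\<^sub>v (\<sigma> x *\<^sub>v v)" using T \<sigma>[OF x] v by (simp add: comm[OF x])
      finally show ?thesis unfolding W_def using \<sigma>[OF x] v(1) mult_mat_vec_carrier by blast
    qed
  qed
  moreover have "W \<noteq> {0\<^sub>v n}"
  proof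
    assume W: "W = {0\<^sub>v n}"
    have "T = 0\<^sub>m n m"
    proof (rule eq_matI)
      fix i j assume "i < dim_row (0\<^sub>m n m :: complex mat)" "j < dim_col (0\<^sub>m n m :: complex mat)"
      then have ij: "i < n" "j < m" by auto
      have "T *\<^sub>v unit_vec m j \<in> W" unfolding W_def by (rule imageI) simp
      then have "(T *\<^sub>v unit_vec m j) $ i = 0\<^sub>v n $ i" by (simp add: W)
      then show "T $$ (i,j) = 0\<^sub>m n m $$ (i,j)" using ij T by (simp add: scalar_prod_right_unit)
    qed (use T in auto)
    with T0 show False ..
  qed
  ultimately have "w \<in> W" using w by blast
  then show ?thesis by (auto simp: W_def)
qed

text \<open>The sizes \<open>n\<close> and \<open>m\<close> are not known to agree, so determinants
  do not apply. The columns of \<open>R\<close> are chosen preimages of the unit vectors, and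
  \<open>R * T = 1\<close> follows because \<open>T\<close> sends \<open>R T v - v\<close> to
  zero.\<close>

lemma mat_inverse_if_bijective:
  fixes T :: "complex mat"
  assumes T: "T \<in> carrier_mat n m"
    and inj: "\<And>v. v \<in> carrier_vec m \<Longrightarrow> T *\<^sub>v v = 0\<^sub>v n \<Longrightarrow> v = 0\<^sub>v m"
    and surj: "\<And>w. w \<in> carrier_vec n \<Longrightarrow> \<exists>v\<in>carrier_vec m. T *\<^sub>v v = w"
  obtains R where "R \<in> carrier_mat m n" "T * R = 1\<^sub>m n" "R * T = 1\<^sub>m m"
proof -
  from surj have "\<forall>i. \<exists>v\<in>carrier_vec m. T *\<^sub>v v = unit_vec n i" by simp
  then obtain r where r: "\<And>i. r i \<in> carrier_vec m" "\<And>i. T *\<^sub>v r i = unit_vec n i" by metis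
  define R where "R = mat m n (\<lambda>(i,j). r j $ i)"
  have R: "R \<in> carrier_mat m n" by (simp add: R_def)
  have colR: "col R j = r j" if "j < n" for j
    using that r(1)[of j] by (intro eq_vecI) (auto simp: R_def)
  have TR: "T * R = 1\<^sub>m n"
  proof (rule eq_matI)
    fix i j assume "i < dim_row (1\<^sub>m n :: complex mat)" "j < dim_col (1\<^sub>m n :: complex mat)"
    then have ij: "i < n" "j < n" by auto
    then have "(T * R) $$ (i,j) = (T *\<^sub>v r j) $ i" using T R colR by simp
    then show "(T * R) $$ (i,j) = 1\<^sub>m n $$ (i,j)" using ij r(2)[of j] by simp
  qed (use T R in auto)
  have "R * T = 1\<^sub>m m"
  proof (rule eq_matI)
    fix i j assume "i < dim_row (1\<^sub>m m :: complex mat)" "j < dim_col (1\<^sub>m m :: complex mat)"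
    then have ij: "i < m" "j < m" by auto
    define e where "e = (unit_vec m j :: complex vec)"
    have e: "e \<in> carrier_vec m" by (simp add: e_def)
    have Te: "T *\<^sub>v e \<in> carrier_vec n" using T e by (rule mult_mat_vec_carrier)
    have RTe: "R *\<^sub>v (T *\<^sub>v e) \<in> carrier_vec m" using R Te by (rule mult_mat_vec_carrier)
    have "T *\<^sub>v (R *\<^sub>v (T *\<^sub>v e)) = (T * R) *\<^sub>v (T *\<^sub>v e)" using T R Te by (simp add: assoc_mult_mat_vec)
    then have TRT: "T *\<^sub>v (R *\<^sub>v (T *\<^sub>v e)) = T *\<^sub>v e" using TR Te by simp
    have "T *\<^sub>v (R *\<^sub>v (T *\<^sub>v e) + (-1) \<cdot>\<^sub>v e) = T *\<^sub>v e + (-1) \<cdot>\<^sub>v (T *\<^sub>v e)"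
      using T RTe e TRT by (simp add: mult_add_distrib_mat_vec[of T n m] mult_mat_vec[of T n m])
    also have "\<dots> = 0\<^sub>v n" using T by (intro eq_vecI) auto
    finally have z: "R *\<^sub>v (T *\<^sub>v e) + (-1) \<cdot>\<^sub>v e = 0\<^sub>v m" using inj RTe e by simp
    have "(R *\<^sub>v (T *\<^sub>v e)) $ i = e $ i"
      using arg_cong[OF z, of "\<lambda>v. v $ i"] ij R e by (simp del: index_mult_mat_vec)
    moreover have "R *\<^sub>v (T *\<^sub>v e) = (R * T) *\<^sub>v e" using R T e by simp
    moreover have "((R * T) *\<^sub>v e) $ i = (R * T) $$ (i,j)" using R T ij by (simp add: e_def del: assoc_mult_mat_vec)
    ultimately show "(R * T) $$ (i,j) = 1\<^sub>m m $$ (i,j)"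
      using ij by (simp add: e_def)
  qed (use R T in auto)
  with R TR show ?thesis using that by blast
qed

lemma irreducible_intertwiner_mat_trace:
  assumes \<rho>: "is_irreducible_rep A u n \<rho>" and \<sigma>: "is_irreducible_rep A u m \<sigma>"
    and T: "T \<in> carrier_mat n m" "T \<noteq> 0\<^sub>m n m"
    and comm: "\<And>x. x \<in> A \<Longrightarrow> \<rho> x * T = T * \<sigma> x" and x: "x \<in> A"
  shows "mat_trace (\<rho> x) = mat_trace (\<sigma> x)"
proof -
  have c: "\<rho> x \<in> carrier_mat n n" "\<sigma> x \<in> carrier_mat m m" if "x \<in> A" for x
    using \<rho> \<sigma> that by (auto simp: is_irreducible_rep_def is_representation_def)
  obtain R where "R \<in> carrier_mat m n" "T * R = 1\<^sub>m n" "R * T = 1\<^sub>m m"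
    using mat_inverse_if_bijective[OF T(1)] intertwiner_injective[OF \<sigma> T c(1) comm]
      intertwiner_surjective[OF \<rho> T c(2) comm] by metis
  then show ?thesis using mat_trace_eq_if_intertwined[OF _ _ T(1)] c[OF x] comm[OF x] by blast
qed

text \<open>Multiplicativity rests on \<open>inv\<close>: \<open>S * R\<close> fixes whatever
  \<open>\<rho> y\<close> makes of the range of \<open>S\<close>, so it can be inserted between
  \<open>\<rho> x\<close> and \<open>\<rho> y\<close>. The unit has to become \<open>1\<close> only
  after compression, since on the corner \<open>\<rho> e\<close> is in general a proper
  projection.\<close>

lemma compressed_representation:
  assumes carrier: "\<And>x. x \<in> A \<Longrightarrow> \<rho> x \<in> carrier_mat n n"
    and add: "\<And>x y. x \<in> A \<Longrightarrow> y \<in> A \<Longrightarrow> \<rho> (x + y) = \<rho> x + \<rho> y"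
    and smult: "\<And>c x. x \<in> A \<Longrightarrow> \<rho> (c *\<^sub>C x) = c \<cdot>\<^sub>m \<rho> x"
    and mult: "\<And>x y. x \<in> A \<Longrightarrow> y \<in> A \<Longrightarrow> \<rho> (x * y) = \<rho> x * \<rho> y"
    and S: "S \<in> carrier_mat n k" and R: "R \<in> carrier_mat k n"
    and inv: "\<And>x v. x \<in> A \<Longrightarrow> v \<in> carrier_vec k \<Longrightarrow> S *\<^sub>v (R *\<^sub>v (\<rho> x *\<^sub>v (S *\<^sub>v v))) = \<rho> x *\<^sub>v (S *\<^sub>v v)"
    and one: "R * (\<rho> u * S) = 1\<^sub>m k"
  shows "is_representation A u k (\<lambda>x. R * (\<rho> x * S))"
  unfolding is_representation_def
proof (intro conjI ballI allI)
  show "R * (\<rho> x * S) \<in> carrier_mat k k" if "x \<in> A" for x using carrier[OF that] S R by simp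
  show "R * (\<rho> (x + y) * S) = R * (\<rho> x * S) + R * (\<rho> y * S)" if "x \<in> A" "y \<in> A" for x y
    using carrier[OF that(1)] carrier[OF that(2)] S R
    by (simp add: add that add_mult_distrib_mat[of _ n n] mult_add_distrib_mat[of R k n _ k])
  show "R * (\<rho> (c *\<^sub>C x) * S) = c \<cdot>\<^sub>m (R * (\<rho> x * S))" if "x \<in> A" for c x
    using carrier[OF that] S R
    by (simp add: smult that mult_smult_assoc_mat[of _ n n] mult_smult_distrib[of R k n _ k])
  show "R * (\<rho> (x * y) * S) = R * (\<rho> x * S) * (R * (\<rho> y * S))" if xy: "x \<in> A" "y \<in> A" for x y
  proof -
    note c = carrier[OF xy(1)] carrier[OF xy(2)]
    have "S * (R * (\<rho> y * S)) = \<rho> y * S"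
    proof (rule mat_eq_if_mult_vec_eq)
      show "S * (R * (\<rho> y * S)) \<in> carrier_mat n k" "\<rho> y * S \<in> carrier_mat n k" using c S R by auto
      fix v :: "complex vec" assume v: "v \<in> carrier_vec k"
      then have Sv: "S *\<^sub>v v \<in> carrier_vec n" using S by auto
      have "(S * (R * (\<rho> y * S))) *\<^sub>v v = S *\<^sub>v (R *\<^sub>v (\<rho> y *\<^sub>v (S *\<^sub>v v)))"
        using c S R v Sv by (simp add: assoc_mult_mat_vec[of _ n k _ k] assoc_mult_mat_vec[of _ k n _ k]
          assoc_mult_mat_vec[of _ n n _ k])
      also have "\<dots> = (\<rho> y * S) *\<^sub>v v" using inv[OF xy(2) v] c S v by simp
      finally show "(S * (R * (\<rho> y * S))) *\<^sub>v v = (\<rho> y * S) *\<^sub>v v" .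
    qed
    then have "\<rho> (x * y) * S = \<rho> x * (S * (R * (\<rho> y * S)))"
      using c S by (simp add: mult xy assoc_mult_mat[of _ n n _ n _ k])
    also have "\<dots> = (\<rho> x * S) * (R * (\<rho> y * S))"
      using c S R assoc_mult_mat[of "\<rho> x" n n S k "R * (\<rho> y * S)" k] by simp
    finally have "R * (\<rho> (x * y) * S) = R * ((\<rho> x * S) * (R * (\<rho> y * S)))" by simp
    also have "\<dots> = R * (\<rho> x * S) * (R * (\<rho> y * S))"
      using c S R assoc_mult_mat[of R k n "\<rho> x * S" k "R * (\<rho> y * S)" k] by simp
    finally show ?thesis .
  qed
  show "R * (\<rho> u * S) = 1\<^sub>m k" by (rule one)
qed

text \<open>The clause for \<open>k = n\<close> makes a proper subspace give a strictly smaller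
  dimension, which drives the descent to an irreducible representation.\<close>

lemma subrepresentation:
  assumes \<rho>: "is_representation A u n \<rho>" and u: "u \<in> A"
    and W: "W \<subseteq> carrier_vec n" and W0: "0\<^sub>v n \<in> W"
    and Wadd: "\<And>v w. v \<in> W \<Longrightarrow> w \<in> W \<Longrightarrow> v + w \<in> W"
    and Wsmult: "\<And>c v. v \<in> W \<Longrightarrow> c \<cdot>\<^sub>v v \<in> W"
    and Winv: "\<And>x w. x \<in> A \<Longrightarrow> w \<in> W \<Longrightarrow> \<rho> x *\<^sub>v w \<in> W"
    and nz: "W \<noteq> {0\<^sub>v n}"
  obtains k \<pi> S where "is_representation A u k \<pi>" "0 < k" "k \<le> n" "S \<in> carrier_mat n k"
    "\<forall>v\<in>carrier_vec k. S *\<^sub>v v \<in> W" "\<forall>v\<in>carrier_vec k. S *\<^sub>v v = 0\<^sub>v n \<longrightarrow> v = 0\<^sub>v k"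
    "\<forall>x\<in>A. \<forall>v\<in>carrier_vec k. S *\<^sub>v (\<pi> x *\<^sub>v v) = \<rho> x *\<^sub>v (S *\<^sub>v v)" "k = n \<longrightarrow> W = carrier_vec n"
proof -
  have c: "\<rho> x \<in> carrier_mat n n" if "x \<in> A" for x using \<rho> that by (auto simp: is_representation_def)
  obtain k S R where S: "S \<in> carrier_mat n k" and R: "R \<in> carrier_mat k n" and RS: "R * S = 1\<^sub>m k"
    and SW': "\<forall>v\<in>carrier_vec k. S *\<^sub>v v \<in> W" and WS': "\<forall>w\<in>W. S *\<^sub>v (R *\<^sub>v w) = w"
    by (rule subspace_retraction[OF W W0 Wadd Wsmult])
  note SW = SW'[rule_format] and WS = WS'[rule_format]
  have Sc: "S *\<^sub>v v \<in> carrier_vec n" if "v \<in> carrier_vec k" for v using SW[OF that] W by blast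
  have inv: "S *\<^sub>v (R *\<^sub>v (\<rho> x *\<^sub>v (S *\<^sub>v v))) = \<rho> x *\<^sub>v (S *\<^sub>v v)" if "x \<in> A" "v \<in> carrier_vec k" for x v
    by (rule WS[OF Winv[OF that(1) SW[OF that(2)]]])
  have "is_representation A u k (\<lambda>x. R * (\<rho> x * S))"
  proof (rule compressed_representation[where n = n])
    have "\<rho> u * S = S" using \<rho> S by (simp add: is_representation_def)
    then show "R * (\<rho> u * S) = 1\<^sub>m k" using RS by simp
  qed (use \<rho> S R inv in \<open>auto simp: is_representation_def\<close>)
  moreover have "k \<noteq> 0"
  proof
    assume k: "k = 0"
    have "w = 0\<^sub>v n" if "w \<in> W" for w
    proof -
      have "S *\<^sub>v (R *\<^sub>v w) = 0\<^sub>v n" using S R k by (intro eq_vecI) (auto simp: scalar_prod_def)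
      then show ?thesis using WS[OF that] by simp
    qed
    then show False using nz W0 by blast
  qed
  moreover have "k \<le> n" by (rule left_inverse_dim_le[OF R S RS])
  moreover have "v = 0\<^sub>v k" if "v \<in> carrier_vec k" "S *\<^sub>v v = 0\<^sub>v n" for v
  proof -
    have "v = R *\<^sub>v (S *\<^sub>v v)" using assoc_mult_mat_vec[OF R S that(1)] RS that(1) by simp
    also have "\<dots> = 0\<^sub>v k" unfolding that(2) using R by (intro eq_vecI) auto
    finally show ?thesis .
  qed
  moreover have "S *\<^sub>v ((R * (\<rho> x * S)) *\<^sub>v v) = \<rho> x *\<^sub>v (S *\<^sub>v v)" if "x \<in> A" "v \<in> carrier_vec k" for x v
    using inv[OF that] c[OF that(1)] R S that(2)
    by (simp add: assoc_mult_mat_vec[of _ k n _ k] assoc_mult_mat_vec[of _ n n _ k])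
  moreover have "W = carrier_vec n" if "k = n"
  proof
    show "W \<subseteq> carrier_vec n" by (rule W)
    show "carrier_vec n \<subseteq> W"
    proof
      fix v :: "complex vec" assume v: "v \<in> carrier_vec n"
      have "S * R = 1\<^sub>m n" using mat_mult_left_right_inverse[of R n S] R S RS that by simp
      then have "S *\<^sub>v (R *\<^sub>v v) = v" using assoc_mult_mat_vec[OF S R v] v by simp
      moreover have "S *\<^sub>v (R *\<^sub>v v) \<in> W" by (rule SW[OF mult_mat_vec_carrier[OF R v]])
      ultimately show "v \<in> W" by simp
    qed
  qed
  ultimately show ?thesis
    by (intro that[of k "\<lambda>x. R * (\<rho> x * S)" S, OF _ _ _ S SW']) auto
qed

text \<open>Take a representation of least positive dimension on which \<open>z\<close> acts
  injectively. Injectivity, unlike being nonzero, is inherited by every invariant subspace, so a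
  proper nonzero one would contradict minimality.\<close>

lemma irreducible_rep_with_injective_element:
  assumes \<rho>: "is_representation A u n \<rho>" and u: "u \<in> A" and n: "0 < n" and z: "z \<in> A"
    and inj: "\<And>v. v \<in> carrier_vec n \<Longrightarrow> \<rho> z *\<^sub>v v = 0\<^sub>v n \<Longrightarrow> v = 0\<^sub>v n"
  shows "\<exists>k \<pi>. is_irreducible_rep A u k \<pi> \<and> \<pi> z \<noteq> 0\<^sub>m k k"
proof -
  define P where "P k \<longleftrightarrow> 0 < k \<and> (\<exists>\<pi>. is_representation A u k \<pi> \<and>
    (\<forall>v\<in>carrier_vec k. \<pi> z *\<^sub>v v = 0\<^sub>v k \<longrightarrow> v = 0\<^sub>v k))" for k
  have "P n" using assms by (auto simp: P_def)
  define k where "k = (LEAST k. P k)"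
  have "P k" unfolding k_def by (rule LeastI) (rule \<open>P n\<close>)
  have least: "k \<le> l" if "P l" for l unfolding k_def using that by (rule Least_le)
  from \<open>P k\<close> obtain \<pi> where k: "0 < k" and \<pi>: "is_representation A u k \<pi>"
    and \<pi>inj: "\<forall>v\<in>carrier_vec k. \<pi> z *\<^sub>v v = 0\<^sub>v k \<longrightarrow> v = 0\<^sub>v k" by (auto simp: P_def)
  have "is_irreducible_rep A u k \<pi>"
    unfolding is_irreducible_rep_def
  proof (intro conjI allI impI)
    fix W assume W: "VectorSpace.subspace class_ring W (module_vec TYPE(complex) k)"
      and Winv: "\<forall>x\<in>A. \<forall>w\<in>W. \<pi> x *\<^sub>v w \<in> W"
    show "W = {0\<^sub>v k} \<or> W = carrier_vec k"
    proof (rule disjCI)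
      assume nW: "W \<noteq> carrier_vec k"
      show "W = {0\<^sub>v k}"
      proof (rule ccontr)
        assume nz: "W \<noteq> {0\<^sub>v k}"
        from W have W': "W \<subseteq> carrier_vec k" "0\<^sub>v k \<in> W" "\<And>v w. v \<in> W \<Longrightarrow> w \<in> W \<Longrightarrow> v + w \<in> W"
          "\<And>c v. v \<in> W \<Longrightarrow> c \<cdot>\<^sub>v v \<in> W" unfolding subspace_module_vec_iff by auto
        obtain l \<sigma> S where \<sigma>: "is_representation A u l \<sigma>" "0 < l" "l \<le> k" "S \<in> carrier_mat k l"
          and SW: "\<forall>v\<in>carrier_vec l. S *\<^sub>v v \<in> W"
          and S0: "\<forall>v\<in>carrier_vec l. S *\<^sub>v v = 0\<^sub>v k \<longrightarrow> v = 0\<^sub>v l"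
          and comm: "\<forall>x\<in>A. \<forall>v\<in>carrier_vec l. S *\<^sub>v (\<sigma> x *\<^sub>v v) = \<pi> x *\<^sub>v (S *\<^sub>v v)"
          and lk: "l = k \<longrightarrow> W = carrier_vec k"
          by (rule subrepresentation[OF \<pi> u W' _ nz]) (use Winv in auto)
        have "v = 0\<^sub>v l" if v: "v \<in> carrier_vec l" "\<sigma> z *\<^sub>v v = 0\<^sub>v l" for v
        proof -
          have "\<pi> z *\<^sub>v (S *\<^sub>v v) = S *\<^sub>v (0\<^sub>v l)" using comm z v by metis
          also have "\<dots> = 0\<^sub>v k" using \<sigma>(4) by (auto intro: eq_vecI)
          finally have "S *\<^sub>v v = 0\<^sub>v k" using \<pi>inj SW v(1) W'(1) by blast
          then show ?thesis using S0 v(1) by blast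
        qed
        then have "P l" using \<sigma> by (auto simp: P_def)
        then show False using least \<sigma>(3) lk nW by force
      qed
    qed
  qed (use \<pi> k in auto)
  moreover have "\<pi> z \<noteq> 0\<^sub>m k k"
  proof
    assume "\<pi> z = 0\<^sub>m k k"
    then have "\<pi> z *\<^sub>v unit_vec k 0 = 0\<^sub>v k" by (auto intro: eq_vecI)
    then have "unit_vec k 0 = (0\<^sub>v k :: complex vec)" using \<pi>inj by simp
    then have "(unit_vec k 0 :: complex vec) $ 0 = 0" using k by simp
    then show False using k by simp
  qed
  ultimately show ?thesis by blast
qed

end

subsection \<open>Star algebras with a definite trace\<close>

text \<open>Independence of \<open>B\<close> is a consequence here, not an axiom: orthogonality with
  positive norms yields it, together with formulas for the coordinates. The basis vectors are not
  normalised, and the identity may have a trace other than \<open>1\<close>, as happens for the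
  corner.\<close>

locale tracial_star_algebra = complex_algebra scale
  for scale :: "complex \<Rightarrow> 'a::ring \<Rightarrow> 'a"  (infixr \<open>*\<^sub>C\<close> 75) +
  fixes A :: "'a set" and u :: 'a and st :: "'a \<Rightarrow> 'a" and B :: "'a set" and \<tau> :: "'a \<Rightarrow> complex"
  assumes finite_basis: "finite B"
    and span_basis: "span B = A"
    and mult_closed: "\<lbrakk>x \<in> A; y \<in> A\<rbrakk> \<Longrightarrow> x * y \<in> A"
    and one_closed: "u \<in> A"
    and one_left: "x \<in> A \<Longrightarrow> u * x = x"
    and one_right: "x \<in> A \<Longrightarrow> x * u = x"
    and star_closed: "x \<in> A \<Longrightarrow> st x \<in> A"
    and star_add: "\<lbrakk>x \<in> A; y \<in> A\<rbrakk> \<Longrightarrow> st (x + y) = st x + st y"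
    and star_scale: "x \<in> A \<Longrightarrow> st (k *\<^sub>C x) = cnj k *\<^sub>C st x"
    and star_mult: "\<lbrakk>x \<in> A; y \<in> A\<rbrakk> \<Longrightarrow> st (x * y) = st y * st x"
    and star_star: "x \<in> A \<Longrightarrow> st (st x) = x"
    and trace_functional: "functional_on A \<tau>"
    and trace_commute: "\<lbrakk>x \<in> A; y \<in> A\<rbrakk> \<Longrightarrow> \<tau> (x * y) = \<tau> (y * x)"
    and trace_star: "x \<in> A \<Longrightarrow> \<tau> (st x) = cnj (\<tau> x)"
    and orthogonal: "\<lbrakk>a \<in> B; b \<in> B; a \<noteq> b\<rbrakk> \<Longrightarrow> \<tau> (a * st b) = 0"
    and positive: "b \<in> B \<Longrightarrow> 0 < Re (\<tau> (b * st b))"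
begin

text \<open>The squared norm of \<open>b\<close>. Taking the real part makes it self-conjugate by
  construction; \<open>trace_basis\<close> shows that nothing is lost, because
  \<open>b * st b\<close> is fixed by the involution.\<close>

definition weight :: "'a \<Rightarrow> complex" where
  "weight b = complex_of_real (Re (\<tau> (b * st b)))"

lemma subspace_carrier: "subspace A"
  using subspace_span[of B] by (simp add: span_basis)

lemmas add_closed = subspace_add[OF subspace_carrier]
lemmas scale_closed = subspace_scale[OF subspace_carrier]
lemmas diff_closed = subspace_diff[OF subspace_carrier]
lemmas sum_closed = subspace_sum[OF subspace_carrier]

lemma basis_closed: "b \<in> B \<Longrightarrow> b \<in> A"
  using span_base[of b B] by (simp add: span_basis)

lemma weight_nonzero: "b \<in> B \<Longrightarrow> weight b \<noteq> 0"
  using positive[of b] by (auto simp: weight_def)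

lemma star_one: "st u = u"
proof -
  have "st u = st u * u" using one_right star_closed one_closed by simp
  also have "\<dots> = st u * st (st u)" using star_star one_closed by simp
  also have "\<dots> = st (st u * u)" using star_mult[of "st u" u] star_closed one_closed by simp
  also have "\<dots> = u" using one_right star_closed one_closed star_star by simp
  finally show ?thesis .
qed

lemma trace_basis:
  assumes "a \<in> B" "b \<in> B"
  shows "\<tau> (a * st b) = (if a = b then weight b else 0)"
proof -
  have "\<tau> (b * st b) = cnj (\<tau> (b * st b))" if "b \<in> B" for b
  proof -
    have "st (b * st b) = b * st b" using that basis_closed star_closed star_mult star_star by simp
    then show ?thesis using trace_star[of "b * st b"] that basis_closed star_closed mult_closed by simp
  qed
  then have "\<tau> (b * st b) = weight b"
    using assms by (simp add: weight_def complex_eq_iff)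
  then show ?thesis using assms orthogonal by simp
qed

lemma functional_on_mult_left: "functional_on A f \<Longrightarrow> a \<in> A \<Longrightarrow> functional_on A (\<lambda>x. f (a * x))"
  unfolding functional_on_def using mult_closed by (simp add: distrib_left scale_mult_right)

lemma functional_on_mult_right: "functional_on A f \<Longrightarrow> a \<in> A \<Longrightarrow> functional_on A (\<lambda>x. f (x * a))"
  unfolding functional_on_def using mult_closed by (simp add: distrib_right scale_mult_left)

lemma star_sum:
  assumes "finite I" "\<And>i. i \<in> I \<Longrightarrow> g i \<in> A"
  shows "st (\<Sum>i\<in>I. c i *\<^sub>C g i) = (\<Sum>i\<in>I. cnj (c i) *\<^sub>C st (g i))"
  using assms
proof (induction I rule: finite_induct)
  case empty
  have "st (0 *\<^sub>C 0) = cnj 0 *\<^sub>C st 0" using star_scale[of 0 0] subspace_0[OF subspace_carrier] by blast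
  then show ?case by simp
next
  case (insert i I)
  then show ?case using star_add[of "c i *\<^sub>C g i" "\<Sum>i\<in>I. c i *\<^sub>C g i"]
    by (simp add: scale_closed sum_closed star_scale)
qed

lemma expansion:
  assumes x: "x \<in> A"
  shows "x = (\<Sum>b\<in>B. (\<tau> (x * st b) / weight b) *\<^sub>C b)"
proof -
  obtain c where c: "x = (\<Sum>b\<in>B. c b *\<^sub>C b)"
    using x span_finite[OF finite_basis] by (auto simp: span_basis)
  have "\<tau> (x * st d) = c d * weight d" if d: "d \<in> B" for d
  proof -
    have "functional_on A (\<lambda>x. \<tau> (x * st d))"
      using functional_on_mult_right[OF trace_functional] d basis_closed star_closed by simp
    then have "\<tau> (x * st d) = (\<Sum>b\<in>B. c b * \<tau> (b * st d))"
      unfolding c by (rule functional_on_sum[OF _ subspace_carrier finite_basis]) (rule basis_closed)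
    also have "\<dots> = (\<Sum>b\<in>B. if b = d then c d * weight d else 0)"
      by (intro sum.cong) (auto simp: trace_basis d)
    finally show ?thesis using d finite_basis by simp
  qed
  then have "(\<Sum>b\<in>B. (\<tau> (x * st b) / weight b) *\<^sub>C b) = (\<Sum>b\<in>B. c b *\<^sub>C b)" (is "?s = _")
    by (intro sum.cong) (auto simp: weight_nonzero)
  also have "\<dots> = x" using c by (rule sym)
  finally show ?thesis by (rule sym)
qed

text \<open>Obtained by applying the involution to the expansion of \<open>st x\<close>. Together
  with \<open>expansion\<close> it says that \<open>b\<close> and \<open>st b / weight b\<close> are
  dual bases for the bilinear form \<open>\<tau> (x * y)\<close>.\<close>

lemma expansion_star:
  assumes x: "x \<in> A"
  shows "x = (\<Sum>b\<in>B. (\<tau> (x * b) / weight b) *\<^sub>C st b)"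
proof -
  have "x = st (\<Sum>b\<in>B. (\<tau> (st x * st b) / weight b) *\<^sub>C b)"
    unfolding expansion[OF star_closed[OF x], symmetric] using star_star[OF x] by simp
  also have "\<dots> = (\<Sum>b\<in>B. cnj (\<tau> (st x * st b) / weight b) *\<^sub>C st b)"
    by (rule star_sum) (auto simp: finite_basis basis_closed)
  also have "\<dots> = (\<Sum>b\<in>B. (\<tau> (x * b) / weight b) *\<^sub>C st b)"
  proof (rule sum.cong)
    fix b assume b: "b \<in> B"
    have "\<tau> (st x * st b) = cnj (\<tau> (b * x))"
      using star_mult[of b x] trace_star[of "b * x"] b x basis_closed mult_closed by simp
    then show "cnj (\<tau> (st x * st b) / weight b) *\<^sub>C st b = (\<tau> (x * b) / weight b) *\<^sub>C st b"
      using b x basis_closed trace_commute by (simp add: weight_def)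
  qed simp
  finally show ?thesis .
qed

lemma functional_expansion:
  assumes "functional_on A f" "x \<in> A"
  shows "f x = (\<Sum>b\<in>B. \<tau> (x * st b) / weight b * f b)"
  by (subst expansion[OF assms(2)], rule functional_on_sum[OF assms(1) subspace_carrier finite_basis])
    (rule basis_closed)

lemma functional_expansion_star:
  assumes "functional_on A f" "x \<in> A"
  shows "f x = (\<Sum>b\<in>B. \<tau> (x * b) / weight b * f (st b))"
  by (subst expansion_star[OF assms(2)], rule functional_on_sum[OF assms(1) subspace_carrier finite_basis])
    (simp add: basis_closed star_closed)

lemma independent_basis: "independent B"
proof (rule independent_if_scalars_zero[OF finite_basis])
  fix c d assume 0: "(\<Sum>b\<in>B. c b *\<^sub>C b) = 0" and d: "d \<in> B"
  have "functional_on A (\<lambda>x. \<tau> (x * st d))"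
    using functional_on_mult_right[OF trace_functional] d basis_closed star_closed by simp
  then have "\<tau> ((\<Sum>b\<in>B. c b *\<^sub>C b) * st d) = (\<Sum>b\<in>B. c b * \<tau> (b * st d))"
    by (rule functional_on_sum[OF _ subspace_carrier finite_basis]) (rule basis_closed)
  then have "\<tau> (0 * st d) = (\<Sum>b\<in>B. c b * \<tau> (b * st d))" by (simp only: 0)
  also have "\<dots> = (\<Sum>b\<in>B. if b = d then c d * weight d else 0)"
    by (intro sum.cong) (auto simp: trace_basis d)
  finally have "\<tau> 0 = c d * weight d" using d finite_basis by simp
  moreover have "\<tau> 0 = 0"
    using functional_on_sum[OF trace_functional subspace_carrier, of "{}"] by simp
  ultimately show "c d = 0" using weight_nonzero[OF d] by simp
qed

lemma representation_eq_trace: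
  assumes x: "x \<in> A" and b: "b \<in> B"
  shows "representation B x b = \<tau> (x * st b) / weight b"
proof -
  have "representation B x = (\<lambda>b. if b \<in> B then \<tau> (x * st b) / weight b else 0)"
  proof (rule representation_eqI[OF independent_basis])
    show "x \<in> span B" using x by (simp add: span_basis)
    let ?f = "\<lambda>b. if b \<in> B then \<tau> (x * st b) / weight b else 0"
    show "?f b \<noteq> 0 \<Longrightarrow> b \<in> B" for b by (auto split: if_splits)
    have sub: "{b. ?f b \<noteq> 0} \<subseteq> B" by auto
    then show "finite {b. ?f b \<noteq> 0}" using finite_basis finite_subset by blast
    have "(\<Sum>b | ?f b \<noteq> 0. ?f b *\<^sub>C b) = (\<Sum>b\<in>B. ?f b *\<^sub>C b)"
      using sub by (intro sum.mono_neutral_left[OF finite_basis]) auto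
    also have "\<dots> = x" using expansion[OF x, symmetric] by simp
    finally show "(\<Sum>b | ?f b \<noteq> 0. ?f b *\<^sub>C b) = x" .
  qed
  then show ?thesis using b by simp
qed

lemma weighted_square_sum_eq_0D:
  assumes "(\<Sum>b\<in>B. f b * cnj (f b) / weight b) = 0" and b: "b \<in> B"
  shows "f b = 0"
proof -
  have "(\<Sum>b\<in>B. f b * cnj (f b) / weight b)
    = complex_of_real (\<Sum>b\<in>B. (cmod (f b))\<^sup>2 / Re (\<tau> (b * st b)))"
    by (simp add: weight_def flip: complex_norm_square)
  then have "(\<Sum>b\<in>B. (cmod (f b))\<^sup>2 / Re (\<tau> (b * st b))) = 0"
    using assms(1) by (metis of_real_eq_0_iff)
  then have "\<forall>b\<in>B. (cmod (f b))\<^sup>2 / Re (\<tau> (b * st b)) = 0"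
    using sum_nonneg_eq_0_iff[OF finite_basis, of "\<lambda>b. (cmod (f b))\<^sup>2 / Re (\<tau> (b * st b))"]
    by (simp add: positive less_imp_le)
  then show ?thesis using b positive[OF b] by auto
qed

text \<open>By Parseval, \<open>\<tau> (x * st x)\<close> is the sum of
  \<open>|\<tau> (x * st b)|^2 / weight b\<close>, so all coordinates of \<open>x\<close>
  vanish.\<close>

lemma trace_definite:
  assumes x: "x \<in> A" and 0: "\<tau> (x * st x) = 0"
  shows "x = 0"
proof -
  have "\<tau> (x * st x) = (\<Sum>b\<in>B. \<tau> (x * st b) / weight b * \<tau> (b * st x))"
    using functional_expansion[OF functional_on_mult_right[OF trace_functional star_closed[OF x]] x] .
  also have "\<dots> = (\<Sum>b\<in>B. \<tau> (x * st b) * cnj (\<tau> (x * st b)) / weight b)"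
  proof (rule sum.cong)
    fix b assume b: "b \<in> B"
    have "\<tau> (b * st x) = cnj (\<tau> (x * st b))"
      using trace_star[of "x * st b"] star_mult[of x "st b"] star_star[of b] b x basis_closed
        star_closed mult_closed by simp
    then show "\<tau> (x * st b) / weight b * \<tau> (b * st x)
      = \<tau> (x * st b) * cnj (\<tau> (x * st b)) / weight b" by simp
  qed simp
  finally have "(\<Sum>b\<in>B. \<tau> (x * st b) * cnj (\<tau> (x * st b)) / weight b) = 0" using 0 by simp
  then have "\<tau> (x * st b) = 0" if "b \<in> B" for b
    using that by (rule weighted_square_sum_eq_0D)
  then have "(\<Sum>b\<in>B. (\<tau> (x * st b) / weight b) *\<^sub>C b) = 0" by simp
  then show ?thesis by (simp only: expansion[OF x, symmetric])
qed

text \<open>For \<open>F\<close> regarded as a linear function on the tensor square, this is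
  \<open>(a \<otimes> 1) \<Omega> = \<Omega> (1 \<otimes> a)\<close> for the Casimir element
  \<open>\<Omega>\<close>: expand \<open>a * b\<close> in the basis, move \<open>st c\<close> around
  the trace, and resum over \<open>b\<close> by the dual expansion of
  \<open>st c * a\<close>.\<close>

lemma casimir:
  assumes F1: "\<And>y. y \<in> A \<Longrightarrow> functional_on A (\<lambda>x. F x y)"
    and F2: "\<And>x. x \<in> A \<Longrightarrow> functional_on A (F x)" and a: "a \<in> A"
  shows "(\<Sum>b\<in>B. F (a * b) (st b) / weight b) = (\<Sum>b\<in>B. F b (st b * a) / weight b)"
proof -
  have "(\<Sum>b\<in>B. F (a * b) (st b) / weight b)
    = (\<Sum>b\<in>B. (\<Sum>c\<in>B. \<tau> (a * b * st c) / weight c * F c (st b)) / weight b)"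
  proof (intro sum.cong refl)
    fix b assume "b \<in> B"
    then have "st b \<in> A" "a * b \<in> A" using a basis_closed star_closed mult_closed by auto
    from functional_expansion[OF F1[OF this(1)] this(2)]
    show "F (a * b) (st b) / weight b
      = (\<Sum>c\<in>B. \<tau> (a * b * st c) / weight c * F c (st b)) / weight b" by (rule arg_cong)
  qed
  also have "\<dots> = (\<Sum>c\<in>B. \<Sum>b\<in>B. \<tau> (a * b * st c) / weight c * F c (st b) / weight b)"
    by (subst sum.swap) (simp add: sum_divide_distrib)
  also have "\<dots> = (\<Sum>c\<in>B. (\<Sum>b\<in>B. \<tau> (st c * a * b) / weight b * F c (st b)) / weight c)"
  proof (unfold sum_divide_distrib, intro sum.cong refl)
    fix b c assume "b \<in> B" "c \<in> B"
    then have "\<tau> (a * b * st c) = \<tau> (st c * a * b)"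
      using a basis_closed star_closed mult_closed trace_commute[of "a * b" "st c"]
      by (simp add: mult.assoc)
    then show "\<tau> (a * b * st c) / weight c * F c (st b) / weight b
      = \<tau> (st c * a * b) / weight b * F c (st b) / weight c" by simp
  qed
  also have "\<dots> = (\<Sum>c\<in>B. F c (st c * a) / weight c)"
  proof (intro sum.cong refl)
    fix c assume "c \<in> B"
    then have "c \<in> A" "st c * a \<in> A" using a basis_closed star_closed mult_closed by auto
    from functional_expansion_star[OF F2[OF this(1)] this(2)]
    show "(\<Sum>b\<in>B. \<tau> (st c * a * b) / weight b * F c (st b)) / weight c
      = F c (st c * a) / weight c" by (rule arg_cong[OF sym])
  qed
  finally show ?thesis .
qed

text \<open>The sum of \<open>\<rho> b * E * \<sigma> (st b) / weight b\<close> with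
  \<open>E\<close> the matrix unit at \<open>(k,l)\<close>: the analogue of averaging a linear map
  over a group.\<close>

definition coefficient_intertwiner ::
  "nat \<Rightarrow> nat \<Rightarrow> ('a \<Rightarrow> complex mat) \<Rightarrow> ('a \<Rightarrow> complex mat) \<Rightarrow> nat \<Rightarrow> nat \<Rightarrow> complex mat" where
  "coefficient_intertwiner n m \<rho> \<sigma> k l
    = mat n m (\<lambda>(i,j). \<Sum>b\<in>B. \<rho> b $$ (i,k) * \<sigma> (st b) $$ (l,j) / weight b)"

lemma coefficient_intertwiner_comm:
  assumes \<rho>: "is_representation A u n \<rho>" and \<sigma>: "is_representation A u m \<sigma>"
    and kl: "k < n" "l < m" and a: "a \<in> A"
  shows "\<rho> a * coefficient_intertwiner n m \<rho> \<sigma> k l = coefficient_intertwiner n m \<rho> \<sigma> k l * \<sigma> a"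
    (is "\<rho> a * ?T = ?T * \<sigma> a")
proof -
  have c: "\<rho> a \<in> carrier_mat n n" "\<sigma> a \<in> carrier_mat m m"
    using \<rho> \<sigma> a by (auto simp: is_representation_def)
  have T: "?T \<in> carrier_mat n m" by (simp add: coefficient_intertwiner_def)
  show ?thesis
  proof (rule eq_matI)
    fix i j assume "i < dim_row (?T * \<sigma> a)" "j < dim_col (?T * \<sigma> a)"
    then have ij: "i < n" "j < m" using T c by auto
    have scal: "functional_on A (\<lambda>x. f x * d)" "functional_on A (\<lambda>x. d * f x)" if "functional_on A f" for f d
      using that by (auto simp: functional_on_def algebra_simps)
    have "(\<rho> a * ?T) $$ (i,j)
      = (\<Sum>p<n. \<rho> a $$ (i,p) * (\<Sum>b\<in>B. \<rho> b $$ (p,k) * \<sigma> (st b) $$ (l,j) / weight b))"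
      using ij c T by (simp add: scalar_prod_def lessThan_atLeast0 coefficient_intertwiner_def)
    also have "\<dots> = (\<Sum>b\<in>B. (\<Sum>p<n. \<rho> a $$ (i,p) * \<rho> b $$ (p,k)) * \<sigma> (st b) $$ (l,j) / weight b)"
      unfolding sum_distrib_left sum_distrib_right sum_divide_distrib
      by (subst sum.swap) (simp add: mult.assoc)
    also have "\<dots> = (\<Sum>b\<in>B. \<rho> (a * b) $$ (i,k) * \<sigma> (st b) $$ (l,j) / weight b)"
      using representation_mult_entry[OF \<rho> a _ ij(1) kl(1)] basis_closed by simp
    also have "\<dots> = (\<Sum>b\<in>B. \<rho> b $$ (i,k) * \<sigma> (st b * a) $$ (l,j) / weight b)"
      using casimir[of "\<lambda>x y. \<rho> x $$ (i,k) * \<sigma> y $$ (l,j)", OF scal(1) scal(2) a]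
        representation_functional[OF \<rho> ij(1) kl(1)] representation_functional[OF \<sigma> kl(2) ij(2)] by blast
    also have "\<dots> = (\<Sum>b\<in>B. \<rho> b $$ (i,k) * (\<Sum>p<m. \<sigma> (st b) $$ (l,p) * \<sigma> a $$ (p,j)) / weight b)"
      using representation_mult_entry[OF \<sigma> _ a kl(2) ij(2)] basis_closed star_closed by simp
    also have "\<dots> = (\<Sum>p<m. (\<Sum>b\<in>B. \<rho> b $$ (i,k) * \<sigma> (st b) $$ (l,p) / weight b) * \<sigma> a $$ (p,j))"
      unfolding sum_distrib_left sum_distrib_right sum_divide_distrib
      by (subst sum.swap) (simp add: ac_simps)
    also have "\<dots> = (?T * \<sigma> a) $$ (i,j)"
      using ij c T by (simp add: scalar_prod_def lessThan_atLeast0 coefficient_intertwiner_def)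
    finally show "(\<rho> a * ?T) $$ (i,j) = (?T * \<sigma> a) $$ (i,j)" .
  qed (use T c in auto)
qed

text \<open>Inequivalence is expressed by different traces at one element: a nonzero averaged
  intertwiner would be invertible and force equal traces everywhere.\<close>

lemma coefficient_orthogonality:
  assumes \<rho>: "is_irreducible_rep A u n \<rho>" and \<sigma>: "is_irreducible_rep A u m \<sigma>"
    and x: "x \<in> A" "mat_trace (\<rho> x) \<noteq> mat_trace (\<sigma> x)"
    and ij: "i < n" "k < n" "l < m" "j < m"
  shows "(\<Sum>b\<in>B. \<rho> b $$ (i,k) * \<sigma> (st b) $$ (l,j) / weight b) = 0"
proof -
  let ?T = "coefficient_intertwiner n m \<rho> \<sigma> k l"
  have "?T = 0\<^sub>m n m"
  proof (rule ccontr)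
    assume "?T \<noteq> 0\<^sub>m n m"
    moreover have "\<rho> a * ?T = ?T * \<sigma> a" if "a \<in> A" for a
      using coefficient_intertwiner_comm that \<rho> \<sigma> ij by (auto simp: is_irreducible_rep_def)
    moreover have "?T \<in> carrier_mat n m" by (simp add: coefficient_intertwiner_def)
    ultimately show False using irreducible_intertwiner_mat_trace[OF \<rho> \<sigma>] x by blast
  qed
  then have "?T $$ (i,j) = 0\<^sub>m n m $$ (i,j)" by simp
  then show ?thesis using ij by (simp add: coefficient_intertwiner_def)
qed

section \<open>Irreducible characters and the involution\<close>

lemma adjoint_representation:
  assumes \<rho>: "is_representation A u n \<rho>"
  shows "is_representation A u n (\<lambda>x. mat n n (\<lambda>(i,j). cnj (\<rho> (st x) $$ (j,i))))"
  unfolding is_representation_def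
proof (intro conjI ballI allI)
  let ?\<sigma> = "\<lambda>x. mat n n (\<lambda>(i,j). cnj (\<rho> (st x) $$ (j,i)))"
  have c: "\<rho> x \<in> carrier_mat n n" if "x \<in> A" for x
    using \<rho> that by (auto simp: is_representation_def)
  have f: "\<rho> (x + y) $$ (i,j) = \<rho> x $$ (i,j) + \<rho> y $$ (i,j)" "\<rho> (c *\<^sub>C x) $$ (i,j) = c * \<rho> x $$ (i,j)"
    if "x \<in> A" "y \<in> A" "i < n" "j < n" for x y c i j
    using representation_functional[OF \<rho> that(3,4)] that unfolding functional_on_def by blast+
  show "?\<sigma> x \<in> carrier_mat n n" for x by simp
  show "?\<sigma> (x + y) = ?\<sigma> x + ?\<sigma> y" if "x \<in> A" "y \<in> A" for x y
    using that by (intro eq_matI) (auto simp: star_add f star_closed)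
  show "?\<sigma> (k *\<^sub>C x) = k \<cdot>\<^sub>m ?\<sigma> x" if "x \<in> A" for k x
    using that by (intro eq_matI) (auto simp: star_scale f star_closed)
  show "?\<sigma> (x * y) = ?\<sigma> x * ?\<sigma> y" if "x \<in> A" "y \<in> A" for x y
    using that
    by (intro eq_matI)
      (auto simp: star_mult representation_mult_entry[OF \<rho>] star_closed scalar_prod_def lessThan_atLeast0
        mult.commute)
  have "\<rho> u = 1\<^sub>m n" using \<rho> by (auto simp: is_representation_def)
  then show "?\<sigma> u = 1\<^sub>m n" by (intro eq_matI) (auto simp: star_one)
qed

text \<open>\<open>\<rho>\<close> is equivalent to its adjoint \<open>\<sigma>\<close>, the
  conjugate transpose of \<open>\<rho> (st x)\<close>; comparing traces gives the claim. The
  equivalence is an averaged intertwiner, and positivity of the weights shows that it does not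
  vanish.\<close>

lemma irreducible_trace_star:
  assumes irr: "is_irreducible_rep A u n \<rho>" and x: "x \<in> A"
  shows "mat_trace (\<rho> (st x)) = cnj (mat_trace (\<rho> x))"
proof -
  define \<sigma> where "\<sigma> = (\<lambda>x. mat n n (\<lambda>(i,j). cnj (\<rho> (st x) $$ (j,i))))"
  have \<rho>: "is_representation A u n \<rho>" and n: "0 < n" using irr by (auto simp: is_irreducible_rep_def)
  have \<sigma>: "is_representation A u n \<sigma>" unfolding \<sigma>_def by (rule adjoint_representation[OF \<rho>])
  define T where "T = coefficient_intertwiner n n \<sigma> \<rho> 0 0"
  have T: "T \<in> carrier_mat n n" by (simp add: T_def coefficient_intertwiner_def)
  have comm: "\<sigma> a * T = T * \<rho> a" if "a \<in> A" for a
    unfolding T_def using coefficient_intertwiner_comm[OF \<sigma> \<rho> n n that] .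
  have "T \<noteq> 0\<^sub>m n n"
  proof
    assume "T = 0\<^sub>m n n"
    then have "T $$ (0,0) = 0" using n by simp
    \<comment> \<open>With \<open>k = l = 0\<close> the \<open>(0,0)\<close> entry of
      \<open>T\<close> is a weighted sum of squared moduli. If it were zero, all
      \<open>\<rho> (st b)\<close>, and hence \<open>\<rho> u\<close>, would have entry
      \<open>0\<close> at \<open>(0,0)\<close>.\<close>
    then have "(\<Sum>b\<in>B. cnj (\<rho> (st b) $$ (0,0)) * \<rho> (st b) $$ (0,0) / weight b) = 0"
      using n by (simp add: T_def coefficient_intertwiner_def \<sigma>_def)
    then have "(\<Sum>b\<in>B. \<rho> (st b) $$ (0,0) * cnj (\<rho> (st b) $$ (0,0)) / weight b) = 0"
      by (simp add: mult.commute)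
    then have "\<rho> (st b) $$ (0,0) = 0" if "b \<in> B" for b
      using that by (rule weighted_square_sum_eq_0D)
    then have "\<rho> u $$ (0,0) = 0"
      using functional_expansion_star[OF representation_functional[OF \<rho> n n] one_closed] by simp
    then show False using \<rho> n by (simp add: is_representation_def)
  qed
  then have inj: "v = 0\<^sub>v n" if "v \<in> carrier_vec n" "T *\<^sub>v v = 0\<^sub>v n" for v
    using intertwiner_injective[OF irr T _ _ comm that] \<sigma> by (auto simp: is_representation_def)
  \<comment> \<open>Injectivity comes from irreducibility of \<open>\<rho>\<close> alone; since
    \<open>T\<close> is square, it yields an inverse.\<close>
  then have "det T \<noteq> 0" using det_0_iff_vec_prod_zero_field[OF T] by auto
  then obtain R where R: "R \<in> carrier_mat n n" "T * R = 1\<^sub>m n" "R * T = 1\<^sub>m n"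
    using det_non_zero_imp_unit[OF T, of "()"] by (auto simp: Units_def ring_mat_def)
  have "mat_trace (\<sigma> x) = mat_trace (\<rho> x)"
    using mat_trace_eq_if_intertwined[OF _ _ T R(1,2,3) comm[OF x]] \<rho> \<sigma> x
    by (auto simp: is_representation_def)
  moreover have "mat_trace (\<sigma> x) = cnj (mat_trace (\<rho> (st x)))"
    using mat_trace_representation[OF \<rho> star_closed[OF x]] mat_trace_representation[OF \<sigma> x]
    by (simp add: \<sigma>_def)
  ultimately show ?thesis by (metis complex_cnj_cnj)
qed

lemma irreducible_rep_representation: "is_irreducible_rep A u n \<rho> \<Longrightarrow> is_representation A u n \<rho>"
  by (simp add: is_irreducible_rep_def)

subsection \<open>Orthogonality of irreducible characters\<close>

lemma Irr_cases:
  assumes "\<chi> \<in> Irr A u"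
  obtains n \<rho> where "is_irreducible_rep A u n \<rho>" "\<chi> \<in> extensional A" "0 < n"
    "\<forall>x\<in>A. \<chi> x = mat_trace (\<rho> x)" "\<forall>x\<in>A. \<chi> x = (\<Sum>i<n. \<rho> x $$ (i,i))"
proof -
  obtain n \<rho> where \<rho>: "is_irreducible_rep A u n \<rho>" "\<chi> = restrict (\<lambda>x. mat_trace (\<rho> x)) A"
    using assms by (auto simp: Irr_def)
  then have "is_representation A u n \<rho>" "0 < n" by (auto simp: is_irreducible_rep_def)
  then show ?thesis using that[OF \<rho>(1)] \<rho>(2) mat_trace_representation by auto
qed

lemma Irr_functional:
  assumes "\<chi> \<in> Irr A u" shows "functional_on A \<chi>"
proof -
  obtain n \<rho> where \<rho>: "is_irreducible_rep A u n \<rho>" "\<chi> \<in> extensional A" "0 < n"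
    "\<forall>x\<in>A. \<chi> x = mat_trace (\<rho> x)" "\<forall>x\<in>A. \<chi> x = (\<Sum>i<n. \<rho> x $$ (i,i))"
    by (rule Irr_cases[OF assms])
  have "functional_on A (\<lambda>x. \<rho> x $$ (i,i))" if "i < n" for i
    by (rule representation_functional[OF irreducible_rep_representation[OF \<rho>(1)] that that])
  then show ?thesis
    unfolding functional_on_def
    by (simp add: \<rho>(5) add_closed scale_closed sum.distrib sum_distrib_left)
qed

lemma Irr_mult_commute:
  assumes "\<chi> \<in> Irr A u" "x \<in> A" "y \<in> A" shows "\<chi> (x * y) = \<chi> (y * x)"
proof -
  obtain n \<rho> where \<rho>: "is_irreducible_rep A u n \<rho>" "\<chi> \<in> extensional A" "0 < n"
    "\<forall>x\<in>A. \<chi> x = mat_trace (\<rho> x)" "\<forall>x\<in>A. \<chi> x = (\<Sum>i<n. \<rho> x $$ (i,i))"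
    by (rule Irr_cases[OF assms(1)])
  from irreducible_rep_representation[OF \<rho>(1)]
  have "\<rho> x \<in> carrier_mat n n" "\<rho> y \<in> carrier_mat n n" "\<rho> (x * y) = \<rho> x * \<rho> y" "\<rho> (y * x) = \<rho> y * \<rho> x"
    using assms(2,3) unfolding is_representation_def by auto
  then show ?thesis using assms \<rho>(4) mult_closed mat_trace_mult_comm by simp
qed

lemma Irr_star:
  assumes "\<chi> \<in> Irr A u" "x \<in> A" shows "\<chi> (st x) = cnj (\<chi> x)"
proof -
  obtain n \<rho> where \<rho>: "is_irreducible_rep A u n \<rho>" "\<chi> \<in> extensional A" "0 < n"
    "\<forall>x\<in>A. \<chi> x = mat_trace (\<rho> x)" "\<forall>x\<in>A. \<chi> x = (\<Sum>i<n. \<rho> x $$ (i,i))"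
    by (rule Irr_cases[OF assms(1)])
  then show ?thesis using irreducible_trace_star[OF \<rho>(1) assms(2)] assms(2) star_closed by simp
qed

lemma Irr_one_nonzero:
  assumes "\<chi> \<in> Irr A u" shows "\<chi> u \<noteq> 0"
proof -
  obtain n \<rho> where \<rho>: "is_irreducible_rep A u n \<rho>" "\<chi> \<in> extensional A" "0 < n"
    "\<forall>x\<in>A. \<chi> x = mat_trace (\<rho> x)" "\<forall>x\<in>A. \<chi> x = (\<Sum>i<n. \<rho> x $$ (i,i))"
    by (rule Irr_cases[OF assms])
  have "\<chi> u = (\<Sum>i<n. \<rho> u $$ (i,i))" using \<rho>(5) one_closed by blast
  then show ?thesis using \<rho>(1,3) by (simp add: is_irreducible_rep_def is_representation_def)
qed

lemma Irr_eqI: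
  assumes "\<chi> \<in> Irr A u" "\<psi> \<in> Irr A u" "\<And>x. x \<in> A \<Longrightarrow> \<chi> x = \<psi> x"
  shows "\<chi> = \<psi>"
proof -
  have "\<chi> \<in> extensional A" "\<psi> \<in> extensional A"
    using assms(1,2) by (auto simp: Irr_def)
  then show ?thesis using assms(3) by (rule extensionalityI)
qed

text \<open>The extra factor \<open>a\<close> is harmless, since all matrix coefficients are
  orthogonal and not just the diagonal ones. With \<open>a = u\<close> this is ordinary
  orthogonality; with \<open>a = e\<close> it compares characters on the corner.\<close>

lemma Irr_orthogonal:
  assumes \<chi>: "\<chi> \<in> Irr A u" and \<psi>: "\<psi> \<in> Irr A u" and neq: "\<chi> \<noteq> \<psi>" and a: "a \<in> A"
  shows "(\<Sum>b\<in>B. \<chi> b * \<psi> (st b * a) / weight b) = 0"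
proof -
  obtain x where x: "x \<in> A" "\<chi> x \<noteq> \<psi> x" using Irr_eqI[OF \<chi> \<psi>] neq by blast
  obtain n \<rho> where \<rho>: "is_irreducible_rep A u n \<rho>" "\<chi> \<in> extensional A" "0 < n"
    "\<forall>x\<in>A. \<chi> x = mat_trace (\<rho> x)" "\<forall>x\<in>A. \<chi> x = (\<Sum>i<n. \<rho> x $$ (i,i))"
    by (rule Irr_cases[OF \<chi>])
  obtain m \<sigma> where \<sigma>: "is_irreducible_rep A u m \<sigma>" "\<psi> \<in> extensional A" "0 < m"
    "\<forall>x\<in>A. \<psi> x = mat_trace (\<sigma> x)" "\<forall>x\<in>A. \<psi> x = (\<Sum>i<m. \<sigma> x $$ (i,i))"
    by (rule Irr_cases[OF \<psi>])
  have rep: "is_representation A u m \<sigma>" using \<sigma>(1) by (simp add: is_irreducible_rep_def)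
  have "(\<Sum>b\<in>B. \<chi> b * \<psi> (st b * a) / weight b)
    = (\<Sum>b\<in>B. (\<Sum>i<n. \<rho> b $$ (i,i)) * (\<Sum>l<m. \<Sum>p<m. \<sigma> (st b) $$ (l,p) * \<sigma> a $$ (p,l)) / weight b)"
    using basis_closed star_closed a mult_closed
    by (intro sum.cong) (simp_all add: \<rho>(5) \<sigma>(5) representation_mult_entry[OF rep])
  also have "\<dots> = (\<Sum>b\<in>B. \<Sum>i<n. \<Sum>l<m. \<Sum>p<m. \<rho> b $$ (i,i) * \<sigma> (st b) $$ (l,p) / weight b * \<sigma> a $$ (p,l))"
    by (simp only: sum_distrib_right, simp only: sum_distrib_left sum_divide_distrib,
        intro sum.cong refl, simp)
  also have "\<dots> = (\<Sum>i<n. \<Sum>l<m. \<Sum>p<m. \<Sum>b\<in>B. \<rho> b $$ (i,i) * \<sigma> (st b) $$ (l,p) / weight b * \<sigma> a $$ (p,l))"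
    by (subst sum.swap, rule sum.cong[OF refl], subst sum.swap, rule sum.cong[OF refl], rule sum.swap)
  also have "\<dots> = (\<Sum>i<n. \<Sum>l<m. \<Sum>p<m. (\<Sum>b\<in>B. \<rho> b $$ (i,i) * \<sigma> (st b) $$ (l,p) / weight b) * \<sigma> a $$ (p,l))"
    by (simp add: sum_distrib_right)
  also have "\<dots> = 0"
    using coefficient_orthogonality[OF \<rho>(1) \<sigma>(1) x(1)] x \<rho>(4) \<sigma>(4) by simp
  finally show ?thesis .
qed

text \<open>The Casimir identity turns the sum into that of
  \<open>|\<chi> (e * b)|^2 / weight b\<close>, which vanishes only if
  \<open>\<chi> (e * x) = 0\<close> for all \<open>x\<close>, in particular
  \<open>\<chi> e = 0\<close>. For \<open>e = u\<close> this is the norm of \<open>\<chi>\<close>; a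
  proper projection serves to separate restrictions to a corner.\<close>

lemma Irr_self_product_nonzero:
  assumes \<chi>: "\<chi> \<in> Irr A u" and e: "e \<in> A" "e * e = e" "st e = e" and nz: "\<chi> e \<noteq> 0"
  shows "(\<Sum>b\<in>B. \<chi> b * \<chi> (st b * e) / weight b) \<noteq> 0"
proof
  assume 0: "(\<Sum>b\<in>B. \<chi> b * \<chi> (st b * e) / weight b) = 0"
  have f: "functional_on A \<chi>" by (rule Irr_functional[OF \<chi>])
  then have scal: "functional_on A (\<lambda>x. \<chi> x * c)" for c
    by (auto simp: functional_on_def algebra_simps)
  have scal': "functional_on A (\<lambda>y. c * \<chi> (y * e))" for c
    using functional_on_mult_right[OF f e(1)] by (auto simp: functional_on_def algebra_simps)
  \<comment> \<open>One of the two copies of \<open>e\<close> in \<open>e = e * e\<close> moves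
    across the Casimir element.\<close>
  have "(\<Sum>b\<in>B. \<chi> (e * b) * \<chi> (st b * e) / weight b) = (\<Sum>b\<in>B. \<chi> b * \<chi> (st b * e * e) / weight b)"
    by (rule casimir[OF scal scal' e(1)])
  also have "\<dots> = 0" using 0 e(2) by (simp add: mult.assoc)
  finally have "(\<Sum>b\<in>B. \<chi> (e * b) * \<chi> (st b * e) / weight b) = 0" .
  moreover have "\<chi> (st b * e) = cnj (\<chi> (e * b))" if "b \<in> B" for b
    using Irr_star[OF \<chi>, of "e * b"] star_mult[of e b] e basis_closed[OF that] mult_closed by simp
  ultimately have "(\<Sum>b\<in>B. \<chi> (e * b) * cnj (\<chi> (e * b)) / weight b) = 0" by simp
  then have "\<chi> (e * b) = 0" if "b \<in> B" for b using that by (rule weighted_square_sum_eq_0D)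
  then have "\<chi> (e * u) = 0"
    using functional_expansion[OF functional_on_mult_left[OF f e(1)] one_closed] by simp
  then show False using nz one_right[OF e(1)] by simp
qed

definition Irr_norm :: "('a \<Rightarrow> complex) \<Rightarrow> complex" where
  "Irr_norm \<chi> = (\<Sum>b\<in>B. \<chi> b * \<chi> (st b) / weight b)"

lemma Irr_norm_nonzero:
  assumes "\<chi> \<in> Irr A u" shows "Irr_norm \<chi> \<noteq> 0"
  using Irr_self_product_nonzero[OF assms one_closed one_left star_one Irr_one_nonzero[OF assms]]
    one_closed basis_closed star_closed one_right by (simp add: Irr_norm_def)

lemma Irr_inner:
  assumes "\<chi> \<in> Irr A u" "\<psi> \<in> Irr A u"
  shows "(\<Sum>b\<in>B. \<chi> b * \<psi> (st b) / weight b) = (if \<chi> = \<psi> then Irr_norm \<chi> else 0)"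
  using Irr_orthogonal[OF assms _ one_closed] basis_closed star_closed one_right
  by (simp add: Irr_norm_def)

text \<open>Orthogonality factors an identity matrix through the coordinates indexed by
  \<open>B\<close>: more than \<open>card B\<close> characters would give a right-invertible matrix
  with too few columns.\<close>

lemma finite_Irr: "finite (Irr A u)"
proof (rule ccontr)
  assume "infinite (Irr A u)"
  then obtain F where F: "F \<subseteq> Irr A u" "finite F" "card F = Suc (card B)"
    using infinite_arbitrarily_large by blast
  define k where "k = card F"
  define n where "n = card B"
  obtain f where f: "bij_betw f {0..<k} F" using ex_bij_betw_nat_finite[OF F(2)] k_def by blast
  obtain g where g: "bij_betw g {0..<n} B" using ex_bij_betw_nat_finite[OF finite_basis] n_def by blast
  define R where "R = mat k n (\<lambda>(i,p). f i (g p))"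
  define S where "S = mat n k (\<lambda>(p,j). f j (st (g p)) / weight (g p) / Irr_norm (f j))"
  have fF: "f i \<in> Irr A u" if "i < k" for i using f F(1) that by (auto simp: bij_betw_def)
  have "R * S = 1\<^sub>m k"
  proof (rule eq_matI)
    fix i j assume "i < dim_row (1\<^sub>m k :: complex mat)" "j < dim_col (1\<^sub>m k :: complex mat)"
    then have ij: "i < k" "j < k" by auto
    have "(R * S) $$ (i,j) = (\<Sum>p\<in>{0..<n}. f i (g p) * f j (st (g p)) / weight (g p) / Irr_norm (f j))"
      using ij by (simp add: R_def S_def scalar_prod_def)
    also have "\<dots> = (\<Sum>b\<in>B. f i b * f j (st b) / weight b / Irr_norm (f j))"
      by (rule sum.reindex_bij_betw[OF g])
    also have "\<dots> = (\<Sum>b\<in>B. f i b * f j (st b) / weight b) / Irr_norm (f j)"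
      by (rule sum_divide_distrib[symmetric])
    also have "\<dots> = (if f i = f j then 1 else 0)"
      using Irr_inner[OF fF fF] Irr_norm_nonzero[OF fF] ij by simp
    also have "f i = f j \<longleftrightarrow> i = j"
      using f ij by (auto simp: bij_betw_def inj_on_def)
    finally show "(R * S) $$ (i,j) = 1\<^sub>m k $$ (i,j)" using ij by simp
  qed (auto simp: R_def S_def)
  then have "k \<le> n" using left_inverse_dim_le[of R k n S] by (simp add: R_def S_def)
  then show False using F(3) by (simp add: k_def n_def)
qed

lemma Irr_combination_inner:
  assumes \<psi>: "\<psi> \<in> Irr A u"
  shows "(\<Sum>b\<in>B. (\<Sum>\<chi>\<in>Irr A u. m \<chi> * \<chi> b) * \<psi> (st b) / weight b) = m \<psi> * Irr_norm \<psi>"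
proof -
  have "(\<Sum>b\<in>B. (\<Sum>\<chi>\<in>Irr A u. m \<chi> * \<chi> b) * \<psi> (st b) / weight b)
    = (\<Sum>b\<in>B. \<Sum>\<chi>\<in>Irr A u. m \<chi> * (\<chi> b * \<psi> (st b) / weight b))"
    by (simp add: sum_distrib_right sum_divide_distrib mult.assoc)
  also have "\<dots> = (\<Sum>\<chi>\<in>Irr A u. m \<chi> * (\<Sum>b\<in>B. \<chi> b * \<psi> (st b) / weight b))"
    by (subst sum.swap) (simp add: sum_distrib_left)
  also have "\<dots> = (\<Sum>\<chi>\<in>Irr A u. if \<chi> = \<psi> then m \<psi> * Irr_norm \<psi> else 0)"
    by (intro sum.cong) (auto simp: Irr_inner \<psi>)
  finally show ?thesis using \<psi> finite_Irr by simp
qed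

lemma Irr_coefficients_unique:
  assumes eq: "\<And>x. x \<in> A \<Longrightarrow> (\<Sum>\<chi>\<in>Irr A u. m \<chi> * \<chi> x) = (\<Sum>\<chi>\<in>Irr A u. m' \<chi> * \<chi> x)"
    and \<psi>: "\<psi> \<in> Irr A u"
  shows "m \<psi> = m' \<psi>"
proof -
  have "m \<psi> * Irr_norm \<psi> = m' \<psi> * Irr_norm \<psi>"
    unfolding Irr_combination_inner[OF \<psi>, symmetric] using basis_closed by (simp add: eq)
  then show ?thesis using Irr_norm_nonzero[OF \<psi>] by simp
qed

lemma std_feasible_mult_eqI:
  assumes "m \<in> extensional (Irr A u)"
    and "\<And>x. x \<in> A \<Longrightarrow> std_feasible_trace u st B x = (\<Sum>\<chi>\<in>Irr A u. m \<chi> * \<chi> x)"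
  shows "std_feasible_mult A u st B = m"
  unfolding std_feasible_mult_def
proof (rule the_equality)
  show "m \<in> extensional (Irr A u) \<and>
    (\<forall>x\<in>A. std_feasible_trace u st B x = (\<Sum>\<chi>\<in>Irr A u. m \<chi> * \<chi> x))" using assms by blast
  fix m' assume m': "m' \<in> extensional (Irr A u) \<and>
    (\<forall>x\<in>A. std_feasible_trace u st B x = (\<Sum>\<chi>\<in>Irr A u. m' \<chi> * \<chi> x))"
  show "m' = m"
  proof (rule extensionalityI)
    show "m' \<in> extensional (Irr A u)" "m \<in> extensional (Irr A u)" using m' assms by auto
    show "m' \<psi> = m \<psi>" if "\<psi> \<in> Irr A u" for \<psi>
      using that by (rule Irr_coefficients_unique[rotated]) (use assms(2) m' in simp)
  qed
qed

subsection \<open>Decomposition of trace functionals\<close>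

text \<open>Schur's lemma over the complex numbers: for an eigenvalue \<open>c\<close>, the matrix
  \<open>\<rho> z - c\<close> is an intertwiner with nonzero kernel, so it is zero.\<close>

lemma central_element_scalar:
  assumes irr: "is_irreducible_rep A u n \<rho>" and z: "z \<in> A" and central: "\<And>x. x \<in> A \<Longrightarrow> x * z = z * x"
  shows "\<exists>c. \<rho> z = c \<cdot>\<^sub>m 1\<^sub>m n"
proof -
  have rep: "is_representation A u n \<rho>" and n: "0 < n" using irr by (auto simp: is_irreducible_rep_def)
  have c: "\<rho> x \<in> carrier_mat n n" if "x \<in> A" for x using rep that by (auto simp: is_representation_def)
  obtain c where "c \<in> spectrum (\<rho> z)" using spectrum_non_empty[OF c[OF z] n] by blast
  then obtain v where v: "v \<in> carrier_vec n" "v \<noteq> 0\<^sub>v n" "\<rho> z *\<^sub>v v = c \<cdot>\<^sub>v v"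
    using c[OF z] by (auto simp: spectrum_def eigenvalue_def eigenvector_def)
  define T where "T = \<rho> z + (- c) \<cdot>\<^sub>m 1\<^sub>m n"
  have T: "T \<in> carrier_mat n n" using c[OF z] by (simp add: T_def)
  have "T = 0\<^sub>m n n"
  proof (rule ccontr)
    assume T0: "T \<noteq> 0\<^sub>m n n"
    have comm: "\<rho> x * T = T * \<rho> x" if x: "x \<in> A" for x
    proof -
      have "\<rho> x * \<rho> z = \<rho> z * \<rho> x"
        using rep x z central[OF x] unfolding is_representation_def by metis
      then show ?thesis using c[OF x] c[OF z] unfolding T_def
        by (simp add: mult_add_distrib_mat[of _ n n] add_mult_distrib_mat[of _ n n]
            mult_smult_distrib[of "\<rho> x" n n _ n] mult_smult_assoc_mat[of _ n n])
    qed
    have "T *\<^sub>v v = \<rho> z *\<^sub>v v + (- c) \<cdot>\<^sub>v v"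
      unfolding T_def using c[OF z] v(1)
      by (simp add: add_mult_distrib_mat_vec[of _ n n] smult_mult_mat_vec[of _ n n])
    also have "\<dots> = 0\<^sub>v n" unfolding v(3) using v(1) by (intro eq_vecI) auto
    finally show False using intertwiner_injective[OF irr T T0 c comm v(1)] v(2) by blast
  qed
  have "\<rho> z = c \<cdot>\<^sub>m 1\<^sub>m n"
  proof (rule eq_matI)
    fix i j assume "i < dim_row (c \<cdot>\<^sub>m 1\<^sub>m n)" "j < dim_col (c \<cdot>\<^sub>m 1\<^sub>m n)"
    then have ij: "i < n" "j < n" by auto
    then have "T $$ (i,j) = \<rho> z $$ (i,j) - (c \<cdot>\<^sub>m 1\<^sub>m n) $$ (i,j)"
      using c[OF z] by (simp add: T_def)
    moreover have "T $$ (i,j) = 0" using \<open>T = 0\<^sub>m n n\<close> ij by simp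
    ultimately show "\<rho> z $$ (i,j) = (c \<cdot>\<^sub>m 1\<^sub>m n) $$ (i,j)" by simp
  qed (use c[OF z] in auto)
  then show ?thesis ..
qed

text \<open>Definiteness is used twice for \<open>y = z * x\<close>: \<open>z * y = 0\<close> gives
  \<open>st z * y = 0\<close> because \<open>z\<close> commutes with \<open>st z\<close>, and
  \<open>st z * y = 0\<close> gives \<open>y = 0\<close> because \<open>st z\<close> acts as the
  adjoint of \<open>z\<close>.\<close>

lemma central_mult_cancel:
  assumes z: "z \<in> A" and central: "\<And>x. x \<in> A \<Longrightarrow> x * z = z * x" and x: "x \<in> A"
    and 0: "z * (z * x) = 0"
  shows "z * x = 0"
proof -
  define y where "y = z * x"
  have y: "y \<in> A" using z x mult_closed by (simp add: y_def)
  have sz: "st z \<in> A" and sy: "st y \<in> A" using z y star_closed by auto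
  have szy: "st z * y \<in> A" using sz y mult_closed by simp
  have "st z * y = 0"
  proof (rule trace_definite[OF szy])
    have "st (st z * y) = st y * z" using star_mult[OF sz y] star_star[OF z] by simp
    then have "\<tau> (st z * y * st (st z * y)) = \<tau> (st z * y * st y * z)" by (simp add: mult.assoc)
    also have "\<dots> = \<tau> (z * (st z * y * st y))"
      by (rule trace_commute[OF mult_closed[OF szy sy] z])
    also have "z * (st z * y * st y) = (z * st z) * (y * st y)" by (simp add: mult.assoc)
    also have "\<dots> = st z * (z * y) * st y" by (simp add: central[OF sz, symmetric] mult.assoc)
    also have "z * y = 0" using 0 by (simp add: y_def)
    finally show "\<tau> (st z * y * st (st z * y)) = 0"
      using functional_on_sum[OF trace_functional subspace_carrier, of "{}"] by simp
  qed
  have "y = 0"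
  proof (rule trace_definite[OF y])
    have sx: "st x \<in> A" using x star_closed by simp
    have "\<tau> (y * st y) = \<tau> (y * st x * st z)" using star_mult[OF z x] by (simp add: y_def mult.assoc)
    also have "\<dots> = \<tau> (st z * (y * st x))" by (rule trace_commute[OF mult_closed[OF y sx] sz])
    also have "st z * (y * st x) = 0" using \<open>st z * y = 0\<close> by (simp flip: mult.assoc)
    finally show "\<tau> (y * st y) = 0"
      using functional_on_sum[OF trace_functional subspace_carrier, of "{}"] by simp
  qed
  then show ?thesis by (simp add: y_def)
qed

text \<open>
  On the left ideal generated by a central element, that element acts injectively, because it is
  normal for the definite form.
\<close>

lemma central_element_eq_0:
  assumes z: "z \<in> A" and central: "\<And>x. x \<in> A \<Longrightarrow> x * z = z * x"
    and kill: "\<And>n \<rho>. is_irreducible_rep A u n \<rho> \<Longrightarrow> \<rho> z = 0\<^sub>m n n"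
  shows "z = 0"
proof (rule ccontr)
  assume z0: "z \<noteq> 0"
  define n where "n = card B"
  obtain g where g: "bij_betw g {0..<n} B" using ex_bij_betw_nat_finite[OF finite_basis] n_def by blast
  have gB: "g i \<in> B" if "i < n" for i using g that by (auto simp: bij_betw_def)
  have ginj: "g i = g j \<longleftrightarrow> i = j" if "i < n" "j < n" for i j
    using g that by (auto simp: bij_betw_def inj_on_def)
  have gA: "g i \<in> A" "st (g i) \<in> A" if "i < n" for i using gB[OF that] basis_closed star_closed by auto
  have exp: "f x = (\<Sum>p<n. \<tau> (x * st (g p)) / weight (g p) * f (g p))"
    if "functional_on A f" "x \<in> A" for f x
    using functional_expansion[OF that] sum.reindex_bij_betw[OF g, of "\<lambda>b. \<tau> (x * st b) / weight b * f b"]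
    by (simp add: lessThan_atLeast0)
  \<comment> \<open>\<open>\<kappa>\<close> takes coordinates in the enumerated basis, and
    \<open>L\<close> is the left regular representation written in these coordinates.\<close>
  define \<kappa> where "\<kappa> x = vec n (\<lambda>i. \<tau> (x * st (g i)) / weight (g i))" for x
  define L where "L a = mat n n (\<lambda>(i,j). \<tau> (a * g j * st (g i)) / weight (g i))" for a
  have tr_add: "\<tau> ((x + y) * w) = \<tau> (x * w) + \<tau> (y * w)" "\<tau> ((c *\<^sub>C x) * w) = c * \<tau> (x * w)"
    if "x \<in> A" "y \<in> A" "w \<in> A" for x y w c
    using functional_on_mult_right[OF trace_functional that(3)] that(1,2) by (auto simp: functional_on_def)
  have \<kappa>c: "\<kappa> x \<in> carrier_vec n" for x by (simp add: \<kappa>_def)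
  have \<kappa>_add: "\<kappa> (x + y) = \<kappa> x + \<kappa> y" and \<kappa>_scale: "\<kappa> (c *\<^sub>C x) = c \<cdot>\<^sub>v \<kappa> x" if "x \<in> A" "y \<in> A" for x y c
    using that gA by (auto simp: \<kappa>_def tr_add add_divide_distrib intro!: eq_vecI)
  have \<kappa>_inj: "x = 0" if x: "x \<in> A" and "\<kappa> x = 0\<^sub>v n" for x
  proof -
    have "\<tau> (x * st b) / weight b = 0" if b: "b \<in> B" for b
    proof -
      obtain i where i: "i < n" "b = g i" using g b by (auto simp: bij_betw_def)
      then have "\<kappa> x $ i = 0" using \<open>\<kappa> x = 0\<^sub>v n\<close> by simp
      then show ?thesis using i by (simp add: \<kappa>_def)
    qed
    then have "(\<Sum>b\<in>B. (\<tau> (x * st b) / weight b) *\<^sub>C b) = 0"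
      by (intro sum.neutral ballI) (simp only: scale_zero_left)
    then show ?thesis by (simp only: expansion[OF x, symmetric])
  qed
  have f: "functional_on A (\<lambda>y. \<tau> (a * y * st (g i)) / weight (g i))" if "a \<in> A" "i < n" for a i
    using functional_on_mult_left[OF functional_on_mult_right[OF trace_functional gA(2)[OF that(2)]] that(1)]
    by (simp add: functional_on_def add_divide_distrib)
  have L\<kappa>: "L a *\<^sub>v \<kappa> x = \<kappa> (a * x)" if "a \<in> A" "x \<in> A" for a x
  proof (rule eq_vecI)
    fix i assume "i < dim_vec (\<kappa> (a * x))"
    then have i: "i < n" by (simp add: \<kappa>_def)
    have "(L a *\<^sub>v \<kappa> x) $ i = (\<Sum>p<n. \<tau> (x * st (g p)) / weight (g p) * (\<tau> (a * g p * st (g i)) / weight (g i)))"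
      using i by (simp add: L_def \<kappa>_def scalar_prod_def lessThan_atLeast0 mult.commute)
    also have "\<dots> = \<tau> (a * x * st (g i)) / weight (g i)" by (rule exp[OF f[OF that(1) i] that(2), symmetric])
    finally show "(L a *\<^sub>v \<kappa> x) $ i = \<kappa> (a * x) $ i" using i by (simp add: \<kappa>_def)
  qed (simp add: L_def \<kappa>_def)
  have col: "col (L a) j = \<kappa> (a * g j)" if "j < n" for a j
    using that by (intro eq_vecI) (auto simp: L_def \<kappa>_def)
  have L: "is_representation A u n L"
    unfolding is_representation_def
  proof (intro conjI ballI allI)
    show "L x \<in> carrier_mat n n" for x by (simp add: L_def)
    show "L (x + y) = L x + L y" if "x \<in> A" "y \<in> A" for x y
      using that gA by (intro eq_matI)
        (auto simp: L_def mult.assoc tr_add mult_closed add_divide_distrib)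
    show "L (c *\<^sub>C x) = c \<cdot>\<^sub>m L x" if "x \<in> A" for c x
      using that gA by (intro eq_matI) (auto simp: L_def mult.assoc tr_add mult_closed)
    show "L (x * y) = L x * L y" if xy: "x \<in> A" "y \<in> A" for x y
    proof (rule mat_col_eqI)
      fix j assume "j < dim_col (L x * L y)"
      then have j: "j < n" by (simp add: L_def)
      have "col (L x * L y) j = L x *\<^sub>v col (L y) j" using j by (intro col_mult2[of _ n n _ n]) (auto simp: L_def)
      also have "\<dots> = \<kappa> (x * (y * g j))" using col[OF j] L\<kappa> xy gA[OF j] mult_closed by simp
      finally show "col (L (x * y)) j = col (L x * L y) j" using col[OF j] by (simp add: mult.assoc)
    qed (auto simp: L_def)
    show "L u = 1\<^sub>m n"
      using gA gB by (intro eq_matI) (auto simp: L_def one_left trace_basis ginj weight_nonzero)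
  qed
  \<comment> \<open>The ideal \<open>z A\<close> in coordinates. It is invariant under
    \<open>L\<close> because \<open>z\<close> is central, and nonzero because it contains
    \<open>z\<close>.\<close>
  define W where "W = \<kappa> ` (\<lambda>x. z * x) ` A"
  have WI: "\<kappa> (z * x) \<in> W" if "x \<in> A" for x using that by (auto simp: W_def)
  have zA: "z * x \<in> A" if "x \<in> A" for x using z that mult_closed by simp
  obtain k \<pi> S where \<pi>: "is_representation A u k \<pi>" "0 < k" "k \<le> n" and S: "S \<in> carrier_mat n k"
    and SW: "\<forall>v\<in>carrier_vec k. S *\<^sub>v v \<in> W" and S0: "\<forall>v\<in>carrier_vec k. S *\<^sub>v v = 0\<^sub>v n \<longrightarrow> v = 0\<^sub>v k"
    and comm: "\<forall>x\<in>A. \<forall>v\<in>carrier_vec k. S *\<^sub>v (\<pi> x *\<^sub>v v) = L x *\<^sub>v (S *\<^sub>v v)"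
    and "k = n \<longrightarrow> W = carrier_vec n"
  proof (rule subrepresentation[OF L one_closed, of W])
    show "W \<subseteq> carrier_vec n" by (auto simp: W_def \<kappa>c)
    have "\<kappa> (0 *\<^sub>C u) = 0 \<cdot>\<^sub>v \<kappa> u" using \<kappa>_scale one_closed by blast
    also have "\<dots> = 0\<^sub>v n" by (intro eq_vecI) (auto simp: \<kappa>_def)
    finally have "\<kappa> 0 = 0\<^sub>v n" by simp
    then show "0\<^sub>v n \<in> W" using WI[of 0] subspace_0[OF subspace_carrier] by simp
    show "v + w \<in> W" if "v \<in> W" "w \<in> W" for v w
    proof -
      obtain x y where xy: "x \<in> A" "y \<in> A" "v = \<kappa> (z * x)" "w = \<kappa> (z * y)" using \<open>v \<in> W\<close> \<open>w \<in> W\<close> by (auto simp: W_def)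
      then have "v + w = \<kappa> (z * (x + y))" using \<kappa>_add zA by (simp add: distrib_left)
      then show ?thesis using WI add_closed xy by simp
    qed
    show "c \<cdot>\<^sub>v v \<in> W" if "v \<in> W" for c v
    proof -
      obtain x where x: "x \<in> A" "v = \<kappa> (z * x)" using \<open>v \<in> W\<close> by (auto simp: W_def)
      then have "c \<cdot>\<^sub>v v = \<kappa> (z * (c *\<^sub>C x))" using \<kappa>_scale zA by (simp add: scale_mult_right)
      then show ?thesis using WI scale_closed x by simp
    qed
    show "L a *\<^sub>v w \<in> W" if a: "a \<in> A" and "w \<in> W" for a w
    proof -
      obtain x where x: "x \<in> A" "w = \<kappa> (z * x)" using \<open>w \<in> W\<close> by (auto simp: W_def)
      then have "L a *\<^sub>v w = \<kappa> (a * (z * x))" using L\<kappa> a zA by simp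
      also have "a * (z * x) = z * (a * x)" by (simp add: central[OF a] flip: mult.assoc)
      finally show ?thesis using WI mult_closed a x by simp
    qed
    have "\<kappa> (z * u) \<in> W" by (rule WI[OF one_closed])
    moreover have "\<kappa> (z * u) \<noteq> 0\<^sub>v n" using \<kappa>_inj[OF z] z0 one_right[OF z] by auto
    ultimately show "W \<noteq> {0\<^sub>v n}" by blast
  qed
  have "v = 0\<^sub>v k" if v: "v \<in> carrier_vec k" "\<pi> z *\<^sub>v v = 0\<^sub>v k" for v
  proof -
    obtain x where x: "x \<in> A" "S *\<^sub>v v = \<kappa> (z * x)" using SW v(1) by (auto simp: W_def)
    have "\<kappa> (z * (z * x)) = L z *\<^sub>v (S *\<^sub>v v)" using L\<kappa> x z zA by simp
    also have "\<dots> = S *\<^sub>v (0\<^sub>v k)" using comm z v by metis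
    also have "\<dots> = 0\<^sub>v n" using S by (auto intro: eq_vecI)
    finally have "z * (z * x) = 0" using \<kappa>_inj zA x(1) by blast
    then have "z * x = 0" using central_mult_cancel z central x(1) by blast
    then have "S *\<^sub>v v = \<kappa> (z * 0)" using x(2) by simp
    then have "S *\<^sub>v v = 0 \<cdot>\<^sub>v \<kappa> u" using \<kappa>_scale[of u u 0] one_closed by simp
    also have "\<dots> = 0\<^sub>v n" by (intro eq_vecI) (auto simp: \<kappa>_def)
    finally show ?thesis using S0 v(1) by blast
  qed
  from irreducible_rep_with_injective_element[OF \<pi>(1) one_closed \<pi>(2) z this]
  show False using kill by blast
qed

text \<open>Orthogonality forces the coefficients \<open>m \<chi>\<close>; what has to be shown is
  that the remainder \<open>s\<close> vanishes.\<close>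

lemma trace_functional_decomposition:
  assumes t: "functional_on A t" and tc: "\<And>x y. x \<in> A \<Longrightarrow> y \<in> A \<Longrightarrow> t (x * y) = t (y * x)"
  shows "\<exists>m. \<forall>x\<in>A. t x = (\<Sum>\<chi>\<in>Irr A u. m \<chi> * \<chi> x)"
proof -
  define m where "m \<chi> = (\<Sum>b\<in>B. t b * \<chi> (st b) / weight b) / Irr_norm \<chi>" for \<chi> :: "'a \<Rightarrow> complex"
  define s where "s x = t x - (\<Sum>\<chi>\<in>Irr A u. m \<chi> * \<chi> x)" for x
  have sf: "functional_on A s" unfolding s_def by (rule functional_on_diff_sum[OF t Irr_functional])
  have sc: "s (x * y) = s (y * x)" if "x \<in> A" "y \<in> A" for x y
    using tc Irr_mult_commute that by (simp add: s_def)
  have s_orth: "(\<Sum>b\<in>B. s b * \<psi> (st b) / weight b) = 0" if \<psi>: "\<psi> \<in> Irr A u" for \<psi>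
  proof -
    have "(\<Sum>b\<in>B. s b * \<psi> (st b) / weight b) = (\<Sum>b\<in>B. t b * \<psi> (st b) / weight b)
      - (\<Sum>b\<in>B. (\<Sum>\<chi>\<in>Irr A u. m \<chi> * \<chi> b) * \<psi> (st b) / weight b)"
      by (simp add: s_def left_diff_distrib diff_divide_distrib sum_subtractf)
    also have "\<dots> = 0"
      unfolding Irr_combination_inner[OF \<psi>] using Irr_norm_nonzero[OF \<psi>] by (simp add: m_def)
    finally show ?thesis .
  qed
  \<comment> \<open>The Riesz representative of \<open>s\<close> for the bilinear form
    \<open>\<tau> (x * y)\<close>, built from the dual basis.\<close>
  define z where "z = (\<Sum>b\<in>B. (s b / weight b) *\<^sub>C st b)"
  have z: "z \<in> A" unfolding z_def by (intro sum_closed scale_closed star_closed basis_closed)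
  have fz: "f z = (\<Sum>b\<in>B. s b / weight b * f (st b))" if "functional_on A f" for f
    unfolding z_def by (rule functional_on_sum[OF that subspace_carrier finite_basis])
      (intro star_closed basis_closed)
  have tz: "\<tau> (a * z) = s a" if a: "a \<in> A" for a
    using fz[OF functional_on_mult_left[OF trace_functional a]] functional_expansion[OF sf a]
    by (simp add: mult.commute)
  have central: "x * z = z * x" if x: "x \<in> A" for x
  proof -
    \<comment> \<open>The trace property of \<open>s\<close> makes the commutator \<open>d\<close>
      orthogonal to itself: the two terms of \<open>\<tau> (st d * d)\<close> are the values of
      \<open>s\<close> at the products of \<open>x\<close> and \<open>st d\<close> in either
      order.\<close>
    define d where "d = x * z - z * x"
    have xz: "x * z \<in> A" "z * x \<in> A" using x z mult_closed by auto
    have d: "d \<in> A" unfolding d_def by (rule diff_closed[OF xz])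
    have sd: "st d \<in> A" by (rule star_closed[OF d])
    have dz: "st d * x \<in> A" "x * st d \<in> A" using sd x mult_closed by auto
    have "\<tau> (d * st d) = \<tau> (st d * d)" by (rule trace_commute[OF d sd])
    also have "\<dots> = \<tau> (st d * (x * z)) - \<tau> (st d * (z * x))"
    proof -
      have "st d * d + st d * (z * x) = st d * (x * z)" by (simp add: d_def algebra_simps)
      moreover have "\<tau> (st d * d + st d * (z * x)) = \<tau> (st d * d) + \<tau> (st d * (z * x))"
        using trace_functional mult_closed sd d xz unfolding functional_on_def by blast
      ultimately show ?thesis by simp
    qed
    also have "\<tau> (st d * (x * z)) = s (st d * x)" using tz[OF dz(1)] by (simp add: mult.assoc)
    also have "\<tau> (st d * (z * x)) = \<tau> (x * (st d * z))"
      using trace_commute[of "st d * z" x] mult_closed sd z x by (simp add: mult.assoc)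
    also have "\<dots> = s (x * st d)" using tz[OF dz(2)] by (simp add: mult.assoc)
    also have "s (st d * x) - s (x * st d) = 0" using sc[OF sd x] by simp
    finally have "d = 0" using trace_definite[OF d] by simp
    then show ?thesis by (simp add: d_def)
  qed
  have "\<rho> z = 0\<^sub>m n n" if irr: "is_irreducible_rep A u n \<rho>" for n \<rho>
  proof -
    have rep: "is_representation A u n \<rho>" and n: "0 < n" using irr by (auto simp: is_irreducible_rep_def)
    obtain c where c: "\<rho> z = c \<cdot>\<^sub>m 1\<^sub>m n" using central_element_scalar[OF irr z central] by blast
    define \<chi> where "\<chi> = restrict (\<lambda>x. mat_trace (\<rho> x)) A"
    have \<chi>: "\<chi> \<in> Irr A u" unfolding Irr_def \<chi>_def using irr by blast
    \<comment> \<open>Evaluating \<open>\<chi>\<close> at \<open>z\<close> gives the inner product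
      of \<open>s\<close> with \<open>\<chi>\<close>, which is zero; it is also the trace of a
      scalar matrix, so the scalar is zero.\<close>
    have "\<chi> z = 0" using fz[OF Irr_functional[OF \<chi>]] s_orth[OF \<chi>] by simp
    moreover have "\<chi> z = of_nat n * c" using z c by (simp add: \<chi>_def mat_trace_def)
    ultimately have "c = 0" using n by simp
    then show ?thesis using c by (intro eq_matI) auto
  qed
  then have "z = 0" using central_element_eq_0[OF z central] by blast
  then have "s a = 0" if "a \<in> A" for a
    using tz[OF that] functional_on_sum[OF trace_functional subspace_carrier, of "{}"] by simp
  then show ?thesis by (intro exI[of _ m]) (simp add: s_def)
qed

end

subsection \<open>The trace of a C-algebra\<close>

context C_algebra
begin

abbreviation coord :: "'a \<Rightarrow> 'a \<Rightarrow> complex" where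
  "coord \<equiv> representation B"

abbreviation deg :: "'a \<Rightarrow> real" where
  "deg \<equiv> basis_degree u st B"

lemma carrier_subspace: "subspace A"
  using subspace_span[of B] by (simp add: span_basis)

lemma basis_in_carrier: "b \<in> B \<Longrightarrow> b \<in> A"
  using span_base[of b B] by (simp add: span_basis)

lemma star_in_basis: "b \<in> B \<Longrightarrow> st b \<in> B"
  using star_basis by blast

lemma star_star_basis: "b \<in> B \<Longrightarrow> st (st b) = b"
  by (rule star_star[OF basis_in_carrier])

lemma coord_add: "x \<in> A \<Longrightarrow> y \<in> A \<Longrightarrow> coord (x + y) b = coord x b + coord y b"
  using representation_add[OF independent_basis] by (simp add: span_basis)

lemma coord_scale: "x \<in> A \<Longrightarrow> coord (c *\<^sub>C x) b = c * coord x b"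
  using representation_scale[OF independent_basis] by (simp add: span_basis)

lemma coord_sum: "(\<And>i. i \<in> I \<Longrightarrow> g i \<in> A) \<Longrightarrow> coord (\<Sum>i\<in>I. g i) b = (\<Sum>i\<in>I. coord (g i) b)"
  using representation_sum[OF independent_basis, of I g] by (simp add: span_basis)

lemma coord_basis: "a \<in> B \<Longrightarrow> coord a b = (if a = b then 1 else 0)"
  using representation_basis[OF independent_basis, of a] by auto

lemma coord_functional: "functional_on A (\<lambda>x. coord x b)"
  by (simp add: functional_on_def coord_add coord_scale)

lemma coord_expansion: "x \<in> A \<Longrightarrow> (\<Sum>b\<in>B. coord x b *\<^sub>C b) = x"
  using sum_representation_eq[OF independent_basis _ finite_basis subset_refl] by (simp add: span_basis)

lemma functional_coord_expansion:
  assumes "functional_on A f" "x \<in> A"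
  shows "f x = (\<Sum>b\<in>B. coord x b * f b)"
  using functional_on_sum[where g = "\<lambda>b. b" and c = "coord x", OF assms(1) carrier_subspace finite_basis
      basis_in_carrier]
    coord_expansion[OF assms(2)] by simp

lemma star_linear_combination:
  assumes "finite I" "I \<subseteq> B"
  shows "st (\<Sum>b\<in>I. c b *\<^sub>C b) = (\<Sum>b\<in>I. cnj (c b) *\<^sub>C st b)"
  using assms
proof (induction I rule: finite_induct)
  case empty
  have "st (0 *\<^sub>C 0) = cnj 0 *\<^sub>C st 0" using star_scale[of 0 0] subspace_0[OF carrier_subspace] by blast
  then show ?case by simp
next
  case (insert b I)
  have "(\<Sum>b\<in>I. c b *\<^sub>C b) \<in> A"
    using insert.prems by (intro subspace_sum[OF carrier_subspace] subspace_scale[OF carrier_subspace] basis_in_carrier) auto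
  then show ?case
    using insert star_add[of "c b *\<^sub>C b" "\<Sum>b\<in>I. c b *\<^sub>C b"] star_scale[of b "c b"] basis_in_carrier[of b]
      subspace_scale[OF carrier_subspace] by simp
qed

lemma star_expansion:
  assumes "x \<in> A" shows "st x = (\<Sum>b\<in>B. cnj (coord x b) *\<^sub>C st b)"
  using star_linear_combination[OF finite_basis subset_refl, of "coord x"] coord_expansion[OF assms] by simp

lemma star_in_carrier: "x \<in> A \<Longrightarrow> st x \<in> A"
  by (subst star_expansion, assumption, rule subspace_sum[OF carrier_subspace],
      rule subspace_scale[OF carrier_subspace], rule basis_in_carrier, rule star_in_basis)

lemma star_unit: "st u = u"
proof -
  have u: "u \<in> A" by (rule basis_in_carrier[OF one_in_basis])
  then have su: "st u \<in> A" by (rule star_in_carrier)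
  have "st u = st u * st (st u)" using star_star[OF u] one_right[OF su] by simp
  also have "\<dots> = st (st u * u)" using star_mult[OF su u] by simp
  also have "\<dots> = u" using one_right[OF su] star_star[OF u] by simp
  finally show ?thesis .
qed

lemma coord_star:
  assumes x: "x \<in> A" and b: "b \<in> B"
  shows "coord (st x) (st b) = cnj (coord x b)"
proof -
  have "coord (st x) (st b) = (\<Sum>a\<in>B. cnj (coord x a) * coord (st a) (st b))"
    by (subst star_expansion[OF x], rule functional_on_sum[OF coord_functional carrier_subspace finite_basis])
      (intro basis_in_carrier star_in_basis)
  also have "\<dots> = (\<Sum>a\<in>B. if a = b then cnj (coord x b) else 0)"
  proof (rule sum.cong)
    fix a assume a: "a \<in> B"
    have "st a = st b \<longleftrightarrow> a = b" using star_star_basis[OF a] star_star_basis[OF b] by metis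
    then show "cnj (coord x a) * coord (st a) (st b) = (if a = b then cnj (coord x b) else 0)"
      using coord_basis[OF star_in_basis[OF a]] by simp
  qed simp
  finally show ?thesis using b finite_basis by simp
qed

lemma degree_map_basis: "b \<in> B \<Longrightarrow> degree_map u st B b = complex_of_real (deg b)"
  using finite_basis by (simp add: degree_map_def coord_basis if_distrib[of "\<lambda>x. x * _"] cong: if_cong)

lemma deg_star: "b \<in> B \<Longrightarrow> deg (st b) = deg b"
  using degree_star[OF basis_in_carrier, of b] degree_map_basis[of b] degree_map_basis[OF star_in_basis, of b]
  by simp

lemma coord_unit_mult:
  assumes "a \<in> B" "b \<in> B"
  shows "coord (a * b) u = (if a = st b then complex_of_real (deg a) else 0)"
  using structure_const_one[OF assms] by (simp add: structure_const_def)

lemma coord_unit_mult_expansion: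
  assumes "x \<in> A" "y \<in> A"
  shows "coord (x * y) u = (\<Sum>a\<in>B. \<Sum>b\<in>B. coord x a * coord y b * coord (a * b) u)"
proof -
  have f: "functional_on A (\<lambda>x. coord (x * y) u)"
    using assms(2) mult_closed by (simp add: functional_on_def distrib_right scale_mult_left coord_add coord_scale)
  have g: "functional_on A (\<lambda>y. coord (a * y) u)" if "a \<in> B" for a
    using basis_in_carrier[OF that] mult_closed
    by (simp add: functional_on_def distrib_left scale_mult_right coord_add coord_scale)
  have "coord (x * y) u = (\<Sum>a\<in>B. coord x a * coord (a * y) u)"
    by (rule functional_coord_expansion[OF f assms(1)])
  also have "\<dots> = (\<Sum>a\<in>B. coord x a * (\<Sum>b\<in>B. coord y b * coord (a * b) u))"
    using functional_coord_expansion[OF g assms(2)] by (intro sum.cong refl arg_cong2[where f = times])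
  finally show ?thesis by (simp add: sum_distrib_left mult.assoc)
qed

text \<open>By axiom (III) both coefficients vanish unless \<open>a = st b\<close>, and then they
  are the degrees of \<open>st b\<close> and \<open>b\<close>, which agree because the degree map
  respects the involution and is real on \<open>B\<close>.\<close>

lemma coord_unit_commute:
  assumes "x \<in> A" "y \<in> A"
  shows "coord (x * y) u = coord (y * x) u"
proof -
  have "coord (a * b) u = coord (b * a) u" if ab: "a \<in> B" "b \<in> B" for a b
  proof -
    have "a = st b \<longleftrightarrow> b = st a" using star_star_basis ab by metis
    then show ?thesis using coord_unit_mult ab deg_star by auto
  qed
  then have "(\<Sum>a\<in>B. \<Sum>b\<in>B. coord x a * coord y b * coord (a * b) u)
    = (\<Sum>b\<in>B. \<Sum>a\<in>B. coord y b * coord x a * coord (b * a) u)"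
    by (subst sum.swap) (intro sum.cong refl, simp add: mult.commute)
  then show ?thesis using coord_unit_mult_expansion assms by simp
qed

text \<open>Axiom (III) with \<open>st b\<close> as second factor is the orthogonality of
  \<open>B\<close>, and the squared norm of \<open>b\<close> is its degree.\<close>

sublocale trace: tracial_star_algebra scale A u st B "\<lambda>x. coord x u"
proof
  show "finite B" by (rule finite_basis)
  show "span B = A" by (rule span_basis)
  show "x * y \<in> A" if "x \<in> A" "y \<in> A" for x y using that by (rule mult_closed)
  show "u \<in> A" by (rule basis_in_carrier[OF one_in_basis])
  show "u * x = x" "x * u = x" "st x \<in> A" "st (st x) = x" if "x \<in> A" for x
    using that one_left one_right star_in_carrier star_star by auto
  show "st (x + y) = st x + st y" "st (x * y) = st y * st x" if "x \<in> A" "y \<in> A" for x y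
    using that star_add star_mult by auto
  show "st (k *\<^sub>C x) = cnj k *\<^sub>C st x" if "x \<in> A" for k x using that by (rule star_scale)
  show "functional_on A (\<lambda>x. coord x u)" by (rule coord_functional)
  show "coord (x * y) u = coord (y * x) u" if "x \<in> A" "y \<in> A" for x y
    using that by (rule coord_unit_commute)
  show "coord (st x) u = cnj (coord x u)" if "x \<in> A" for x
    using coord_star[OF that one_in_basis] star_unit by simp
  show "coord (a * st b) u = 0" if "a \<in> B" "b \<in> B" "a \<noteq> b" for a b
    using coord_unit_mult[OF that(1) star_in_basis[OF that(2)]] star_star_basis that by simp
  show "0 < Re (coord (b * st b) u)" if "b \<in> B" for b
    using coord_unit_mult[OF that star_in_basis[OF that]] star_star_basis that degree_pos by simp
qed

lemma weight_eq_deg: "b \<in> B \<Longrightarrow> trace.weight b = complex_of_real (deg b)"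
  using coord_unit_mult[OF _ star_in_basis, of b b] star_star_basis by (simp add: trace.weight_def)

lemma coord_eq_trace: "x \<in> A \<Longrightarrow> b \<in> B \<Longrightarrow> coord x b = coord (x * st b) u / complex_of_real (deg b)"
  using trace.representation_eq_trace weight_eq_deg by simp

text \<open>Both sides are the coefficient of \<open>u\<close> in \<open>a * b * st c\<close>, read
  cyclically: the rotation symmetry of structure constants weighted by degrees.\<close>

lemma coord_reciprocity:
  assumes a: "a \<in> A" and b: "b \<in> B" and c: "c \<in> B"
  shows "coord (a * b) c * complex_of_real (deg c) = coord (st c * a) (st b) * complex_of_real (deg b)"
proof -
  have A: "b \<in> A" "st c \<in> A" "a * b \<in> A" "st c * a \<in> A"
    using assms basis_in_carrier star_in_carrier mult_closed by auto
  have "coord (a * b) c * complex_of_real (deg c) = coord (a * b * st c) u"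
    using coord_eq_trace[OF A(3) c] degree_pos[OF c] by simp
  also have "\<dots> = coord (st c * a * b) u"
    using coord_unit_commute[OF A(3,2)] by (simp add: mult.assoc)
  also have "\<dots> = coord (st c * a) (st b) * complex_of_real (deg b)"
    using coord_eq_trace[OF A(4) star_in_basis[OF b]] star_star_basis[OF b] deg_star[OF b] degree_pos[OF b]
    by simp
  finally show ?thesis .
qed

lemma basis_eqI:
  assumes "x \<in> A" "y \<in> A" "\<And>b. b \<in> B \<Longrightarrow> coord x b = coord y b"
  shows "x = y"
proof -
  have "(\<Sum>b\<in>B. coord x b *\<^sub>C b) = (\<Sum>b\<in>B. coord y b *\<^sub>C b)" using assms(3) by (intro sum.cong) auto
  then show ?thesis using coord_expansion assms(1,2) by simp
qed

lemma sum_in_carrier: "S \<subseteq> B \<Longrightarrow> (\<Sum>b\<in>S. b) \<in> A"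
  by (intro subspace_sum[OF carrier_subspace] basis_in_carrier) auto

lemma coord_sum_subset:
  assumes "S \<subseteq> B" shows "coord (\<Sum>b\<in>S. b) c = (if c \<in> S then 1 else 0)"
proof -
  have S: "finite S" using assms finite_basis finite_subset by blast
  have "coord (\<Sum>b\<in>S. b) c = (\<Sum>b\<in>S. coord b c)" using assms by (intro coord_sum basis_in_carrier) auto
  also have "\<dots> = (\<Sum>b\<in>S. if b = c then 1 else 0)" using assms by (intro sum.cong) (auto simp: coord_basis)
  finally show ?thesis using S by simp
qed

text \<open>Reciprocity turns the coefficient at \<open>c \<in> S\<close> into the degree of
  \<open>st c * a\<close> divided by that of \<open>c\<close>, and multiplicativity of the degree
  map leaves the degree of \<open>a\<close>. It is applied both to \<open>C\<close> and to the whole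
  of \<open>B\<close>.\<close>

lemma closed_sum_mult:
  assumes S: "S \<subseteq> B" and star: "\<And>s. s \<in> S \<Longrightarrow> st s \<in> S"
    and closed: "\<And>s t c. \<lbrakk>s \<in> S; t \<in> S; c \<in> B; coord (s * t) c \<noteq> 0\<rbrakk> \<Longrightarrow> c \<in> S" and a: "a \<in> S"
  shows "a * (\<Sum>s\<in>S. s) = complex_of_real (deg a) *\<^sub>C (\<Sum>s\<in>S. s)"
proof (rule basis_eqI)
  have aA: "a \<in> A" using a S basis_in_carrier by auto
  have SA: "(\<Sum>s\<in>S. s) \<in> A" by (rule sum_in_carrier[OF S])
  show "a * (\<Sum>s\<in>S. s) \<in> A" by (rule mult_closed[OF aA SA])
  show "complex_of_real (deg a) *\<^sub>C (\<Sum>s\<in>S. s) \<in> A" by (rule subspace_scale[OF carrier_subspace SA])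
  fix c assume c: "c \<in> B"
  have sA: "s \<in> A" "s \<in> B" if "s \<in> S" for s using S that basis_in_carrier by auto
  have e: "coord (a * (\<Sum>s\<in>S. s)) c = (\<Sum>s\<in>S. coord (a * s) c)"
    unfolding sum_distrib_left by (intro coord_sum mult_closed aA sA)
  show "coord (a * (\<Sum>s\<in>S. s)) c = coord (complex_of_real (deg a) *\<^sub>C (\<Sum>s\<in>S. s)) c"
  proof (cases "c \<in> S")
    case False
    then have "coord (a * s) c = 0" if "s \<in> S" for s using closed[OF a that c] by blast
    then show ?thesis using e coord_scale[OF SA] coord_sum_subset[OF S] False by simp
  next
    case True
    have caA: "st c * a \<in> A" using mult_closed star_in_carrier sA True aA by blast
    have bij: "bij_betw st S S"
      by (rule bij_betw_byWitness[where f' = st]) (use star sA star_star_basis in auto)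
    have "coord (a * (\<Sum>s\<in>S. s)) c * complex_of_real (deg c)
      = (\<Sum>s\<in>S. coord (st c * a) (st s) * complex_of_real (deg (st s)))"
      unfolding e sum_distrib_right
      by (intro sum.cong refl) (simp add: coord_reciprocity[OF aA sA(2) c] deg_star sA(2))
    also have "\<dots> = (\<Sum>s\<in>S. coord (st c * a) s * complex_of_real (deg s))"
      by (rule sum.reindex_bij_betw[OF bij])
    also have "\<dots> = degree_map u st B (st c * a)"
      unfolding degree_map_def
    proof (rule sum.mono_neutral_left[OF finite_basis S], intro ballI)
      fix b assume "b \<in> B - S"
      then show "coord (st c * a) b * complex_of_real (deg b) = 0" using closed[OF star[OF True] a, of b] by auto
    qed
    also have "\<dots> = complex_of_real (deg c) * complex_of_real (deg a)"
      using degree_mult[OF star_in_carrier[OF sA(1)[OF True]] aA] degree_map_basis[OF sA(2)[OF a]]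
        degree_map_basis[OF star_in_basis[OF c]] deg_star[OF c] by simp
    finally show ?thesis
      using degree_pos[OF c] coord_scale[OF SA] coord_sum_subset[OF S] True by simp
  qed
qed

end

context table_algebra
begin

text \<open>The order on complex numbers includes being real, so the criterion for the vanishing of
  nonnegative sums applies to complex coefficients as they stand.\<close>

lemma coord_mult_nonneg: "a \<in> B \<Longrightarrow> b \<in> B \<Longrightarrow> c \<in> B \<Longrightarrow> 0 \<le> coord (a * b) c"
  using structure_const_nonneg structure_const_real
  by (auto simp: structure_const_def less_eq_complex_def complex_is_Real_iff)

lemma coord_mult_expansion:
  assumes "x \<in> A" "y \<in> A"
  shows "coord (x * y) c = (\<Sum>a\<in>B. coord x a * coord (a * y) c)"
    and "coord (x * y) c = (\<Sum>b\<in>B. coord y b * coord (x * b) c)"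
  using functional_coord_expansion[OF trace.functional_on_mult_right[OF coord_functional assms(2)] assms(1)]
    functional_coord_expansion[OF trace.functional_on_mult_left[OF coord_functional assms(1)] assms(2)] by auto

end

subsection \<open>Double cosets of a closed subset\<close>

locale table_algebra_closed_subset = table_algebra scale A u st B
  for scale :: "complex \<Rightarrow> 'a::ring \<Rightarrow> 'a"  (infixr \<open>*\<^sub>C\<close> 75)
    and A :: "'a set" and u :: 'a and st :: "'a \<Rightarrow> 'a" and B :: "'a set" +
  fixes C :: "'a set"
  assumes closed_subset: "closed_subset st B C"
begin

lemma subset_basis: "C \<subseteq> B" and nonempty: "C \<noteq> {}"
  using closed_subset by (auto simp: closed_subset_def)

lemma star_mult_closed:
  "a \<in> C \<Longrightarrow> b \<in> C \<Longrightarrow> c \<in> B \<Longrightarrow> coord (st a * b) c \<noteq> 0 \<Longrightarrow> c \<in> C"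
  using closed_subset unfolding closed_subset_def set_prod_def structure_const_def by blast

text \<open>By axiom (III) the product \<open>st c * c\<close> contains \<open>u\<close> with the
  positive coefficient \<open>deg (st c)\<close>.\<close>

lemma unit_in_subset: "u \<in> C"
proof -
  obtain c where c: "c \<in> C" using nonempty by blast
  then have cB: "c \<in> B" using subset_basis by blast
  have "coord (st c * c) u = complex_of_real (deg (st c))"
    using coord_unit_mult[OF star_in_basis[OF cB] cB] by simp
  then have "coord (st c * c) u \<noteq> 0" using degree_pos[OF star_in_basis[OF cB]] by simp
  then show ?thesis using star_mult_closed[OF c c one_in_basis] by blast
qed

lemma subset_star_closed: "c \<in> C \<Longrightarrow> st c \<in> C"
proof -
  assume c: "c \<in> C"
  then have "st c \<in> B" using subset_basis star_in_basis by blast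
  moreover then have "st c * u = st c" by (intro one_right basis_in_carrier)
  ultimately show ?thesis
    using star_mult_closed[OF c unit_in_subset, of "st c"] by (simp add: coord_basis)
qed

lemma subset_mult_closed: "a \<in> C \<Longrightarrow> b \<in> C \<Longrightarrow> c \<in> B \<Longrightarrow> coord (a * b) c \<noteq> 0 \<Longrightarrow> c \<in> C"
  using star_mult_closed[OF subset_star_closed, of a b c] star_star_basis subset_basis by auto

lemma finite_subset_C: "finite C"
  using subset_basis finite_basis finite_subset by blast

definition total :: complex where
  "total = complex_of_real (set_degree u st B C)"

definition e :: 'a where
  "e = inverse total *\<^sub>C (\<Sum>c\<in>C. c)"

lemma total_eq: "total = (\<Sum>c\<in>C. complex_of_real (deg c))"
  by (simp add: total_def set_degree_def)

lemma total_pos: "0 < total"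
proof -
  have "0 < set_degree u st B C"
    unfolding set_degree_def using degree_pos subset_basis nonempty finite_subset_C by (intro sum_pos) auto
  then show ?thesis by (simp add: total_def less_complex_def)
qed

lemma total_nonzero: "total \<noteq> 0"
  using total_pos by simp

lemma sum_C_mult: "c \<in> C \<Longrightarrow> c * (\<Sum>c\<in>C. c) = complex_of_real (deg c) *\<^sub>C (\<Sum>c\<in>C. c)"
  by (rule closed_sum_mult[OF subset_basis subset_star_closed subset_mult_closed])

lemma sum_B_mult: "b \<in> B \<Longrightarrow> b * (\<Sum>b\<in>B. b) = complex_of_real (deg b) *\<^sub>C (\<Sum>b\<in>B. b)"
  by (rule closed_sum_mult[OF subset_refl star_in_basis])

lemma e_carrier: "e \<in> A"
  unfolding e_def by (intro subspace_scale[OF carrier_subspace] sum_in_carrier subset_basis)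

text \<open>On a common eigenvector of \<open>C\<close> for the degrees, \<open>e\<close> acts by
  \<open>(\<Sum>c\<in>C. deg c) / total = 1\<close>. Both \<open>C^+\<close> and \<open>B^+\<close>
  are of this kind.\<close>

lemma e_mult_eq_if_degree_eigenvector:
  assumes "\<And>c. c \<in> C \<Longrightarrow> c * x = complex_of_real (deg c) *\<^sub>C x"
  shows "e * x = x"
proof -
  have "e * x = inverse total *\<^sub>C (\<Sum>c\<in>C. c * x)"
    by (simp add: e_def scale_mult_left sum_distrib_right)
  also have "(\<Sum>c\<in>C. c * x) = (\<Sum>c\<in>C. complex_of_real (deg c) *\<^sub>C x)" using assms by simp
  also have "\<dots> = total *\<^sub>C x" by (simp add: total_eq scale_sum_left)
  finally show ?thesis using total_nonzero by simp
qed

lemma e_sum_C: "e * (\<Sum>c\<in>C. c) = (\<Sum>c\<in>C. c)"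
  by (rule e_mult_eq_if_degree_eigenvector[OF sum_C_mult])

lemma e_idem: "e * e = e"
proof -
  have "e * e = inverse total *\<^sub>C (e * (\<Sum>c\<in>C. c))"
    by (simp add: e_def scale_mult_right)
  then show ?thesis by (simp add: e_sum_C) (simp add: e_def)
qed

lemma star_sum_subset:
  assumes "S \<subseteq> B" "st ` S = S" shows "st (\<Sum>s\<in>S. s) = (\<Sum>s\<in>S. s)"
proof -
  have inj: "inj_on st S" using assms star_star_basis by (metis inj_onI subsetD)
  have "st (\<Sum>s\<in>S. s) = st (\<Sum>s\<in>S. 1 *\<^sub>C s)" by simp
  also have "\<dots> = (\<Sum>s\<in>S. st s)"
    using star_linear_combination[of S "\<lambda>_. 1"] assms(1) finite_basis finite_subset by auto
  also have "\<dots> = (\<Sum>s\<in>st ` S. s)" by (simp add: sum.reindex[OF inj])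
  finally show ?thesis by (simp add: assms(2))
qed

lemma star_image_C: "st ` C = C"
proof
  show "st ` C \<subseteq> C" using subset_star_closed by auto
  show "C \<subseteq> st ` C"
  proof
    fix c assume c: "c \<in> C"
    then have "c = st (st c)" using star_star_basis subset_basis by auto
    then show "c \<in> st ` C" using subset_star_closed[OF c] by blast
  qed
qed

lemma star_e: "st e = e"
  using star_scale[OF sum_in_carrier[OF subset_basis]] star_sum_subset[OF subset_basis star_image_C]
  by (simp add: e_def total_def)

lemma e_sum_B: "e * (\<Sum>b\<in>B. b) = (\<Sum>b\<in>B. b)"
  using subset_basis by (intro e_mult_eq_if_degree_eigenvector sum_B_mult) auto

lemma sum_B_e: "(\<Sum>b\<in>B. b) * e = (\<Sum>b\<in>B. b)"
proof -
  have "st (e * (\<Sum>b\<in>B. b)) = st (\<Sum>b\<in>B. b)" by (simp add: e_sum_B)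
  then show ?thesis
    using star_mult[OF e_carrier sum_in_carrier[OF subset_refl]] star_sum_subset[OF subset_refl star_basis] star_e
    by simp
qed

section \<open>The averaging operator in basis coordinates\<close>

lemma corner_carrier: "x \<in> A \<Longrightarrow> e * x * e \<in> A"
  using mult_closed e_carrier by simp

text \<open>The matrix of \<open>x -> e * x * e\<close>. It behaves like an idempotent stochastic
  matrix, normalised over its first argument and reversible with respect to the degrees; the double
  cosets are its classes of communicating states.\<close>

definition corner_coord :: "'a \<Rightarrow> 'a \<Rightarrow> complex" where
  "corner_coord z x = coord (e * z * e) x"

lemma corner_coord_expansion:
  assumes z: "z \<in> B"
  shows "corner_coord z x = inverse (total * total) *
    (\<Sum>c\<in>C. \<Sum>d\<in>C. \<Sum>w\<in>B. coord (c * z) w * coord (w * d) x)"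
proof -
  have A: "c \<in> A" if "c \<in> C" for c using that subset_basis basis_in_carrier by auto
  have zA: "z \<in> A" by (rule basis_in_carrier[OF z])
  have "(\<Sum>c\<in>C. c) * z * (\<Sum>c\<in>C. c) = (\<Sum>c\<in>C. \<Sum>d\<in>C. c * z * d)"
    by (simp only: sum_distrib_right[of "\<lambda>c. c" C z] sum_product)
  then have "e * z * e = inverse (total * total) *\<^sub>C (\<Sum>c\<in>C. \<Sum>d\<in>C. c * z * d)"
    by (simp add: e_def scale_mult_left scale_mult_right)
  then have "corner_coord z x = inverse (total * total) * (\<Sum>c\<in>C. \<Sum>d\<in>C. coord (c * z * d) x)"
    using A zA mult_closed
    by (simp add: corner_coord_def coord_scale coord_sum subspace_sum[OF carrier_subspace])
  also have "(\<Sum>c\<in>C. \<Sum>d\<in>C. coord (c * z * d) x)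
    = (\<Sum>c\<in>C. \<Sum>d\<in>C. \<Sum>w\<in>B. coord (c * z) w * coord (w * d) x)"
    using A zA mult_closed by (intro sum.cong refl coord_mult_expansion(1)) auto
  finally show ?thesis .
qed

lemma corner_coord_nonneg:
  assumes "z \<in> B" "x \<in> B" shows "0 \<le> corner_coord z x"
proof -
  have "0 \<le> inverse (total * total)" using total_pos by (simp add: total_def less_eq_complex_def less_complex_def)
  then show ?thesis
    unfolding corner_coord_expansion[OF assms(1)] using assms subset_basis
    by (intro mult_nonneg_nonneg sum_nonneg coord_mult_nonneg) auto
qed

text \<open>Nonnegativity excludes cancellation: the sum for \<open>corner_coord z x\<close>
  vanishes only if each of its terms does, and a nonzero term is exactly a witness for membership of
  \<open>x\<close> in \<open>C z C\<close>.\<close>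

lemma double_coset_iff:
  assumes z: "z \<in> B"
  shows "x \<in> double_coset B C z \<longleftrightarrow> x \<in> B \<and> corner_coord z x \<noteq> 0"
proof (cases "x \<in> B")
  case True
  have nn: "0 \<le> coord (c * z) w * coord (w * d) x" if "c \<in> C" "d \<in> C" "w \<in> B" for c d w
    using that z True subset_basis by (intro mult_nonneg_nonneg coord_mult_nonneg) auto
  have "corner_coord z x = 0 \<longleftrightarrow> (\<Sum>c\<in>C. \<Sum>d\<in>C. \<Sum>w\<in>B. coord (c * z) w * coord (w * d) x) = 0"
    using corner_coord_expansion[OF z] total_nonzero by simp
  also have "\<dots> \<longleftrightarrow> (\<forall>c\<in>C. (\<Sum>d\<in>C. \<Sum>w\<in>B. coord (c * z) w * coord (w * d) x) = 0)"
    by (rule sum_nonneg_eq_0_iff[OF finite_subset_C]) (intro sum_nonneg nn)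
  also have "\<dots> \<longleftrightarrow> (\<forall>c\<in>C. \<forall>d\<in>C. (\<Sum>w\<in>B. coord (c * z) w * coord (w * d) x) = 0)"
    by (intro ball_cong refl sum_nonneg_eq_0_iff[OF finite_subset_C] sum_nonneg nn)
  also have "\<dots> \<longleftrightarrow> (\<forall>c\<in>C. \<forall>d\<in>C. \<forall>w\<in>B. coord (c * z) w * coord (w * d) x = 0)"
    by (intro ball_cong refl sum_nonneg_eq_0_iff[OF finite_basis] nn)
  finally show ?thesis using True
    by (auto simp: double_coset_def set_prod_def structure_const_def)
qed (simp add: double_coset_def set_prod_def)

text \<open>Self-adjointness of \<open>e\<close> and cyclicity of the trace make
  \<open>x -> e * x * e\<close> Hermitian for the form. Symmetry of the double coset relation comes
  from here.\<close>

lemma corner_coord_symmetric: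
  assumes z: "z \<in> B" and x: "x \<in> B"
  shows "corner_coord z x * complex_of_real (deg x) = cnj (corner_coord x z * complex_of_real (deg z))"
proof -
  have A: "z \<in> A" "x \<in> A" "st x \<in> A" "st z \<in> A" "e \<in> A" using z x basis_in_carrier star_in_carrier e_carrier by auto
  have "corner_coord z x * complex_of_real (deg x) = coord (e * z * e * st x) u"
    using coord_eq_trace[OF corner_carrier[OF A(1)] x] degree_pos[OF x] by (simp add: corner_coord_def)
  also have "\<dots> = coord (z * (e * st x * e)) u"
    using coord_unit_commute[OF A(5), of "z * e * st x"] mult_closed A by (simp add: mult.assoc)
  also have "z * (e * st x * e) = st (e * x * e * st z)"
    using A mult_closed by (simp add: star_mult star_e star_star mult.assoc)
  also have "coord \<dots> u = cnj (coord (e * x * e * st z) u)"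
    using trace.trace_star mult_closed A by simp
  also have "coord (e * x * e * st z) u = corner_coord x z * complex_of_real (deg z)"
    using coord_eq_trace[OF corner_carrier[OF A(2)] z] degree_pos[OF z] by (simp add: corner_coord_def)
  finally show ?thesis .
qed

lemma double_coset_subset: "double_coset B C z \<subseteq> B"
  by (auto simp: double_coset_def set_prod_def)

lemma double_coset_sym:
  assumes "z \<in> B" "x \<in> double_coset B C z" shows "z \<in> double_coset B C x"
proof -
  have x: "x \<in> B" "corner_coord z x \<noteq> 0" using assms double_coset_iff by auto
  then have "corner_coord x z \<noteq> 0"
    using corner_coord_symmetric[OF assms(1) x(1)] degree_pos[OF x(1)] by auto
  then show ?thesis using double_coset_iff[OF x(1)] assms(1) by simp
qed

lemma double_coset_self:
  assumes z: "z \<in> B" shows "z \<in> double_coset B C z"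
proof -
  have zA: "z \<in> A" by (rule basis_in_carrier[OF z])
  have "coord (u * z) z \<noteq> 0" "coord (z * u) z \<noteq> 0"
    using one_left[OF zA] one_right[OF zA] z by (simp_all add: coord_basis)
  then show ?thesis
    using z unit_in_subset unfolding double_coset_def set_prod_def structure_const_def by blast
qed

lemma corner_coord_compose:
  assumes z: "z \<in> B"
  shows "corner_coord z y = (\<Sum>x\<in>B. corner_coord z x * corner_coord x y)"
proof -
  have eze: "e * z * e \<in> A" by (rule corner_carrier[OF basis_in_carrier[OF z]])
  have f: "functional_on A (\<lambda>x. coord (e * x * e) y)"
    by (rule trace.functional_on_mult_left[OF trace.functional_on_mult_right[OF coord_functional e_carrier] e_carrier])
  have "e * (e * z * e) * e = (e * e) * z * (e * e)" by (simp only: mult.assoc)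
  then have "e * (e * z * e) * e = e * z * e" by (simp only: e_idem)
  then have "corner_coord z y = coord (e * (e * z * e) * e) y" by (simp add: corner_coord_def)
  also have "\<dots> = (\<Sum>x\<in>B. coord (e * z * e) x * coord (e * x * e) y)"
    by (rule functional_coord_expansion[OF f eze])
  finally show ?thesis by (simp add: corner_coord_def)
qed

text \<open>\<open>corner_coord\<close> composes to itself since \<open>e\<close> is idempotent;
  with nonnegative entries a single intermediate \<open>x\<close> makes the composite entry
  nonzero.\<close>

lemma double_coset_trans:
  assumes z: "z \<in> B" and x: "x \<in> double_coset B C z" and y: "y \<in> double_coset B C x"
  shows "y \<in> double_coset B C z"
proof -
  have x': "x \<in> B" "corner_coord z x \<noteq> 0" using x double_coset_iff[OF z] by auto
  have y': "y \<in> B" "corner_coord x y \<noteq> 0" using y double_coset_iff[OF x'(1)] by auto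
  have "corner_coord z y \<noteq> 0"
  proof
    assume 0: "corner_coord z y = 0"
    have "0 \<le> corner_coord z x * corner_coord x y" if "x \<in> B" for x
      using corner_coord_nonneg[OF z that] corner_coord_nonneg[OF that y'(1)] by (rule mult_nonneg_nonneg)
    then have "(\<Sum>x\<in>B. corner_coord z x * corner_coord x y) = 0
      \<longleftrightarrow> (\<forall>x\<in>B. corner_coord z x * corner_coord x y = 0)"
      by (rule sum_nonneg_eq_0_iff[OF finite_basis])
    then have "\<forall>x\<in>B. corner_coord z x * corner_coord x y = 0"
      unfolding corner_coord_compose[OF z, symmetric] using 0 by simp
    then have "corner_coord z x * corner_coord x y = 0" using x'(1) by blast
    then show False using x'(2) y'(2) by simp
  qed
  then show ?thesis using double_coset_iff[OF z] y'(1) by simp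
qed

lemma double_coset_eq:
  assumes z: "z \<in> B" and x: "x \<in> double_coset B C z"
  shows "double_coset B C x = double_coset B C z"
proof -
  have xB: "x \<in> B" using x double_coset_subset by auto
  show ?thesis using double_coset_trans[OF z x] double_coset_trans[OF xB double_coset_sym[OF z x]] by blast
qed

lemma double_coset_disjoint:
  assumes "z \<in> B" "y \<in> B" "double_coset B C z \<noteq> double_coset B C y"
  shows "double_coset B C z \<inter> double_coset B C y = {}"
  using assms double_coset_eq by blast

lemma double_coset_unit: "double_coset B C u = C"
proof -
  have uA: "u \<in> A" by (rule basis_in_carrier[OF one_in_basis])
  have "e * u * e = e" using one_right[OF e_carrier] e_idem by simp
  then have "corner_coord u x = inverse total * (if x \<in> C then 1 else 0)" for x
    unfolding corner_coord_def e_def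
    using coord_scale[OF sum_in_carrier[OF subset_basis]] coord_sum_subset[OF subset_basis] by simp
  then show ?thesis using double_coset_iff[OF one_in_basis] total_nonzero subset_basis by (auto split: if_splits)
qed

text \<open>The normalisation comes from \<open>e * B^+ * e = B^+\<close>, which rests on the degree
  eigenvector \<open>B^+\<close>.\<close>

lemma corner_coord_row_sum:
  assumes x: "x \<in> B" shows "(\<Sum>z\<in>B. corner_coord z x) = 1"
proof -
  have "(\<Sum>z\<in>B. corner_coord z x) = coord (\<Sum>z\<in>B. e * z * e) x"
    unfolding corner_coord_def by (rule coord_sum[symmetric]) (intro corner_carrier basis_in_carrier)
  also have "(\<Sum>z\<in>B. e * z * e) = e * (\<Sum>z\<in>B. z) * e" by (simp add: sum_distrib_left sum_distrib_right)
  also have "\<dots> = (\<Sum>z\<in>B. z)" by (simp add: e_sum_B sum_B_e)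
  finally show ?thesis using coord_sum_subset[OF subset_refl] x by simp
qed

lemma corner_coord_row_sum_double_coset:
  assumes z: "z \<in> B" and x: "x \<in> double_coset B C z"
  shows "(\<Sum>y\<in>double_coset B C z. corner_coord y x) = 1"
proof -
  have xB: "x \<in> B" using x double_coset_subset by auto
  have "(\<Sum>y\<in>double_coset B C z. corner_coord y x) = (\<Sum>y\<in>B. corner_coord y x)"
  proof (rule sum.mono_neutral_left[OF finite_basis double_coset_subset], intro ballI)
    fix y assume y: "y \<in> B - double_coset B C z"
    show "corner_coord y x = 0"
    proof (rule ccontr)
      assume "corner_coord y x \<noteq> 0"
      then have "x \<in> double_coset B C y" using double_coset_iff y xB by simp
      then have "double_coset B C y = double_coset B C z" using double_coset_eq z x y by blast
      then show False using double_coset_self y by blast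
    qed
  qed
  then show ?thesis using corner_coord_row_sum[OF xB] by simp
qed

text \<open>Entries between different double cosets are zero, so the normalisation holds blockwise
  and each coset sum is fixed, just as \<open>B^+\<close> is.\<close>

lemma corner_sum_double_coset:
  assumes z: "z \<in> B"
  shows "e * (\<Sum>x\<in>double_coset B C z. x) * e = (\<Sum>x\<in>double_coset B C z. x)"
proof (rule basis_eqI)
  let ?D = "double_coset B C z"
  have DA: "(\<Sum>x\<in>?D. x) \<in> A" by (rule sum_in_carrier[OF double_coset_subset])
  then show "(\<Sum>x\<in>?D. x) \<in> A" "e * (\<Sum>x\<in>?D. x) * e \<in> A" using corner_carrier by auto
  fix x assume x: "x \<in> B"
  have "e * (\<Sum>y\<in>?D. y) * e = (\<Sum>y\<in>?D. e * y * e)" by (simp add: sum_distrib_left sum_distrib_right)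
  moreover have "coord (\<Sum>y\<in>?D. e * y * e) x = (\<Sum>y\<in>?D. corner_coord y x)"
    unfolding corner_coord_def
    by (rule coord_sum, rule corner_carrier, rule basis_in_carrier, erule subsetD[OF double_coset_subset])
  ultimately have s: "coord (e * (\<Sum>y\<in>?D. y) * e) x = (\<Sum>y\<in>?D. corner_coord y x)" by simp
  show "coord (e * (\<Sum>y\<in>?D. y) * e) x = coord (\<Sum>y\<in>?D. y) x"
  proof (cases "x \<in> ?D")
    case True
    then show ?thesis using s corner_coord_row_sum_double_coset[OF z] coord_sum_subset[OF double_coset_subset] by simp
  next
    case False
    have "corner_coord y x = 0" if y: "y \<in> ?D" for y
    proof (rule ccontr)
      assume "corner_coord y x \<noteq> 0"
      then have "x \<in> double_coset B C y" using double_coset_iff y x double_coset_subset by blast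
      then show False using double_coset_eq[OF z y] False by simp
    qed
    then show ?thesis using s False coord_sum_subset[OF double_coset_subset] by simp
  qed
qed

text \<open>
  A maximum principle: since \<open>e * z * e\<close> is fixed by the averaging operator \<open>x \<mapsto> e * x * e\<close>, whose rows are
  positive exactly on double cosets and sum to \<open>1\<close>, its coordinates are constant on double cosets.
\<close>

lemma corner_basis:
  assumes z: "z \<in> B"
  shows "\<exists>M. e * z * e = M *\<^sub>C (\<Sum>x\<in>double_coset B C z. x)"
proof -
  let ?D = "double_coset B C z"
  have fin: "finite ?D" using double_coset_subset finite_basis finite_subset by blast
  have ne: "?D \<noteq> {}" using double_coset_self[OF z] by blast
  define r where "r x = Re (corner_coord z x)" for x
  have real: "Im (corner_coord y x) = 0" if "y \<in> B" "x \<in> B" for x y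
    using corner_coord_nonneg[OF that] by (simp add: less_eq_complex_def)
  have "Max (r ` ?D) \<in> r ` ?D" using fin ne by simp
  then obtain m where m: "m \<in> ?D" and rm: "r m = Max (r ` ?D)" by auto
  have max: "r y \<le> r m" if "y \<in> ?D" for y unfolding rm using fin that by simp
  have mB: "m \<in> B" using m double_coset_subset by blast
  have const: "r x = r m" if x: "x \<in> ?D" for x
  proof -
    have xB: "x \<in> B" using x double_coset_subset by auto
    have DB: "y \<in> B" if "y \<in> ?D" for y using that double_coset_subset by auto
    have "corner_coord z m = (\<Sum>y\<in>?D. corner_coord z y * corner_coord y m)"
    proof -
      have "(\<Sum>y\<in>?D. corner_coord z y * corner_coord y m) = (\<Sum>y\<in>B. corner_coord z y * corner_coord y m)"
        by (rule sum.mono_neutral_left[OF finite_basis double_coset_subset]) (auto simp: double_coset_iff[OF z])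
      also have "\<dots> = corner_coord z m" by (rule corner_coord_compose[OF z, symmetric])
      finally show ?thesis by (rule sym)
    qed
    \<comment> \<open>The weights \<open>corner_coord y m\<close> sum to \<open>1\<close> over the
      coset, so the value at \<open>m\<close> is a convex combination of values that do not exceed
      it. Every deficit with nonzero weight must vanish, and all weights on the coset are
      nonzero.\<close>
    then have "(\<Sum>y\<in>?D. corner_coord y m * (corner_coord z m - corner_coord z y))
      = (\<Sum>y\<in>?D. corner_coord y m) * corner_coord z m - corner_coord z m"
      by (simp add: right_diff_distrib sum_subtractf sum_distrib_right mult.commute)
    then have 0: "(\<Sum>y\<in>?D. corner_coord y m * (corner_coord z m - corner_coord z y)) = 0"
      using corner_coord_row_sum_double_coset[OF z m] by simp
    have "0 \<le> corner_coord y m * (corner_coord z m - corner_coord z y)" if y: "y \<in> ?D" for y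
    proof (rule mult_nonneg_nonneg)
      show "0 \<le> corner_coord y m" by (rule corner_coord_nonneg[OF DB[OF y] mB])
      show "0 \<le> corner_coord z m - corner_coord z y"
        using max[OF y] real[OF z mB] real[OF z DB[OF y]]
        by (simp add: r_def less_eq_complex_def)
    qed
    then have "(\<Sum>y\<in>?D. corner_coord y m * (corner_coord z m - corner_coord z y)) = 0
      \<longleftrightarrow> (\<forall>y\<in>?D. corner_coord y m * (corner_coord z m - corner_coord z y) = 0)"
      by (rule sum_nonneg_eq_0_iff[OF fin])
    then have "corner_coord x m * (corner_coord z m - corner_coord z x) = 0" using 0 x by blast
    moreover have "corner_coord x m \<noteq> 0"
      using double_coset_iff[OF xB, of m] double_coset_eq[OF z x] m by simp
    ultimately show ?thesis by (simp add: r_def)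
  qed
  have "e * z * e = corner_coord z m *\<^sub>C (\<Sum>x\<in>?D. x)"
  proof (rule basis_eqI)
    have DA: "(\<Sum>x\<in>?D. x) \<in> A" by (rule sum_in_carrier[OF double_coset_subset])
    show "e * z * e \<in> A" by (rule corner_carrier[OF basis_in_carrier[OF z]])
    show "corner_coord z m *\<^sub>C (\<Sum>x\<in>?D. x) \<in> A" by (rule subspace_scale[OF carrier_subspace DA])
    fix x assume x: "x \<in> B"
    have "corner_coord z x = corner_coord z m * (if x \<in> ?D then 1 else 0)"
    proof (cases "x \<in> ?D")
      case True
      then show ?thesis using const[OF True] real[OF z x] real[OF z mB] by (simp add: r_def complex_eq_iff)
    next
      case False
      then show ?thesis using double_coset_iff[OF z] x by simp
    qed
    then show "coord (e * z * e) x = coord (corner_coord z m *\<^sub>C (\<Sum>x\<in>?D. x)) x"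
      using coord_scale[OF DA] coord_sum_subset[OF double_coset_subset] by (simp add: corner_coord_def)
  qed
  then show ?thesis by blast
qed

subsection \<open>The corner algebra and its trace\<close>

definition corner :: "'a set" where
  "corner = {e * a * e | a. a \<in> A}"

abbreviation quotient :: "'a set" where
  "quotient \<equiv> quotient_basis u st B C"

lemma corner_subset: "corner \<subseteq> A"
  using corner_carrier by (auto simp: corner_def)

lemma corner_left: "x \<in> corner \<Longrightarrow> e * x = x"
  using e_idem by (auto simp: corner_def simp flip: mult.assoc)

lemma corner_right: "x \<in> corner \<Longrightarrow> x * e = x"
  using e_idem by (auto simp: corner_def mult.assoc)

lemma cornerI: "x \<in> A \<Longrightarrow> e * x = x \<Longrightarrow> x * e = x \<Longrightarrow> x \<in> corner"
  by (auto simp: corner_def intro!: exI[of _ x])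

lemma subspace_corner: "subspace corner"
proof (rule subspaceI)
  show "0 \<in> corner" by (rule cornerI) (simp_all add: subspace_0[OF carrier_subspace])
  show "x + y \<in> corner" if "x \<in> corner" "y \<in> corner" for x y
    using that corner_subset corner_left corner_right
    by (intro cornerI subspace_add[OF carrier_subspace]) (auto simp: distrib_left distrib_right)
  show "c *\<^sub>C x \<in> corner" if "x \<in> corner" for c x
    using that corner_subset corner_left corner_right
    by (intro cornerI subspace_scale[OF carrier_subspace]) (auto simp: scale_mult_left scale_mult_right)
qed

lemma quotient_elem_eq: "quotient_elem u st B C z = inverse total *\<^sub>C (\<Sum>x\<in>double_coset B C z. x)"
  by (simp add: quotient_elem_def total_def)

lemma quotient_elem_corner:
  assumes "z \<in> B" shows "quotient_elem u st B C z \<in> corner"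
proof -
  let ?s = "\<Sum>x\<in>double_coset B C z. x"
  have "?s \<in> corner"
    unfolding corner_def
    by (intro CollectI exI[of _ ?s] conjI corner_sum_double_coset[OF assms, symmetric]
        sum_in_carrier double_coset_subset)
  then show ?thesis unfolding quotient_elem_eq by (rule subspace_scale[OF subspace_corner])
qed

lemma span_quotient: "span quotient = corner"
proof
  show "span quotient \<subseteq> corner"
    by (rule span_minimal[OF _ subspace_corner]) (auto simp: quotient_basis_def quotient_elem_corner)
  show "corner \<subseteq> span quotient"
  proof
    fix x assume "x \<in> corner"
    then obtain a where a: "a \<in> A" "x = e * a * e" by (auto simp: corner_def)
    have "e * z * e \<in> span quotient" if z: "z \<in> B" for z
    proof -
      obtain M where "e * z * e = M *\<^sub>C (\<Sum>x\<in>double_coset B C z. x)" using corner_basis[OF z] by blast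
      then have "e * z * e = (M * total) *\<^sub>C quotient_elem u st B C z"
        using total_nonzero by (simp add: quotient_elem_eq)
      then show ?thesis using z by (simp add: quotient_basis_def span_scale span_base)
    qed
    then have "(\<Sum>z\<in>B. coord a z *\<^sub>C (e * z * e)) \<in> span quotient"
      by (intro span_sum span_scale)
    also have "(\<Sum>z\<in>B. coord a z *\<^sub>C (e * z * e)) = e * (\<Sum>z\<in>B. coord a z *\<^sub>C z) * e"
      by (simp add: sum_distrib_left sum_distrib_right scale_mult_left scale_mult_right)
    also have "\<dots> = x" using coord_expansion[OF a(1)] a(2) by simp
    finally show "x \<in> span quotient" .
  qed
qed

section \<open>Inner products and degrees of the quotient basis\<close>

lemma trace_sum_product:
  assumes S: "S \<subseteq> B" and T: "T \<subseteq> B"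
  shows "coord ((\<Sum>x\<in>S. x) * st (\<Sum>y\<in>T. y)) u = (\<Sum>x\<in>S \<inter> T. complex_of_real (deg x))"
proof -
  have fin: "finite S" "finite T" using S T finite_basis finite_subset by blast+
  have A: "x \<in> A" "x \<in> B" if "x \<in> S \<or> x \<in> T" for x using that S T basis_in_carrier by auto
  have "st (\<Sum>y\<in>T. y) = (\<Sum>y\<in>T. st y)"
    using star_linear_combination[OF fin(2) T, of "\<lambda>_. 1"] by simp
  then have "(\<Sum>x\<in>S. x) * st (\<Sum>y\<in>T. y) = (\<Sum>x\<in>S. \<Sum>y\<in>T. x * st y)" by (simp add: sum_product)
  also have "coord \<dots> u = (\<Sum>x\<in>S. coord (\<Sum>y\<in>T. x * st y) u)"
    by (rule coord_sum, rule subspace_sum[OF carrier_subspace])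
      (simp add: A mult_closed star_in_carrier)
  also have "\<dots> = (\<Sum>x\<in>S. \<Sum>y\<in>T. coord (x * st y) u)"
    by (intro sum.cong refl coord_sum) (simp add: A mult_closed star_in_carrier)
  also have "\<dots> = (\<Sum>x\<in>S. \<Sum>y\<in>T. if x = y then complex_of_real (deg x) else 0)"
    by (intro sum.cong refl) (simp add: coord_unit_mult A star_in_basis star_star_basis)
  also have "\<dots> = (\<Sum>x\<in>S. if x \<in> T then complex_of_real (deg x) else 0)"
    using fin by (intro sum.cong refl) simp
  also have "\<dots> = (\<Sum>x\<in>S \<inter> T. complex_of_real (deg x))"
    using fin(1) by (simp add: sum.inter_restrict)
  finally show ?thesis .
qed

lemma trace_quotient_product:
  assumes "z \<in> B" "y \<in> B"
  shows "coord (quotient_elem u st B C z * st (quotient_elem u st B C y)) u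
    = inverse (total * total) * (\<Sum>x\<in>double_coset B C z \<inter> double_coset B C y. complex_of_real (deg x))"
proof -
  let ?z = "\<Sum>x\<in>double_coset B C z. x" and ?y = "\<Sum>x\<in>double_coset B C y. x"
  have A: "?z \<in> A" "?y \<in> A" by (auto intro!: sum_in_carrier double_coset_subset)
  have "st (quotient_elem u st B C y) = inverse total *\<^sub>C st ?y"
    unfolding quotient_elem_eq star_scale[OF A(2)] by (simp add: total_def)
  then have "quotient_elem u st B C z * st (quotient_elem u st B C y) = inverse (total * total) *\<^sub>C (?z * st ?y)"
    by (simp add: quotient_elem_eq scale_mult_left scale_mult_right)
  then show ?thesis
    using coord_scale[OF mult_closed[OF A(1) star_in_carrier[OF A(2)]]]
      trace_sum_product[OF double_coset_subset double_coset_subset] by simp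
qed

lemma e_in_corner: "e \<in> corner"
  by (intro cornerI e_carrier e_idem)

text \<open>The identity is \<open>e\<close>, but the trace is still that of \<open>A\<close>.
  Orthogonality of \<open>quotient\<close> is the disjointness of double cosets, and the squared
  norms are degree sums divided by the square of \<open>total\<close>.\<close>

sublocale corner: tracial_star_algebra scale corner e st quotient "\<lambda>x. coord x u"
proof
  show "finite quotient" using finite_basis by (simp add: quotient_basis_def)
  show "span quotient = corner" by (rule span_quotient)
  show "x * y \<in> corner" if "x \<in> corner" "y \<in> corner" for x y
  proof (rule cornerI)
    show "x * y \<in> A" using that corner_subset mult_closed by blast
    show "e * (x * y) = x * y" by (simp only: mult.assoc[symmetric] corner_left[OF that(1)])
    show "x * y * e = x * y" by (simp only: mult.assoc corner_right[OF that(2)])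
  qed
  show "e \<in> corner" by (rule e_in_corner)
  show "e * x = x" "x * e = x" if "x \<in> corner" for x using that by (rule corner_left corner_right)+
  show "st x \<in> corner" if x: "x \<in> corner" for x
  proof (rule cornerI)
    have xA: "x \<in> A" using x corner_subset by blast
    show "st x \<in> A" by (rule star_in_carrier[OF xA])
    show "e * st x = st x" using star_mult[OF xA e_carrier] corner_right[OF x] star_e by simp
    show "st x * e = st x" using star_mult[OF e_carrier xA] corner_left[OF x] star_e by simp
  qed
  show "st (x + y) = st x + st y" "st (x * y) = st y * st x" if "x \<in> corner" "y \<in> corner" for x y
    using that by (simp_all add: star_add star_mult subsetD[OF corner_subset])
  show "st (k *\<^sub>C x) = cnj k *\<^sub>C st x" if "x \<in> corner" for k x using that corner_subset star_scale by auto
  show "st (st x) = x" if "x \<in> corner" for x using that corner_subset star_star by auto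
  show "functional_on corner (\<lambda>x. coord x u)"
    using coord_functional corner_subset unfolding functional_on_def by blast
  show "coord (x * y) u = coord (y * x) u" if "x \<in> corner" "y \<in> corner" for x y
    using that corner_subset coord_unit_commute by blast
  show "coord (st x) u = cnj (coord x u)" if "x \<in> corner" for x
    using that corner_subset trace.trace_star by blast
  show "coord (a * st b) u = 0" if ab: "a \<in> quotient" "b \<in> quotient" "a \<noteq> b" for a b
  proof -
    obtain z y where z: "z \<in> B" "a = quotient_elem u st B C z" and y: "y \<in> B" "b = quotient_elem u st B C y"
      using ab by (auto simp: quotient_basis_def)
    then have "double_coset B C z \<noteq> double_coset B C y" using ab(3) by (auto simp: quotient_elem_def)
    then have "double_coset B C z \<inter> double_coset B C y = {}" by (rule double_coset_disjoint[OF z(1) y(1)])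
    then show ?thesis using trace_quotient_product[OF z(1) y(1)] z y by simp
  qed
  show "0 < Re (coord (b * st b) u)" if b: "b \<in> quotient" for b
  proof -
    obtain z where z: "z \<in> B" "b = quotient_elem u st B C z" using b by (auto simp: quotient_basis_def)
    have fin: "finite (double_coset B C z)" using double_coset_subset finite_basis finite_subset by blast
    have "0 < (\<Sum>x\<in>double_coset B C z. deg x)"
      using fin double_coset_self[OF z(1)] double_coset_subset degree_pos by (intro sum_pos) auto
    moreover have "0 < inverse (set_degree u st B C * set_degree u st B C)"
      using total_pos by (simp add: total_def less_complex_def)
    moreover have "coord (b * st b) u = complex_of_real (inverse (set_degree u st B C * set_degree u st B C)
      * (\<Sum>x\<in>double_coset B C z. deg x))"
      using trace_quotient_product[OF z(1) z(1)] z by (simp add: total_def)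
    ultimately show ?thesis by (simp only: Re_complex_of_real mult_pos_pos)
  qed
qed

lemma quotient_elem_unit: "quotient_elem u st B C u = e"
  by (simp add: quotient_elem_eq double_coset_unit e_def)

lemma e_in_quotient: "e \<in> quotient"
  using quotient_elem_unit one_in_basis by (force simp: quotient_basis_def)

lemma trace_e: "coord e u = inverse total"
  using coord_scale[OF sum_in_carrier[OF subset_basis]] coord_sum_subset[OF subset_basis] unit_in_subset
  by (simp add: e_def)

text \<open>The coefficient of \<open>e\<close> is the inner product with \<open>e\<close> divided
  by the squared norm of \<open>e\<close>, and that norm is
  \<open>coord e u = inverse total\<close>.\<close>

lemma quotient_representation_unit:
  assumes x: "x \<in> corner"
  shows "representation quotient x e = coord x u * total"
proof -
  have "corner.weight e = inverse total"
    using corner.trace_basis[OF e_in_quotient e_in_quotient] star_e e_idem trace_e by simp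
  then show ?thesis
    using corner.representation_eq_trace[OF x e_in_quotient] corner_right[OF x] star_e by (simp add: field_simps)
qed

text \<open>In quotient notation, \<open>|b/C| = |(CbC)^+| / |C^+|\<close>: of the two factors
  \<open>inverse total\<close> in the inner product, one is absorbed by the normalisation of the
  coefficient of \<open>e\<close>.\<close>

lemma quotient_basis_degree:
  assumes z: "z \<in> B"
  shows "complex_of_real (basis_degree e st quotient (quotient_elem u st B C z))
    = inverse total * (\<Sum>x\<in>double_coset B C z. complex_of_real (deg x))"
proof -
  let ?d = "quotient_elem u st B C z"
  have d: "?d * st ?d \<in> corner"
    by (intro corner.mult_closed corner.star_closed quotient_elem_corner z)
  have "representation quotient (?d * st ?d) e = inverse total * (\<Sum>x\<in>double_coset B C z. complex_of_real (deg x))"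
    unfolding quotient_representation_unit[OF d] trace_quotient_product[OF z z] Int_absorb
    using total_nonzero by (simp add: field_simps)
  also have "\<dots> = complex_of_real (inverse (set_degree u st B C) * (\<Sum>x\<in>double_coset B C z. deg x))"
    by (simp add: total_def)
  finally have r: "representation quotient (?d * st ?d) e
    = complex_of_real (inverse (set_degree u st B C) * (\<Sum>x\<in>double_coset B C z. deg x))" .
  have "basis_degree e st quotient ?d = inverse (set_degree u st B C) * (\<Sum>x\<in>double_coset B C z. deg x)"
    unfolding basis_degree_def[of e st quotient] structure_const_def r by (rule Re_complex_of_real)
  then show ?thesis by (simp add: total_def)
qed

lemma quotient_set_degree:
  "complex_of_real (set_degree e st quotient quotient) = inverse total * complex_of_real (set_degree u st B B)"
proof -
  \<comment> \<open>Elements of one double coset give the same \<open>quotient_elem\<close>, so the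
    sum is indexed by the set \<open>K\<close> of double cosets, on which the assignment is
    injective.\<close>
  define K where "K = double_coset B C ` B"
  have fin: "finite k" if "k \<in> K" for k
    using that finite_subset[OF double_coset_subset finite_basis] by (auto simp: K_def)
  have UK: "\<Union> K = B" using double_coset_self double_coset_subset by (auto simp: K_def)
  have disj: "k \<inter> l = {}" if "k \<in> K" "l \<in> K" "k \<noteq> l" for k l
    using that double_coset_disjoint by (auto simp: K_def)
  define q where "q k = inverse total *\<^sub>C (\<Sum>x\<in>k. x)" for k
  have qK: "quotient = q ` K" by (simp add: quotient_basis_def K_def q_def quotient_elem_eq image_image)
  have inj: "inj_on q K"
  proof (rule inj_onI)
    fix k l assume k: "k \<in> K" and l: "l \<in> K" and "q k = q l"
    then have "(\<Sum>x\<in>k. x) = (\<Sum>x\<in>l. x)" using total_nonzero by (simp add: q_def)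
    moreover have "k \<subseteq> B" "l \<subseteq> B" using k l UK by auto
    ultimately show "k = l" using coord_sum_subset by (metis subset_antisym subsetI zero_neq_one)
  qed
  have "complex_of_real (set_degree e st quotient quotient)
    = (\<Sum>k\<in>K. complex_of_real (basis_degree e st quotient (q k)))"
    unfolding set_degree_def by (subst (2) qK) (simp add: sum.reindex[OF inj])
  also have "\<dots> = (\<Sum>k\<in>K. inverse total * (\<Sum>x\<in>k. complex_of_real (deg x)))"
  proof (rule sum.cong[OF refl])
    fix k assume "k \<in> K"
    then obtain z where "z \<in> B" "k = double_coset B C z" by (auto simp: K_def)
    then show "complex_of_real (basis_degree e st quotient (q k)) = inverse total * (\<Sum>x\<in>k. complex_of_real (deg x))"
      using quotient_basis_degree[of z] by (simp add: q_def quotient_elem_eq)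
  qed
  also have "\<dots> = inverse total * (\<Sum>k\<in>K. \<Sum>x\<in>k. complex_of_real (deg x))" by (simp add: sum_distrib_left)
  also have "(\<Sum>k\<in>K. \<Sum>x\<in>k. complex_of_real (deg x)) = (\<Sum>x\<in>\<Union>K. complex_of_real (deg x))"
    using sum.Union_disjoint[of K "\<lambda>x. complex_of_real (deg x)"] fin disj by simp
  also have "\<dots> = complex_of_real (set_degree u st B B)" by (simp add: UK set_degree_def)
  finally show ?thesis .
qed

lemma std_feasible_trace_quotient:
  assumes "x \<in> corner"
  shows "std_feasible_trace e st quotient x = std_feasible_trace u st B x"
  unfolding std_feasible_trace_def quotient_representation_unit[OF assms] quotient_set_degree
  using total_nonzero by simp

subsection \<open>Restriction of characters\<close>

text \<open>The corner acts on the range of the projection \<open>\<rho> e\<close>; compressing to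
  it does not change the trace, because \<open>\<rho> x\<close> maps into this range. Irreducibility
  is lifted from \<open>A\<close>: a subspace invariant under the corner is compared with a suitable
  subspace invariant under \<open>A\<close>.\<close>

lemma restrict_Irr:
  assumes \<chi>: "\<chi> \<in> Irr A u" and nz: "\<exists>x\<in>corner. \<chi> x \<noteq> 0"
  shows "restrict \<chi> corner \<in> Irr corner e"
proof -
  obtain n \<rho> where irr: "is_irreducible_rep A u n \<rho>" and "\<chi> \<in> extensional A" "0 < n"
    and tr: "\<forall>x\<in>A. \<chi> x = mat_trace (\<rho> x)" and "\<forall>x\<in>A. \<chi> x = (\<Sum>i<n. \<rho> x $$ (i,i))"
    by (rule trace.Irr_cases[OF \<chi>])
  have rep: "is_representation A u n \<rho>" using irr by (simp add: is_irreducible_rep_def)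
  have c: "\<rho> x \<in> carrier_mat n n" if "x \<in> A" for x using rep that by (auto simp: is_representation_def)
  have mult: "\<rho> (x * y) = \<rho> x * \<rho> y" if "x \<in> A" "y \<in> A" for x y
    using rep that by (auto simp: is_representation_def)
  have act: "\<rho> (x * y) *\<^sub>v v = \<rho> x *\<^sub>v (\<rho> y *\<^sub>v v)" if "x \<in> A" "y \<in> A" "v \<in> carrier_vec n" for x y v
    using mult[OF that(1,2)] assoc_mult_mat_vec[OF c[OF that(1)] c[OF that(2)] that(3)] by simp
  have rv: "\<rho> x *\<^sub>v v \<in> carrier_vec n" if "x \<in> A" "v \<in> carrier_vec n" for x v
    by (rule mult_mat_vec_carrier[OF c[OF that(1)] that(2)])
  note eA = e_carrier
  define W where "W = {v \<in> carrier_vec n. \<rho> e *\<^sub>v v = v}"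
  have WI: "\<rho> x *\<^sub>v v \<in> W" if x: "x \<in> A" "e * x = x" and v: "v \<in> carrier_vec n" for x v
    using act[OF eA x(1) v] rv[OF x(1) v] x(2) by (simp add: W_def)
  have W: "W \<subseteq> carrier_vec n" by (auto simp: W_def)
  have W0: "0\<^sub>v n \<in> W" using c[OF eA] by (auto simp: W_def intro!: eq_vecI)
  have Wadd: "v + w \<in> W" if "v \<in> W" "w \<in> W" for v w
    using that c[OF eA] by (auto simp: W_def mult_add_distrib_mat_vec[of _ n n])
  have Wsmult: "k \<cdot>\<^sub>v v \<in> W" if "v \<in> W" for k v
    using that c[OF eA] by (auto simp: W_def mult_mat_vec[of _ n n])
  obtain k S R where S: "S \<in> carrier_mat n k" and R: "R \<in> carrier_mat k n" and RS: "R * S = 1\<^sub>m k"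
    and SW': "\<forall>v\<in>carrier_vec k. S *\<^sub>v v \<in> W" and WS': "\<forall>w\<in>W. S *\<^sub>v (R *\<^sub>v w) = w"
    by (rule subspace_retraction[OF W W0 Wadd Wsmult])
  note SW = SW'[rule_format] and WS = WS'[rule_format]
  have Sv: "S *\<^sub>v v \<in> carrier_vec n" "\<rho> e *\<^sub>v (S *\<^sub>v v) = S *\<^sub>v v" if "v \<in> carrier_vec k" for v
    using SW[OF that] by (auto simp: W_def)
  have RSv: "R *\<^sub>v (S *\<^sub>v v) = v" if "v \<in> carrier_vec k" for v
    using assoc_mult_mat_vec[OF R S that] RS that by simp
  have cx: "x \<in> A" "e * x = x" "x * e = x" if "x \<in> corner" for x
    using that corner_subset corner_left corner_right by auto
  define \<pi> where "\<pi> x = R * (\<rho> x * S)" for x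
  have \<pi>v: "\<pi> x *\<^sub>v v = R *\<^sub>v (\<rho> x *\<^sub>v (S *\<^sub>v v))" if "x \<in> A" "v \<in> carrier_vec k" for x v
    using assoc_mult_mat_vec[OF R mult_carrier_mat[OF c[OF that(1)] S] that(2)]
      assoc_mult_mat_vec[OF c[OF that(1)] S that(2)] by (simp add: \<pi>_def)
  have rep\<pi>: "is_representation corner e k \<pi>"
    unfolding \<pi>_def
  proof (rule compressed_representation[OF _ _ _ _ S R])
    show "\<rho> x \<in> carrier_mat n n" if "x \<in> corner" for x by (rule c[OF cx(1)[OF that]])
    show "\<rho> (x + y) = \<rho> x + \<rho> y" if "x \<in> corner" "y \<in> corner" for x y
      using rep cx(1)[OF that(1)] cx(1)[OF that(2)] by (simp add: is_representation_def)
    show "\<rho> (c *\<^sub>C x) = c \<cdot>\<^sub>m \<rho> x" if "x \<in> corner" for c x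
      using rep cx(1)[OF that] by (simp add: is_representation_def)
    show "\<rho> (x * y) = \<rho> x * \<rho> y" if "x \<in> corner" "y \<in> corner" for x y
      by (rule mult[OF cx(1)[OF that(1)] cx(1)[OF that(2)]])
    show "S *\<^sub>v (R *\<^sub>v (\<rho> x *\<^sub>v (S *\<^sub>v v))) = \<rho> x *\<^sub>v (S *\<^sub>v v)" if "x \<in> corner" "v \<in> carrier_vec k" for x v
      by (rule WS[OF WI[OF cx(1)[OF that(1)] cx(2)[OF that(1)] Sv(1)[OF that(2)]]])
    have "\<rho> e * S = S"
    proof (rule mat_eq_if_mult_vec_eq[OF mult_carrier_mat[OF c[OF eA] S] S])
      show "(\<rho> e * S) *\<^sub>v v = S *\<^sub>v v" if "v \<in> carrier_vec k" for v
        using assoc_mult_mat_vec[OF c[OF eA] S that] Sv(2)[OF that] by simp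
    qed
    then show "R * (\<rho> e * S) = 1\<^sub>m k" using RS by simp
  qed
  have trace\<pi>: "mat_trace (\<pi> x) = \<chi> x" if x: "x \<in> corner" for x
  proof -
    note cc = c[OF cx(1)[OF x]]
    have "S * (R * \<rho> x) = \<rho> x"
    proof (rule mat_eq_if_mult_vec_eq[of _ n n])
      show "S * (R * \<rho> x) \<in> carrier_mat n n" using S R cc by simp
      show "\<rho> x \<in> carrier_mat n n" by (rule cc)
      fix v :: "complex vec" assume v: "v \<in> carrier_vec n"
      have "(S * (R * \<rho> x)) *\<^sub>v v = S *\<^sub>v (R *\<^sub>v (\<rho> x *\<^sub>v v))"
        using assoc_mult_mat_vec[OF S mult_carrier_mat[OF R cc] v] assoc_mult_mat_vec[OF R cc v] by simp
      also have "\<dots> = \<rho> x *\<^sub>v v" by (rule WS[OF WI[OF cx(1,2)[OF x] v]])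
      finally show "(S * (R * \<rho> x)) *\<^sub>v v = \<rho> x *\<^sub>v v" .
    qed
    moreover have "mat_trace (S * (R * \<rho> x)) = mat_trace ((R * \<rho> x) * S)"
      by (rule mat_trace_mult_comm[OF S mult_carrier_mat[OF R cc]])
    moreover have "(R * \<rho> x) * S = \<pi> x" unfolding \<pi>_def by (rule assoc_mult_mat[OF R cc S])
    ultimately show ?thesis using tr cx(1)[OF x] by simp
  qed
  have "is_irreducible_rep corner e k \<pi>"
    unfolding is_irreducible_rep_def
  proof (intro conjI allI impI)
    show "is_representation corner e k \<pi>" by (rule rep\<pi>)
    show "0 < k"
    proof (rule ccontr)
      assume "\<not> 0 < k"
      then have "mat_trace (\<pi> x) = 0" for x using R by (simp add: mat_trace_def \<pi>_def)
      then show False using nz trace\<pi> by auto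
    qed
    fix U assume "VectorSpace.subspace class_ring U (module_vec TYPE(complex) k)"
      and Uinv: "\<forall>x\<in>corner. \<forall>w\<in>U. \<pi> x *\<^sub>v w \<in> U"
    then have U: "U \<subseteq> carrier_vec k" "0\<^sub>v k \<in> U" "\<And>v w. v \<in> U \<Longrightarrow> w \<in> U \<Longrightarrow> v + w \<in> U"
      "\<And>c v. v \<in> U \<Longrightarrow> c \<cdot>\<^sub>v v \<in> U" unfolding subspace_module_vec_iff by auto
    have ea: "e * a \<in> A" if "a \<in> A" for a by (rule mult_closed[OF eA that])
    \<comment> \<open>The largest \<open>A\<close>-submodule whose image under
      \<open>\<rho> e\<close> lies in the copy of \<open>U\<close> inside the range of
      \<open>S\<close>. It is invariant because \<open>a\<close> ranges over all of
      \<open>A\<close>, so that \<open>a * b\<close> is again admissible.\<close>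
    define X where "X = {v \<in> carrier_vec n. \<forall>a\<in>A. R *\<^sub>v (\<rho> (e * a) *\<^sub>v v) \<in> U}"
    have "X = {0\<^sub>v n} \<or> X = carrier_vec n"
    proof (rule irreducible_rep_subspace[OF irr])
      show "X \<subseteq> carrier_vec n" by (auto simp: X_def)
      show "0\<^sub>v n \<in> X"
      proof -
        have "R *\<^sub>v (\<rho> (e * a) *\<^sub>v 0\<^sub>v n) = 0\<^sub>v k" if "a \<in> A" for a
        proof -
          have "\<rho> (e * a) *\<^sub>v 0\<^sub>v n = 0\<^sub>v n" using c[OF ea[OF that]] by (intro eq_vecI) auto
          then show ?thesis using R by (auto intro!: eq_vecI)
        qed
        then show ?thesis using U(2) by (simp add: X_def)
      qed
      show "v + w \<in> X" if "v \<in> X" "w \<in> X" for v w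
        unfolding X_def
      proof (intro CollectI conjI ballI)
        have vw: "v \<in> carrier_vec n" "w \<in> carrier_vec n" using that by (auto simp: X_def)
        then show "v + w \<in> carrier_vec n" by simp
        fix a assume a: "a \<in> A"
        have "R *\<^sub>v (\<rho> (e * a) *\<^sub>v (v + w)) = R *\<^sub>v (\<rho> (e * a) *\<^sub>v v) + R *\<^sub>v (\<rho> (e * a) *\<^sub>v w)"
          using mult_add_distrib_mat_vec[OF c[OF ea[OF a]] vw]
            mult_add_distrib_mat_vec[OF R rv[OF ea[OF a] vw(1)] rv[OF ea[OF a] vw(2)]] by simp
        then show "R *\<^sub>v (\<rho> (e * a) *\<^sub>v (v + w)) \<in> U" using U(3) that a by (simp add: X_def)
      qed
      show "d \<cdot>\<^sub>v v \<in> X" if "v \<in> X" for d v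
        unfolding X_def
      proof (intro CollectI conjI ballI)
        have v: "v \<in> carrier_vec n" using that by (auto simp: X_def)
        then show "d \<cdot>\<^sub>v v \<in> carrier_vec n" by simp
        fix a assume a: "a \<in> A"
        have "R *\<^sub>v (\<rho> (e * a) *\<^sub>v (d \<cdot>\<^sub>v v)) = d \<cdot>\<^sub>v (R *\<^sub>v (\<rho> (e * a) *\<^sub>v v))"
          using mult_mat_vec[OF c[OF ea[OF a]] v] mult_mat_vec[OF R rv[OF ea[OF a] v]] by simp
        then show "R *\<^sub>v (\<rho> (e * a) *\<^sub>v (d \<cdot>\<^sub>v v)) \<in> U" using U(4) that a by (simp add: X_def)
      qed
      show "\<rho> b *\<^sub>v v \<in> X" if b: "b \<in> A" and v: "v \<in> X" for b v
        unfolding X_def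
      proof (intro CollectI conjI ballI)
        have vc: "v \<in> carrier_vec n" using v by (auto simp: X_def)
        then show "\<rho> b *\<^sub>v v \<in> carrier_vec n" by (rule rv[OF b])
        fix a assume a: "a \<in> A"
        have "\<rho> (e * a) *\<^sub>v (\<rho> b *\<^sub>v v) = \<rho> (e * (a * b)) *\<^sub>v v"
          using act[OF ea[OF a] b vc] by (simp add: mult.assoc)
        then show "R *\<^sub>v (\<rho> (e * a) *\<^sub>v (\<rho> b *\<^sub>v v)) \<in> U" using v mult_closed[OF a b] by (simp add: X_def)
      qed
    qed
    then show "U = {0\<^sub>v k} \<or> U = carrier_vec k"
    proof
      assume X: "X = {0\<^sub>v n}"
      \<comment> \<open>\<open>S\<close> embeds \<open>U\<close> into \<open>X\<close>, because
        \<open>e * a * e\<close> lies in the corner and \<open>\<rho> e\<close> fixes the range of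
        \<open>S\<close>. So \<open>X\<close> being zero forces \<open>U\<close> to be zero.\<close>
      have "w = 0\<^sub>v k" if w: "w \<in> U" for w
      proof -
        have wc: "w \<in> carrier_vec k" using w U(1) by blast
        have "S *\<^sub>v w \<in> X"
          unfolding X_def
        proof (intro CollectI conjI ballI)
          show "S *\<^sub>v w \<in> carrier_vec n" by (rule Sv(1)[OF wc])
          fix a assume a: "a \<in> A"
          have eae: "e * a * e \<in> corner" using a by (auto simp: corner_def)
          have "\<rho> (e * a) *\<^sub>v (S *\<^sub>v w) = \<rho> (e * a * e) *\<^sub>v (S *\<^sub>v w)"
            using act[OF ea[OF a] eA Sv(1)[OF wc]] Sv(2)[OF wc] by simp
          then have "R *\<^sub>v (\<rho> (e * a) *\<^sub>v (S *\<^sub>v w)) = \<pi> (e * a * e) *\<^sub>v w"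
            using \<pi>v[OF cx(1)[OF eae] wc] by simp
          then show "R *\<^sub>v (\<rho> (e * a) *\<^sub>v (S *\<^sub>v w)) \<in> U" using Uinv eae w by simp
        qed
        then have "R *\<^sub>v (S *\<^sub>v w) = R *\<^sub>v 0\<^sub>v n" using X by simp
        then show ?thesis using RSv[OF wc] R by (auto intro: eq_vecI)
      qed
      then show ?thesis using U(2) by blast
    next
      assume X: "X = carrier_vec n"
      \<comment> \<open>The choice \<open>a = u\<close> recovers \<open>R (S v) = v\<close>, so
        \<open>U\<close> is everything.\<close>
      have "v \<in> U" if v: "v \<in> carrier_vec k" for v
      proof -
        have "S *\<^sub>v v \<in> X" using X Sv(1)[OF v] by simp
        then have "R *\<^sub>v (\<rho> (e * u) *\<^sub>v (S *\<^sub>v v)) \<in> U" using basis_in_carrier[OF one_in_basis] by (simp add: X_def)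
        then show ?thesis using one_right[OF eA] Sv(2)[OF v] RSv[OF v] by simp
      qed
      then show ?thesis using U(1) by blast
    qed
  qed
  moreover have "restrict \<chi> corner = restrict (\<lambda>x. mat_trace (\<pi> x)) corner"
    by (rule restrict_ext) (simp add: trace\<pi>)
  ultimately show ?thesis unfolding Irr_def by blast
qed

text \<open>For distinct characters the sum of
  \<open>\<chi> b * \<psi> (st b * e) / weight b\<close> is zero. But
  \<open>\<psi> (st b * e) = \<psi> (e * st b * e)\<close> depends only on the restriction, so
  \<open>\<psi>\<close> may be replaced by \<open>\<chi>\<close> there, and the resulting self
  product is nonzero.\<close>

lemma restrict_Irr_inj:
  assumes \<chi>: "\<chi> \<in> Irr A u" and \<psi>: "\<psi> \<in> Irr A u" and nz: "\<exists>x\<in>corner. \<chi> x \<noteq> 0"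
    and eq: "\<And>x. x \<in> corner \<Longrightarrow> \<chi> x = \<psi> x"
  shows "\<chi> = \<psi>"
proof (rule ccontr)
  assume neq: "\<chi> \<noteq> \<psi>"
  \<comment> \<open>A nonzero restriction is an irreducible character of the corner, hence nonzero
    at the identity \<open>e\<close>.\<close>
  have "restrict \<chi> corner e \<noteq> 0" by (rule corner.Irr_one_nonzero[OF restrict_Irr[OF \<chi> nz]])
  then have \<chi>e: "\<chi> e \<noteq> 0" using e_in_corner by simp
  have "\<chi> (st b * e) = \<psi> (st b * e)" if b: "b \<in> B" for b
  proof -
    have A: "st b \<in> A" "st b * e \<in> A" using b basis_in_carrier star_in_carrier mult_closed e_carrier by auto
    have swap: "\<phi> (st b * e) = \<phi> (e * st b * e)" if "\<phi> \<in> Irr A u" for \<phi>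
      using trace.Irr_mult_commute[OF that A(2) e_carrier] by (simp add: mult.assoc e_idem)
    have "e * st b * e \<in> corner" using A(1) by (auto simp: corner_def)
    then show ?thesis unfolding swap[OF \<chi>] swap[OF \<psi>] by (rule eq)
  qed
  then have "(\<Sum>b\<in>B. \<chi> b * \<chi> (st b * e) / trace.weight b) = (\<Sum>b\<in>B. \<chi> b * \<psi> (st b * e) / trace.weight b)"
    by (intro sum.cong) auto
  also have "\<dots> = 0" by (rule trace.Irr_orthogonal[OF \<chi> \<psi> neq e_carrier])
  finally show False using trace.Irr_self_product_nonzero[OF \<chi> e_carrier e_idem star_e \<chi>e] by simp
qed

lemma std_feasible_mult_quotient:
  assumes \<chi>: "\<chi> \<in> Irr A u" and nz: "\<exists>x\<in>corner. \<chi> x \<noteq> 0"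
  shows "std_feasible_mult corner e st quotient (restrict \<chi> corner) = std_feasible_mult A u st B \<chi>"
proof -
  let ?t = "std_feasible_trace u st B"
  have "functional_on A ?t"
    unfolding std_feasible_trace_def functional_on_def by (simp add: coord_add coord_scale distrib_right)
  moreover have "?t (x * y) = ?t (y * x)" if "x \<in> A" "y \<in> A" for x y
    using coord_unit_commute[OF that] by (simp add: std_feasible_trace_def)
  ultimately obtain m where m: "\<forall>x\<in>A. ?t x = (\<Sum>\<chi>\<in>Irr A u. m \<chi> * \<chi> x)"
    using trace.trace_functional_decomposition by blast
  have mA: "std_feasible_mult A u st B = restrict m (Irr A u)"
    by (rule trace.std_feasible_mult_eqI) (use m in auto)
  define F where "F = {\<chi> \<in> Irr A u. \<exists>x\<in>corner. \<chi> x \<noteq> 0}"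
  define r where "r = (\<lambda>\<chi>::'a \<Rightarrow> complex. restrict \<chi> corner)"
  have inj: "inj_on r F"
  proof (rule inj_onI)
    fix \<phi> \<psi> assume F: "\<phi> \<in> F" "\<psi> \<in> F" and "r \<phi> = r \<psi>"
    then have "\<phi> x = \<psi> x" if "x \<in> corner" for x using that by (metis r_def restrict_apply')
    then show "\<phi> = \<psi>" using F by (intro restrict_Irr_inj) (auto simp: F_def)
  qed
  have rF: "r ` F \<subseteq> Irr corner e" using restrict_Irr by (auto simp: r_def F_def)
  \<comment> \<open>Irreducible characters of the corner that do not arise by restriction from
    \<open>F\<close> receive the coefficient \<open>0\<close>; uniqueness of the decomposition on
    the corner justifies this choice.\<close>
  define m' where "m' = restrict (\<lambda>\<psi>. if \<psi> \<in> r ` F then m (the_inv_into F r \<psi>) else 0) (Irr corner e)"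
  have m'r: "m' (r \<phi>) = m \<phi>" if "\<phi> \<in> F" for \<phi>
    using that rF the_inv_into_f_f[OF inj that] by (auto simp: m'_def)
  have "std_feasible_mult corner e st quotient = m'"
  proof (rule corner.std_feasible_mult_eqI)
    show "m' \<in> extensional (Irr corner e)" by (simp add: m'_def)
    fix x assume x: "x \<in> corner"
    have "std_feasible_trace e st quotient x = (\<Sum>\<chi>\<in>Irr A u. m \<chi> * \<chi> x)"
      using std_feasible_trace_quotient[OF x] m x corner_subset by auto
    also have "\<dots> = (\<Sum>\<chi>\<in>F. m \<chi> * \<chi> x)"
      by (rule sum.mono_neutral_right[OF trace.finite_Irr]) (use x in \<open>auto simp: F_def\<close>)
    also have "\<dots> = (\<Sum>\<chi>\<in>F. m' (r \<chi>) * r \<chi> x)"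
      by (intro sum.cong refl) (use x m'r in \<open>simp add: r_def\<close>)
    also have "\<dots> = (\<Sum>\<psi>\<in>r ` F. m' \<psi> * \<psi> x)"
      by (simp add: sum.reindex[OF inj])
    also have "\<dots> = (\<Sum>\<psi>\<in>Irr corner e. m' \<psi> * \<psi> x)"
      by (rule sum.mono_neutral_left[OF corner.finite_Irr rF]) (auto simp: m'_def)
    finally show "std_feasible_trace e st quotient x = (\<Sum>\<psi>\<in>Irr corner e. m' \<psi> * \<psi> x)" .
  qed
  moreover have "\<chi> \<in> F" using \<chi> nz by (simp add: F_def)
  ultimately show ?thesis using m'r[of \<chi>] mA \<chi> by (simp add: r_def)
qed

end

theorem theorem3p7:
  fixes scale :: "complex \<Rightarrow> 'a::ring \<Rightarrow> 'a"
    and A B C H :: "'a set" and u e :: 'a and st :: "'a \<Rightarrow> 'a"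
    and \<chi> :: "'a \<Rightarrow> complex"
  assumes "table_algebra scale A u st B"
    and "complex_algebra.closed_subset scale st B C"
    and "e = scale (complex_of_real (inverse (complex_algebra.set_degree scale u st B C))) (\<Sum>c\<in>C. c)"
    and "H = {e * a * e | a. a \<in> A}"
    and "\<chi> \<in> complex_algebra.Irr scale A u"
    and "\<exists>x\<in>H. \<chi> x \<noteq> 0"
  shows "complex_algebra.std_feasible_mult scale H e st
           (complex_algebra.quotient_basis scale u st B C) (restrict \<chi> H)
         = complex_algebra.std_feasible_mult scale A u st B \<chi>"
proof -
  interpret table_algebra scale A u st B by (rule assms(1))
  interpret Q: table_algebra_closed_subset scale A u st B C
    by unfold_locales (rule assms(2))
  have e: "e = Q.e" by (simp add: assms(3) Q.e_def Q.total_def)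
  have H: "H = Q.corner" by (simp add: assms(4) e Q.corner_def)
  show ?thesis
    unfolding e H by (rule Q.std_feasible_mult_quotient) (use assms(5,6) H in auto)
qed

end
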